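(* For every $n\in\mathbb{N}$: $\mathrm{NE}^{ap}_{\mathfrak{D}_{n+1}\cup\overline{\mathfrak{D}_{n+1}}}\equiv_W\mathrm{C}_{\{0,1\}^\mathbb{N}}^{[n]}\times\left(\mathrm{LPO}^{[n]}\right)^*$.
   Context: $f\leq_W g$ iff there are computable partial $K,H$ on $\mathbb{N}^\mathbb{N}$ such that for every realizer $G$ of $g$, $p\mapsto K(\langle p,G(H(p))\rangle)$ realizes $f$ (realizers $F$ of $f:X\rightrightarrows Y$ on represented spaces $(X,\delta_X)$ satisfy $\delta_Y(F(p))\in f(\delta_X(p))$). $\times$ product; $f^*$: $f^0=\mathrm{id}$, $f^{n+1}=f\times f^n$, $f^*(n,x)=f^n(x)$. $\lim(p)(n)=\lim_i p(\langle n,i\rangle)$; jump $(X,\delta_X)'=(X,\delta_X\circ\lim)$, $X^{(n)}$ the $n$-fold jump; $f^{[n]}:X^{(n)}\rightrightarrows Y$ is $f$ with input space replaced by its $n$-th jump. $\mathrm{LPO}(p)=1$ iff $p=0^\mathbb{N}$. $\mathrm{C}_{\{0,1\}^\mathbb{N}}$ maps a nonempty closed subset of $\{0,1\}^\mathbb{N}$ (named by an enumeration of cylinders covering its complement) to any element. $\mathfrak{D}_m$: sets $D\subseteq\{0,1\}^\mathbb{N}$ for which there are open $U_0,\ldots,U_{m-1}$ with $x\in D\iff\min\{\beta\mid x\in U_\beta\}\not\equiv m\pmod2$ ($\min\emptyset=m$), named by names of the $U_i$; $\overline{\mathfrak{D}_m}$: complements, same names; the union class is named by a tag and a name. Games: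 two-player infinite sequential games with choices $\{0,1\}$, turn function $d$, finitely many outcomes, valuation $v$, linear antagonistic preferences ($\prec_1=\prec_2^{-1}$); strategy profiles $s:\{0,1\}^*\to\{0,1\}$; Nash equilibrium: no player can unilaterally deviate to a strictly preferred outcome. $\mathrm{NE}^{ap}_\Gamma$ takes such a game, named by the number of outcomes, $d$ and preferences as tables, and for each player and each upper set $U$ w.r.t. its preference a $\Gamma$-name of $v^{-1}(U)$, and outputs any Nash equilibrium. *)

theory Defs
  imports Main "HOL-Library.Nat_Bijection"
begin

type_synonym baire = "nat \<Rightarrow> nat"
type_synonym cantor = "nat \<Rightarrow> bool"

(* a representation, given as the relation "p is a name of x" *)
type_synonym 'a rep = "baire \<Rightarrow> 'a \<Rightarrow> bool"

(* a multi-valued problem f : X =>> Y on represented spaces; dom f = {x. f x \<noteq> {}} *)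
type_synonym ('a, 'b) prob = "('a \<Rightarrow> 'b set) \<times> 'a rep \<times> 'b rep"

datatype rterm = RZ | RS | RP nat | RO | RC rterm "rterm list" | RR rterm rterm | RM rterm

inductive reval :: "baire \<Rightarrow> rterm \<Rightarrow> nat list \<Rightarrow> nat \<Rightarrow> bool" for p :: baire where
  zero: "reval p RZ xs 0"
| succ: "reval p RS (x # xs) (Suc x)"
| proj: "i < length xs \<Longrightarrow> reval p (RP i) xs (xs ! i)"
| orcl: "reval p RO (x # xs) (p x)"
| comp: "length ys = length gs \<Longrightarrow> (\<forall>i < length gs. reval p (gs ! i) xs (ys ! i))
          \<Longrightarrow> reval p f ys z \<Longrightarrow> reval p (RC f gs) xs z"
| prec0: "reval p f xs z \<Longrightarrow> reval p (RR f g) (0 # xs) z"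
| precS: "reval p (RR f g) (n # xs) y \<Longrightarrow> reval p g (n # y # xs) z
          \<Longrightarrow> reval p (RR f g) (Suc n # xs) z"
| mu: "reval p f (n # xs) 0 \<Longrightarrow> (\<forall>m < n. \<exists>y. 0 < y \<and> reval p f (m # xs) y)
          \<Longrightarrow> reval p (RM f) xs n"

definition computes :: "rterm \<Rightarrow> baire \<Rightarrow> baire \<Rightarrow> bool" where
  "computes t p q \<longleftrightarrow> (\<forall>n. reval p t [n] (q n))"

definition bpair :: "baire \<Rightarrow> baire \<Rightarrow> baire" where
  "bpair p q = (\<lambda>n. if even n then p (n div 2) else q (n div 2))"

definition bfst :: "baire \<Rightarrow> baire" where "bfst p = (\<lambda>n. p (2 * n))"
definition bsnd :: "baire \<Rightarrow> baire" where "bsnd p = (\<lambda>n. p (2 * n + 1))"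

definition bcomp :: "baire \<Rightarrow> nat \<Rightarrow> baire" where
  "bcomp p i = (\<lambda>m. p (prod_encode (i, m)))"

definition realizer :: "('a, 'b) prob \<Rightarrow> (baire \<Rightarrow> baire) \<Rightarrow> bool" where
  "realizer P G \<longleftrightarrow> (case P of (f, dX, dY) \<Rightarrow>
     \<forall>p x. dX p x \<and> f x \<noteq> {} \<longrightarrow> (\<exists>y. dY (G p) y \<and> y \<in> f x))"

definition weihrauch_le :: "('a, 'b) prob \<Rightarrow> ('c, 'd) prob \<Rightarrow> bool" (infix "\<le>\<^sub>W" 50) where
  "P \<le>\<^sub>W Q \<longleftrightarrow> (case P of (f, dX, dY) \<Rightarrow> case Q of (g, dZ, dU) \<Rightarrow>
     \<exists>tH tK. \<forall>G. realizer Q G \<longrightarrow>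
       (\<forall>p x. dX p x \<and> f x \<noteq> {} \<longrightarrow>
          (\<exists>h. computes tH p h \<and> (\<exists>z. dZ h z \<and> g z \<noteq> {}) \<and>
             (\<exists>k. computes tK (bpair p (G h)) k \<and> (\<exists>y. dY k y \<and> y \<in> f x)))))"

definition weihrauch_eq :: "('a, 'b) prob \<Rightarrow> ('c, 'd) prob \<Rightarrow> bool" (infix "\<equiv>\<^sub>W" 50) where
  "P \<equiv>\<^sub>W Q \<longleftrightarrow> P \<le>\<^sub>W Q \<and> Q \<le>\<^sub>W P"

definition prod_rep :: "'a rep \<Rightarrow> 'b rep \<Rightarrow> ('a \<times> 'b) rep" where
  "prod_rep dX dY p xy \<longleftrightarrow> dX (bfst p) (fst xy) \<and> dY (bsnd p) (snd xy)"

definition prod_prob :: "('a, 'b) prob \<Rightarrow> ('c, 'd) prob \<Rightarrow> ('a \<times> 'c, 'b \<times> 'd) prob" where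
  "prod_prob P Q = (case P of (f, dX, dY) \<Rightarrow> case Q of (g, dZ, dU) \<Rightarrow>
     (\<lambda>(x, z). f x \<times> g z, prod_rep dX dZ, prod_rep dY dU))"

(* X^* = disjoint union of the X^n, as lists; name: p 0 = n, i-th entry named by \<lambda>k. p (1 + <i,k>) *)
definition tuple_rep :: "'a rep \<Rightarrow> 'a list rep" where
  "tuple_rep d p xs \<longleftrightarrow> p 0 = length xs \<and>
     (\<forall>i < length xs. d (\<lambda>k. p (Suc (prod_encode (i, k)))) (xs ! i))"

definition star_prob :: "('a, 'b) prob \<Rightarrow> ('a list, 'b list) prob" where
  "star_prob P = (case P of (f, dX, dY) \<Rightarrow>
     (\<lambda>xs. {ys. length ys = length xs \<and> (\<forall>i < length xs. ys ! i \<in> f (xs ! i))},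
      tuple_rep dX, tuple_rep dY))"

definition lim_rel :: "baire \<Rightarrow> baire \<Rightarrow> bool" where
  "lim_rel p q \<longleftrightarrow> (\<forall>n. \<exists>i0. \<forall>i \<ge> i0. p (prod_encode (n, i)) = q n)"

definition jump_rep :: "'a rep \<Rightarrow> 'a rep" where
  "jump_rep d p x \<longleftrightarrow> (\<exists>q. lim_rel p q \<and> d q x)"

definition jump_prob :: "nat \<Rightarrow> ('a, 'b) prob \<Rightarrow> ('a, 'b) prob" where
  "jump_prob n P = (case P of (f, dX, dY) \<Rightarrow> (f, (jump_rep ^^ n) dX, dY))"

definition baire_rep :: "baire rep" where "baire_rep p q \<longleftrightarrow> p = q"
definition nat_rep :: "nat rep" where "nat_rep p n \<longleftrightarrow> p 0 = n"
definition cantor_rep :: "cantor rep" where "cantor_rep p x \<longleftrightarrow> (\<forall>i. p i = of_bool (x i))"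

definition LPO :: "(baire, nat) prob" where
  "LPO = (\<lambda>p. {if p = (\<lambda>_. 0) then 1 else 0}, baire_rep, nat_rep)"

definition cyl :: "nat list \<Rightarrow> cantor set" where
  "cyl ws = {x. \<forall>i < length ws. x i = (ws ! i \<noteq> 0)}"

(* open set enumerated by p: p i = 0 means "nothing", p i = c+1 means cylinder of list_decode c *)
definition open_of :: "baire \<Rightarrow> cantor set" where
  "open_of p = {x. \<exists>i. 0 < p i \<and> x \<in> cyl (list_decode (p i - 1))}"

definition closed_rep :: "cantor set rep" where
  "closed_rep p A \<longleftrightarrow> A = - open_of p"

definition C_cantor :: "(cantor set, cantor) prob" where
  "C_cantor = (\<lambda>A. A, closed_rep, cantor_rep)"

definition first_idx :: "nat \<Rightarrow> baire \<Rightarrow> cantor \<Rightarrow> nat" where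
  "first_idx m p x = (if \<exists>b < m. x \<in> open_of (bcomp p b)
                      then (LEAST b. b < m \<and> x \<in> open_of (bcomp p b)) else m)"

definition Dm_set :: "nat \<Rightarrow> baire \<Rightarrow> cantor set" where
  "Dm_set m p = {x. first_idx m p x mod 2 \<noteq> m mod 2}"

definition gamma_rep :: "nat \<Rightarrow> cantor set rep" where
  "gamma_rep m p D \<longleftrightarrow>
     (p 0 = 0 \<and> D = Dm_set m (\<lambda>k. p (Suc k))) \<or> (p 0 = 1 \<and> D = - Dm_set m (\<lambda>k. p (Suc k)))"

(* game: (number of outcomes k, turn function d (True = player 1), strict preference of player 1
   on {0..<k}, valuation v) ; player 2's preference is the converse *)
type_synonym game = "nat \<times> (bool list \<Rightarrow> bool) \<times> (nat \<Rightarrow> nat \<Rightarrow> bool) \<times> (cantor \<Rightarrow> nat)"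

definition prefp :: "(nat \<Rightarrow> nat \<Rightarrow> bool) \<Rightarrow> bool \<Rightarrow> nat \<Rightarrow> nat \<Rightarrow> bool" where
  "prefp pr i a b = (if i then pr a b else pr b a)"

definition valid_game :: "game \<Rightarrow> bool" where
  "valid_game G \<longleftrightarrow> (case G of (k, d, pr, v) \<Rightarrow>
     (\<forall>x. v x < k) \<and> (\<forall>a b. pr a b \<longrightarrow> a < k \<and> b < k) \<and>
     (\<forall>a. \<not> pr a a) \<and> (\<forall>a b c. pr a b \<longrightarrow> pr b c \<longrightarrow> pr a c) \<and>
     (\<forall>a < k. \<forall>b < k. a \<noteq> b \<longrightarrow> pr a b \<or> pr b a))"

definition upper_set :: "nat \<Rightarrow> (nat \<Rightarrow> nat \<Rightarrow> bool) \<Rightarrow> bool \<Rightarrow> nat set \<Rightarrow> bool" where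
  "upper_set k pr i U \<longleftrightarrow> U \<subseteq> {..<k} \<and> (\<forall>a \<in> U. \<forall>b < k. prefp pr i a b \<longrightarrow> b \<in> U)"

(* finite 0/1 words coded by naturals (surjective coding) *)
definition word :: "nat \<Rightarrow> bool list" where
  "word j = map (\<lambda>c. c \<noteq> 0) (list_decode j)"

definition game_rep :: "nat \<Rightarrow> game rep" where
  "game_rep m p G \<longleftrightarrow> valid_game G \<and> (case G of (k, d, pr, v) \<Rightarrow>
     bcomp p 0 0 = k \<and>
     (\<forall>j. bcomp p 1 j = of_bool (d (word j))) \<and>
     (\<forall>a < k. \<forall>b < k. bcomp p 2 (prod_encode (a, b)) = of_bool (pr a b)) \<and>
     (\<forall>i U. upper_set k pr i U \<longrightarrow>
        gamma_rep m (bcomp (bcomp p 3) (prod_encode (of_bool i, set_encode U))) {x. v x \<in> U}))"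

type_synonym strategy = "bool list \<Rightarrow> bool"

definition strat_rep :: "strategy rep" where
  "strat_rep p s \<longleftrightarrow> (\<forall>j. p j = of_bool (s (word j)))"

fun hist :: "strategy \<Rightarrow> nat \<Rightarrow> bool list" where
  "hist s 0 = []"
| "hist s (Suc n) = hist s n @ [s (hist s n)]"

definition play :: "strategy \<Rightarrow> cantor" where
  "play s = (\<lambda>n. s (hist s n))"

definition is_NE :: "game \<Rightarrow> strategy \<Rightarrow> bool" where
  "is_NE G s \<longleftrightarrow> (case G of (k, d, pr, v) \<Rightarrow>
     \<forall>i s'. (\<forall>w. d w \<noteq> i \<longrightarrow> s' w = s w) \<longrightarrow> \<not> prefp pr i (v (play s)) (v (play s')))"

definition NE_ap :: "nat \<Rightarrow> (game, strategy) prob" where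
  "NE_ap m = (\<lambda>G. {s. is_NE G s}, game_rep m, strat_rep)"

end

theory Submission
  imports Defs
begin

text \<open>
  A set in the difference hierarchy colours the positions of the binary tree: as more of the open sets
  \<open>U\<^sub>i\<close> recognise a position, its colour decreases, and the final colour of a play decides membership.
  Such a weak parity game is solved colour by colour. Reaching a winning position of smaller colour is
  an open condition relative to the solution for the smaller colours, so with colours \<open>0, \<dots>, n + 1\<close> all
  that is needed is computable from the \<open>n\<close>-th jump of the name, up to one last unbounded search: LPO
  tells who wins, and closed choice picks at every position a child that enters the attractor no later
  than its sibling, which serves the attracting player and, negated, the avoiding one. An equilibrium
  combines player 1's strategy for the best outcome that can be enforced with player 2's strategy against the
  next better one.

  Conversely, a statement \<open>\<exists>e. q e \<noteq> 0\<close> about an \<open>n\<close>-fold limit \<open>q\<close> has \<open>n + 1\<close> alternating quantifiers,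
  and a game of \<open>n + 1\<close> unary moves verifies it, where stalling loses. Player 1 is paid for the number of
  correct claims of this kind; player 2 may challenge claims and must otherwise build a point of the closed set,
  which player 1 may refute by a verification. At an equilibrium exactly the true claims are made and
  the point stays in the set.
\<close>

section \<open>Total computable functionals\<close>

text \<open>The upper bound hinges on a count: there are n + 2 colours but only n jumps. The least
  colour costs nothing, since its winner is fixed, and each of the colours 1, ..., n costs one
  limit. The winning region of the top colour is never computed: its attractor is an increasing
  union of stages decidable from the n-th limit, so membership of the root is one instance of LPO,
  and comparing the stages of two siblings gives a closed condition. Mere membership in the
  attractor would not yield a winning strategy, because a play can stay inside it for ever; a fixed
  bound on the stage confines the play to finitely many words. In the other direction, n limits
  below an existential quantifier seem to need more than n + 1 alternations. They do not: a limit is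
  unfolded as "from some i0 on, for all i", and i0 is named in the same move as the preceding
  witness.\<close>

abbreviation pf :: "nat \<Rightarrow> nat" where "pf z \<equiv> fst (prod_decode z)"
abbreviation ps :: "nat \<Rightarrow> nat" where "ps z \<equiv> snd (prod_decode z)"

text \<open>Every functional needed in the two reductions is total, and further arguments are packed into
  the single argument by \<^const>\<open>prod_encode\<close>; minimisation is never used.\<close>

definition cpt :: "(baire \<Rightarrow> nat \<Rightarrow> nat) \<Rightarrow> bool" where
  "cpt F \<longleftrightarrow> (\<exists>t. \<forall>p x. reval p t [x] (F p x))"

definition dec :: "(baire \<Rightarrow> nat \<Rightarrow> bool) \<Rightarrow> bool" where
  "dec P \<longleftrightarrow> cpt (\<lambda>p x. of_bool (P p x))"

named_theorems cpt_intros

lemma reval_RC: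
  assumes "list_all2 (\<lambda>g y. reval p g xs y) gs ys" "reval p f ys z"
  shows "reval p (RC f gs) xs z"
  using assms by (intro reval.comp[of ys]) (auto simp: list_all2_conv_all_nth)

lemma reval_RP: "i < length xs \<Longrightarrow> xs ! i = y \<Longrightarrow> reval p (RP i) xs y"
  using reval.proj by metis

subsection \<open>Pairing\<close>

definition t_add :: rterm where "t_add = RR (RP 0) (RC RS [RP 1])"
definition t_pred :: rterm where "t_pred = RR RZ (RP 0)"
definition t_sub :: rterm where "t_sub = RR (RP 0) (RC t_pred [RP 1])"
definition t_tri :: rterm where "t_tri = RR RZ (RC RS [RC t_add [RP 0, RP 1]])"
definition t_pair :: rterm where "t_pair = RC t_add [RC t_tri [t_add], RP 0]"

lemma reval_add: "reval p t_add [n, y] (n + y)"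
  unfolding t_add_def
proof (induction n)
  case 0
  show ?case by (auto intro!: reval.prec0 reval_RP)
next
  case (Suc n)
  have "reval p (RC RS [RP 1]) [n, n + y, y] (Suc (n + y))"
    by (rule reval_RC[where ys = "[n + y]"]) (auto intro: reval_RP reval.succ)
  with Suc show ?case by (auto intro: reval.precS)
qed

lemma reval_pred: "reval p t_pred [n] (n - 1)"
  unfolding t_pred_def
proof (induction n)
  case 0
  show ?case by (auto intro!: reval.prec0 reval.zero)
next
  case (Suc n)
  have "reval p (RP 0) [n, n - 1] n" by (auto intro: reval_RP)
  with Suc show ?case by (auto intro: reval.precS)
qed

lemma reval_sub: "reval p t_sub [n, y] (y - n)"
  unfolding t_sub_def
proof (induction n)
  case 0
  show ?case by (auto intro!: reval.prec0 reval_RP)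
next
  case (Suc n)
  have "reval p (RC t_pred [RP 1]) [n, y - n, y] (y - Suc n)"
    using reval_pred[of p "y - n"]
    by (intro reval_RC[where ys = "[y - n]"]) (auto intro: reval_RP)
  with Suc show ?case by (rule reval.precS)
qed

lemma reval_tri: "reval p t_tri [n] (triangle n)"
  unfolding t_tri_def
proof (induction n)
  case 0
  show ?case by (auto intro!: reval.prec0 reval.zero)
next
  case (Suc n)
  have "reval p (RC t_add [RP 0, RP 1]) [n, triangle n] (n + triangle n)"
    by (rule reval_RC[where ys = "[n, triangle n]"]) (auto intro: reval_RP reval_add)
  then have "reval p (RC RS [RC t_add [RP 0, RP 1]]) [n, triangle n] (Suc (n + triangle n))"
    by (intro reval_RC[where ys = "[n + triangle n]"]) (auto intro: reval_RP reval.succ)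
  then have "reval p (RC RS [RC t_add [RP 0, RP 1]]) [n, triangle n] (triangle (Suc n))"
    by (simp add: add.commute)
  with Suc show ?case by (rule reval.precS)
qed

lemma reval_pair: "reval p t_pair [m, n] (prod_encode (m, n))"
proof -
  have "reval p (RC t_tri [t_add]) [m, n] (triangle (m + n))"
    by (rule reval_RC[where ys = "[m + n]"]) (auto intro: reval_add reval_tri)
  then show ?thesis
    unfolding t_pair_def prod_encode_def
    by (intro reval_RC[where ys = "[triangle (m + n), m]"]) (auto intro: reval_add reval_RP)
qed

lemma cpt_const [cpt_intros]: "cpt (\<lambda>p x. c)"
  unfolding cpt_def
proof (induction c)
  case 0
  then show ?case using reval.zero by blast
next
  case (Suc c)
  then obtain t where "\<forall>p x. reval p t [x] c" by blast
  then have "\<forall>p x. reval p (RC RS [t]) [x] (Suc c)"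
    by (auto intro!: reval_RC[where ys = "[c]"] reval.succ)
  then show ?case by blast
qed

lemma cpt_id [cpt_intros]: "cpt (\<lambda>p x. x)"
  unfolding cpt_def by (rule exI[of _ "RP 0"]) (auto intro: reval_RP)

lemma cpt_comp1:
  assumes "\<And>p x. reval p t [x] (f p x)" "cpt F"
  shows "cpt (\<lambda>p x. f p (F p x))"
proof -
  obtain s where "\<And>p x. reval p s [x] (F p x)" using assms(2) unfolding cpt_def by blast
  then have "reval p (RC t [s]) [x] (f p (F p x))" for p x
    by (intro reval_RC[where ys = "[F p x]"]) (auto intro: assms)
  then show ?thesis unfolding cpt_def by blast
qed

lemma cpt_comp2:
  assumes "\<And>p x y. reval p t [x, y] (f x y)" "cpt F" "cpt G"
  shows "cpt (\<lambda>p x. f (F p x) (G p x))"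
proof -
  obtain s where "\<And>p x. reval p s [x] (F p x)" using assms(2) unfolding cpt_def by blast
  moreover obtain r where "\<And>p x. reval p r [x] (G p x)" using assms(3) unfolding cpt_def by blast
  ultimately have "reval p (RC t [s, r]) [x] (f (F p x) (G p x))" for p x
    by (intro reval_RC[where ys = "[F p x, G p x]"]) (auto intro: assms)
  then show ?thesis unfolding cpt_def by blast
qed

lemma cpt_compose:
  assumes "cpt F" "cpt G"
  shows "cpt (\<lambda>p x. F p (G p x))"
  using assms cpt_comp1[OF _ assms(2)] unfolding cpt_def by metis

lemma cpt_orcl [cpt_intros]: "cpt F \<Longrightarrow> cpt (\<lambda>p x. p (F p x))"
  by (rule cpt_comp1[of RO]) (auto intro: reval.orcl)

lemma cpt_Suc [cpt_intros]: "cpt F \<Longrightarrow> cpt (\<lambda>p x. Suc (F p x))"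
  by (rule cpt_comp1[of RS]) (auto intro: reval.succ)

lemma cpt_add [cpt_intros]: "cpt F \<Longrightarrow> cpt G \<Longrightarrow> cpt (\<lambda>p x. F p x + G p x)"
  by (rule cpt_comp2[of t_add "(+)"]) (rule reval_add)

lemma cpt_sub [cpt_intros]: "cpt F \<Longrightarrow> cpt G \<Longrightarrow> cpt (\<lambda>p x. F p x - G p x)"
  by (rule cpt_comp2[of t_sub "\<lambda>x y. y - x"]) (rule reval_sub)

lemma cpt_triangle: "cpt F \<Longrightarrow> cpt (\<lambda>p x. triangle (F p x))"
  by (rule cpt_comp1[of t_tri]) (rule reval_tri)

lemma cpt_pair [cpt_intros]: "cpt F \<Longrightarrow> cpt G \<Longrightarrow> cpt (\<lambda>p x. prod_encode (F p x, G p x))"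
  by (rule cpt_comp2[of t_pair "\<lambda>x y. prod_encode (x, y)"]) (rule reval_pair)

text \<open>The antidiagonal of \<open>z\<close> in the Cantor pairing. It is all that inversion
  requires: both components follow from it by subtraction.\<close>

definition diag :: "nat \<Rightarrow> nat" where "diag z = pf z + ps z"

lemma diag_eqI: "triangle s \<le> z \<Longrightarrow> z < triangle (Suc s) \<Longrightarrow> diag z = s"
  using prod_encode_inverse[of "(z - triangle s, s - (z - triangle s))"]
  by (simp add: prod_encode_def diag_def)

lemma diag_bounds: "triangle (diag z) \<le> z" "z < triangle (Suc (diag z))"
  using prod_decode_inverse[of z] unfolding prod_encode_def diag_def
  by (auto simp: case_prod_beta)

text \<open>The antidiagonal changes exactly when \<open>Suc z\<close> is the next triangular
  number, and truncated subtraction turns this test into arithmetic for a recursion step.\<close>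

lemma diag_Suc: "diag (Suc z) = diag z + (1 - (triangle (Suc (diag z)) - Suc z))"
  using diag_bounds[of z] by (cases "triangle (Suc (diag z)) = Suc z") (auto intro!: diag_eqI)

lemma diag_0: "diag 0 = 0" by (rule diag_eqI) auto

lemma pf_diag: "pf z = z - triangle (diag z)"
  using prod_decode_inverse[of z] unfolding prod_encode_def diag_def
  by (auto simp: case_prod_beta)

lemma ps_diag: "ps z = diag z - pf z"
  by (simp add: diag_def)

lemma cpt_diag: assumes "cpt F" shows "cpt (\<lambda>p x. diag (F p x))"
proof -
  define tS where "tS = RC t_tri [RC RS [RP 1]]"
  define tD where "tD = RC t_sub [RC RS [RP 0], tS]"
  define tE where "tE = RC t_sub [tD, RC RS [RZ]]"
  define t where "t = RR RZ (RC t_add [RP 1, tE])"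
  have S: "reval p tS [n, y] (triangle (Suc y))" for p n y
    unfolding tS_def
    by (intro reval_RC[where ys = "[Suc y]"] reval_tri list.rel_intros
        reval_RC[where ys = "[y]"] reval.succ reval_RP) auto
  have D: "reval p tD [n, y] (triangle (Suc y) - Suc n)" for p n y
    unfolding tD_def
    by (intro reval_RC[where ys = "[Suc n, triangle (Suc y)]"] reval_sub list.rel_intros S
        reval_RC[where ys = "[n]"] reval.succ reval_RP) auto
  have one: "reval p (RC RS [RZ]) [n, y] 1" for p n y
    using reval.succ[of p 0 "[]"] by (intro reval_RC[where ys = "[0]"]) (auto intro: reval.zero)
  have E: "reval p tE [n, y] (1 - (triangle (Suc y) - Suc n))" for p n y
    unfolding tE_def
    by (intro reval_RC[where ys = "[triangle (Suc y) - Suc n, 1]"] reval_sub list.rel_intros D one)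
  have "reval p t [n] (diag n)" for p n
    unfolding t_def
  proof (induction n)
    case 0
    show ?case by (auto intro!: reval.prec0 reval.zero simp: diag_0)
  next
    case (Suc n)
    have "reval p (RC t_add [RP 1, tE]) [n, diag n] (diag (Suc n))"
      unfolding diag_Suc
      by (intro reval_RC[where ys = "[diag n, 1 - (triangle (Suc (diag n)) - Suc n)]"]
          reval_add list.rel_intros E reval_RP) auto
    with Suc show ?case by (rule reval.precS)
  qed
  then show ?thesis by (rule cpt_comp1) fact
qed

lemma cpt_pf [cpt_intros]: "cpt F \<Longrightarrow> cpt (\<lambda>p x. pf (F p x))"
  unfolding pf_diag by (intro cpt_sub cpt_triangle cpt_diag)

lemma cpt_ps [cpt_intros]: "cpt F \<Longrightarrow> cpt (\<lambda>p x. ps (F p x))"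
  unfolding ps_diag by (intro cpt_sub cpt_pf cpt_diag)

subsection \<open>Primitive recursion and bounded search\<close>

text \<open>Since \<open>cpt\<close> knows unary functionals only, the second premise receives
  counter, previous value and parameter packed in this order into \<open>z\<close>.\<close>

lemma cpt_rec [cpt_intros]:
  assumes "cpt F" "cpt (\<lambda>p z. G p (ps (ps z)) (pf z) (pf (ps z)))" "cpt H"
  shows "cpt (\<lambda>p x. rec_nat (F p x) (\<lambda>n r. G p x n r) (H p x))"
proof -
  obtain tF where F: "\<And>p x. reval p tF [x] (F p x)" using assms(1) unfolding cpt_def by blast
  obtain tG where G: "\<And>p z. reval p tG [z] (G p (ps (ps z)) (pf z) (pf (ps z)))"
    using assms(2) unfolding cpt_def by blast
  obtain tH where H: "\<And>p x. reval p tH [x] (H p x)" using assms(3) unfolding cpt_def by blast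
  define tQ where "tQ = RC tG [RC t_pair [RP 0, RC t_pair [RP 1, RP 2]]]"
  have Q: "reval p tQ [n, r, x] (G p x n r)" for p n r x
  proof -
    have "reval p (RC t_pair [RP 1, RP 2]) [n, r, x] (prod_encode (r, x))"
      by (rule reval_RC[where ys = "[r, x]"]) (auto intro: reval_RP reval_pair)
    then have "reval p (RC t_pair [RP 0, RC t_pair [RP 1, RP 2]]) [n, r, x]
        (prod_encode (n, prod_encode (r, x)))"
      by (intro reval_RC[where ys = "[n, prod_encode (r, x)]"]) (auto intro: reval_RP reval_pair)
    with G[of p "prod_encode (n, prod_encode (r, x))"] show ?thesis
      unfolding tQ_def
      by (intro reval_RC[where ys = "[prod_encode (n, prod_encode (r, x))]"]) auto
  qed
  have R: "reval p (RR tF tQ) [n, x] (rec_nat (F p x) (\<lambda>n r. G p x n r) n)" for p n x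
  proof (induction n)
    case 0
    show ?case using F by (auto intro: reval.prec0)
  next
    case (Suc n)
    then show ?case using Q by (auto intro: reval.precS)
  qed
  have "reval p (RC (RR tF tQ) [tH, RP 0]) [x] (rec_nat (F p x) (\<lambda>n r. G p x n r) (H p x))" for p x
    by (rule reval_RC[where ys = "[H p x, x]"]) (auto intro: R H reval_RP)
  then show ?thesis unfolding cpt_def by blast
qed

section \<open>Decidable predicates and their closure properties\<close>

lemma decD [cpt_intros]: "dec P \<Longrightarrow> cpt (\<lambda>p x. of_bool (P p x))"
  by (simp add: dec_def)

lemma dec_const [cpt_intros]: "dec (\<lambda>p x. c)"
  unfolding dec_def by (rule cpt_const)

lemma dec_pos: assumes "cpt F" shows "dec (\<lambda>p x. 0 < F p x)"
proof -
  have "cpt (\<lambda>p x. 1 - (1 - F p x))" by (intro cpt_intros assms)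
  moreover have "1 - (1 - F p x) = of_bool (0 < F p x)" for p x by auto
  ultimately show ?thesis by (simp add: dec_def)
qed

lemma dec_less [cpt_intros]: assumes "cpt F" "cpt G" shows "dec (\<lambda>p x. F p x < G p x)"
  using dec_pos[OF cpt_sub[OF assms(2,1)]] by simp

lemma dec_not [cpt_intros]: assumes "dec P" shows "dec (\<lambda>p x. \<not> P p x)"
proof -
  have "cpt (\<lambda>p x. 1 - of_bool (P p x))" by (intro cpt_intros decD assms)
  moreover have "1 - of_bool (P p x) = (of_bool (\<not> P p x) :: nat)" for p x by simp
  ultimately show ?thesis by (simp add: dec_def)
qed

lemma dec_disj [cpt_intros]: assumes "dec P" "dec Q" shows "dec (\<lambda>p x. P p x \<or> Q p x)"
proof -
  have "dec (\<lambda>p x. 0 < (of_bool (P p x) :: nat) + of_bool (Q p x))"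
    by (intro dec_pos cpt_intros assms)
  moreover have "(0 < (of_bool (P p x) :: nat) + of_bool (Q p x)) = (P p x \<or> Q p x)" for p x
    by auto
  ultimately show ?thesis by simp
qed

lemma dec_conj [cpt_intros]: assumes "dec P" "dec Q" shows "dec (\<lambda>p x. P p x \<and> Q p x)"
  using dec_not[OF dec_disj[OF dec_not[OF assms(1)] dec_not[OF assms(2)]]] by simp

lemma dec_imp [cpt_intros]: assumes "dec P" "dec Q" shows "dec (\<lambda>p x. P p x \<longrightarrow> Q p x)"
  unfolding imp_conv_disj by (intro dec_disj dec_not assms)

lemma dec_iff [cpt_intros]: assumes "dec P" "dec Q" shows "dec (\<lambda>p x. P p x = Q p x)"
  unfolding iff_conv_conj_imp by (intro dec_conj dec_imp assms)

lemma dec_le [cpt_intros]: assumes "cpt F" "cpt G" shows "dec (\<lambda>p x. F p x \<le> G p x)"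
  using dec_not[OF dec_less[OF assms(2,1)]] by (simp add: not_less)

lemma dec_eq [cpt_intros]: assumes "cpt F" "cpt G" shows "dec (\<lambda>p x. F p x = G p x)"
  unfolding order_eq_iff by (intro dec_conj dec_le assms)

lemma cpt_if [cpt_intros]:
  assumes "dec P" "cpt F" "cpt G" shows "cpt (\<lambda>p x. if P p x then F p x else G p x)"
proof -
  have "cpt (\<lambda>p x. rec_nat (G p x) (\<lambda>_ _. F p x) (of_bool (P p x)))"
    by (intro cpt_intros assms cpt_compose[OF assms(2)])
  moreover have "rec_nat (G p x) (\<lambda>_ _. F p x) (of_bool (P p x)) = (if P p x then F p x else G p x)"
    for p x by simp
  ultimately show ?thesis by simp
qed

lemma dec_if [cpt_intros]:
  assumes "dec P" "dec Q" "dec R" shows "dec (\<lambda>p x. if P p x then Q p x else R p x)"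
proof -
  have "cpt (\<lambda>p x. if P p x then of_bool (Q p x) else of_bool (R p x))"
    by (intro cpt_intros assms)
  then show ?thesis unfolding dec_def by (simp add: if_distrib)
qed

lemma dec_compose:
  assumes "dec P" "cpt F" shows "dec (\<lambda>p x. P p (F p x))"
  using assms cpt_compose unfolding dec_def by blast

text \<open>The default is \<open>b\<close> when the search fails. In the recursion,
  \<open>r < i\<close> means that an earlier index has already succeeded.\<close>

definition bleast :: "nat \<Rightarrow> (nat \<Rightarrow> bool) \<Rightarrow> nat" where
  "bleast b P = rec_nat 0 (\<lambda>i r. if r < i then r else if P i then i else Suc i) b"

lemma bleast_spec: "bleast b P \<le> b" "\<And>i. i < bleast b P \<Longrightarrow> \<not> P i" "bleast b P < b \<Longrightarrow> P (bleast b P)"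
proof -
  have "bleast b P \<le> b \<and> (\<forall>i<bleast b P. \<not> P i) \<and> (bleast b P < b \<longrightarrow> P (bleast b P))"
  proof (induction b)
    case 0
    then show ?case by (simp add: bleast_def)
  next
    case (Suc b)
    have "bleast (Suc b) P = (if bleast b P < b then bleast b P else if P b then b else Suc b)"
      by (simp add: bleast_def)
    with Suc show ?case by (auto simp: less_Suc_eq)
  qed
  then show "bleast b P \<le> b" "bleast b P < b \<Longrightarrow> P (bleast b P)"
    "\<And>i. i < bleast b P \<Longrightarrow> \<not> P i" by auto
qed

lemma bleast_less_iff: "bleast b P < b \<longleftrightarrow> (\<exists>i<b. P i)"
  using bleast_spec(2)[of _ b P] bleast_spec(3)[of b P] by (meson linorder_not_le order_le_less_trans)

lemma bleast_eqI: "r \<le> b \<Longrightarrow> (\<And>i. i < r \<Longrightarrow> \<not> P i) \<Longrightarrow> (r < b \<Longrightarrow> P r) \<Longrightarrow> bleast b P = r"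
  using bleast_spec(1)[of b P] bleast_spec(2)[of _ b P] bleast_spec(3)[of b P]
  by (metis linorder_neqE_nat order.strict_trans2 nat_less_le)

lemma cpt_bleast [cpt_intros]:
  assumes "cpt B" "dec (\<lambda>p z. P p (ps z) (pf z))"
  shows "cpt (\<lambda>p x. bleast (B p x) (P p x))"
proof -
  have "dec (\<lambda>p z. P p (ps (ps z)) (pf z))"
    using dec_compose[OF assms(2), of "\<lambda>p z. prod_encode (pf z, ps (ps z))"]
    by (simp add: cpt_intros)
  then show ?thesis unfolding bleast_def by (intro cpt_intros assms)
qed

lemma dec_ex [cpt_intros]:
  assumes "cpt B" "dec (\<lambda>p z. P p (ps z) (pf z))"
  shows "dec (\<lambda>p x. \<exists>i<B p x. P p x i)"
  unfolding bleast_less_iff[symmetric] using assms by (intro cpt_intros)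

lemma dec_all [cpt_intros]:
  assumes "cpt B" "dec (\<lambda>p z. P p (ps z) (pf z))"
  shows "dec (\<lambda>p x. \<forall>i<B p x. P p x i)"
  using dec_not[OF dec_ex[OF assms(1) dec_not[OF assms(2)]]] by simp

lemma cpt_mult [cpt_intros]:
  assumes "cpt F" "cpt G" shows "cpt (\<lambda>p x. F p x * G p x)"
proof -
  have "cpt (\<lambda>p x. rec_nat 0 (\<lambda>_ r. r + G p x) (F p x))"
    by (intro cpt_intros assms cpt_compose[OF assms(2)])
  moreover have "rec_nat 0 (\<lambda>_ r. r + m) n = n * m" for n m :: nat by (induction n) auto
  ultimately show ?thesis by simp
qed

lemma dec_odd [cpt_intros]: assumes "cpt F" shows "dec (\<lambda>p x. odd (F p x))"
proof -
  have "cpt (\<lambda>p x. rec_nat 0 (\<lambda>_ r. 1 - r) (F p x))" by (intro cpt_intros assms)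
  moreover have "rec_nat 0 (\<lambda>_ r. 1 - r) n = (of_bool (odd n) :: nat)" for n by (induction n) auto
  ultimately show ?thesis by (simp add: dec_def)
qed

lemma dec_even [cpt_intros]: "cpt F \<Longrightarrow> dec (\<lambda>p x. even (F p x))"
  using dec_not[OF dec_odd] by simp

lemma cpt_div2 [cpt_intros]: assumes "cpt F" shows "cpt (\<lambda>p x. F p x div 2)"
proof -
  have "cpt (\<lambda>p x. rec_nat 0 (\<lambda>i r. r + of_bool (odd i)) (F p x))" by (intro cpt_intros assms)
  moreover have "rec_nat 0 (\<lambda>i r. r + of_bool (odd i)) n = n div 2" for n :: nat
    by (induction n) auto
  ultimately show ?thesis by simp
qed

lemma dec_set_decode [cpt_intros]:
  assumes "cpt F" "cpt G" shows "dec (\<lambda>p x. F p x \<in> set_decode (G p x))"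
proof -
  have "dec (\<lambda>p x. odd (rec_nat (G p x) (\<lambda>_ r. r div 2) (F p x)))" by (intro cpt_intros assms)
  moreover have "rec_nat m (\<lambda>_ r. r div 2) n = m div 2 ^ n" for n m :: nat
    by (induction n) (auto simp: div_mult2_eq power_Suc2 simp del: power_Suc)
  ultimately show ?thesis by (simp add: set_decode_def)
qed

lemma set_decode_less: "i \<in> set_decode e \<Longrightarrow> i < e"
proof -
  assume "i \<in> set_decode e"
  then have "e div 2 ^ i \<noteq> 0" unfolding set_decode_def by (auto intro: ccontr)
  then have "2 ^ i \<le> e" by (metis div_less not_le)
  then show "i < e" using less_exp[of i] by linarith
qed

lemma dec_ball_set_decode [cpt_intros]:
  assumes "cpt B" "dec (\<lambda>p z. P p (ps z) (pf z))"
  shows "dec (\<lambda>p x. \<forall>i\<in>set_decode (B p x). P p x i)"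
proof -
  have "dec (\<lambda>p x. \<forall>i<B p x. i \<in> set_decode (B p x) \<longrightarrow> P p x i)"
    by (intro cpt_intros assms cpt_compose[OF assms(1)])
  moreover have "(\<forall>i<b. i \<in> set_decode b \<longrightarrow> Q i) = (\<forall>i\<in>set_decode b. Q i)" for b Q
    using set_decode_less by auto
  ultimately show ?thesis by simp
qed

lemma cpt_set_encode [cpt_intros]:
  assumes "cpt B" "dec (\<lambda>p z. P p (ps z) (pf z))"
  shows "cpt (\<lambda>p x. set_encode {i. i < B p x \<and> P p x i})"
proof -
  have "dec (\<lambda>p z. P p (ps (ps z)) (pf z))"
    using dec_compose[OF assms(2), of "\<lambda>p z. prod_encode (pf z, ps (ps z))"]
    by (simp add: cpt_intros)
  then have "cpt (\<lambda>p x. rec_nat 0 (\<lambda>i r. if P p x i then rec_nat 1 (\<lambda>_ r. r + r) i + r else r) (B p x))"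
    by (intro cpt_intros assms)
  moreover have "rec_nat 1 (\<lambda>_ r. r + r) = (^) (2::nat)"
  proof
    show "rec_nat 1 (\<lambda>_ r. r + r) i = (2::nat) ^ i" for i by (induction i) auto
  qed
  moreover have "rec_nat 0 (\<lambda>i r. if Q i then (2::nat) ^ i + r else r) b = set_encode {i. i < b \<and> Q i}" for b Q
  proof (induction b)
    case (Suc b)
    have "{i. i < Suc b \<and> Q i} = (if Q b then insert b {i. i < b \<and> Q i} else {i. i < b \<and> Q i})"
      by (auto simp: less_Suc_eq)
    with Suc show ?case by auto
  qed simp
  ultimately show ?thesis by (simp only:)
qed

subsection \<open>Words\<close>

text \<open>\<open>word\<close> identifies all nonzero entries, so a word has many codes;
  \<open>enc\<close> selects the canonical one with entries 0 and 1.\<close>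

definition enc :: "bool list \<Rightarrow> nat" where "enc u = list_encode (map of_bool u)"

lemma word_enc [simp]: "word (enc u) = u"
  by (simp add: word_def enc_def comp_def)

lemma enc_eq_iff [simp]: "enc u = enc v \<longleftrightarrow> u = v"
  by (metis word_enc)

definition cptw :: "(baire \<Rightarrow> nat \<Rightarrow> bool list) \<Rightarrow> bool" where
  "cptw U \<longleftrightarrow> cpt (\<lambda>p x. enc (U p x))"

lemma cpt_enc [cpt_intros]: "cptw U \<Longrightarrow> cpt (\<lambda>p x. enc (U p x))"
  by (simp add: cptw_def)

definition bit_at :: "bool list \<Rightarrow> nat \<Rightarrow> bool" where
  "bit_at u i \<longleftrightarrow> i < length u \<and> u ! i"

text \<open>Iterated tails of a coded list. The code 0 of the empty list is a fixed point, because
  \<open>prod_decode 0 = (0, 0)\<close>, so running past the end needs no case distinction.\<close>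

definition dropc :: "nat \<Rightarrow> nat \<Rightarrow> nat" where
  "dropc i c = rec_nat c (\<lambda>_ r. ps (r - 1)) i"

lemma prod_decode_0 [simp]: "prod_decode 0 = (0, 0)"
  using prod_encode_inverse[of "(0, 0)"] by (simp add: prod_encode_def)

lemma dropc_eq: "dropc i c = list_encode (drop i (list_decode c))"
proof (induction i)
  case 0
  then show ?case by (simp add: dropc_def)
next
  case (Suc i)
  have "ps (list_encode xs - 1) = list_encode (tl xs)" for xs by (cases xs) auto
  with Suc show ?case by (simp add: dropc_def drop_Suc tl_drop)
qed

lemma length_list_decode_le: "length (list_decode c) \<le> c"
proof -
  have "length xs \<le> list_encode xs" for xs
    by (induction xs) (auto intro: order_trans[OF _ le_prod_encode_2])
  then show ?thesis using list_decode_inverse by metis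
qed

lemma length_list_decode: "length (list_decode c) = bleast c (\<lambda>i. dropc i c = 0)"
proof (rule sym, rule bleast_eqI)
  have *: "dropc i c = 0 \<longleftrightarrow> length (list_decode c) \<le> i" for i
    unfolding dropc_eq by (cases "drop i (list_decode c)") (auto simp: drop_eq_Nil[symmetric] simp del: drop_eq_Nil)
  show "\<not> dropc i c = 0" if "i < length (list_decode c)" for i using that * by auto
  show "dropc (length (list_decode c)) c = 0" using * by auto
qed (rule length_list_decode_le)

lemma nth_list_decode: "pf (dropc i c - 1) = (if i < length (list_decode c) then list_decode c ! i else 0)"
proof (cases "i < length (list_decode c)")
  case True
  then show ?thesis by (simp add: dropc_eq Cons_nth_drop_Suc[symmetric])
next
  case False
  then show ?thesis by (simp add: dropc_eq)
qed

lemma cpt_dropc: "cpt F \<Longrightarrow> cpt G \<Longrightarrow> cpt (\<lambda>p x. dropc (F p x) (G p x))"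
  unfolding dropc_def by (intro cpt_intros)

lemma cpt_length_list_decode: 
  assumes "cpt F" shows "cpt (\<lambda>p x. length (list_decode (F p x)))"
  unfolding length_list_decode by (intro cpt_intros cpt_dropc assms cpt_compose[OF assms])

lemma cpt_list_build:
  assumes "cpt L" "cpt (\<lambda>p z. F p (ps z) (pf z))"
  shows "cpt (\<lambda>p x. list_encode (map (F p x) [0..<L p x]))"
proof -
  have "cpt (\<lambda>p z. F p (ps (ps z)) (L p (ps (ps z)) - Suc (pf z)))"
    using cpt_compose[OF assms(2), of "\<lambda>p z. prod_encode (L p (ps (ps z)) - Suc (pf z), ps (ps z))"]
    by (simp add: cpt_intros cpt_compose[OF assms(1)])
  \<comment> \<open>The list is built from its last entry, because the coding prepends; hence the
    index counts down from \<open>L p x\<close>.\<close>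
  then have "cpt (\<lambda>p x. rec_nat 0 (\<lambda>i r. Suc (prod_encode (F p x (L p x - Suc i), r))) (L p x))"
    by (intro cpt_intros assms)
  moreover have "rec_nat 0 (\<lambda>i r. Suc (prod_encode (f (l - Suc i), r))) n
      = list_encode (map f [l - n..<l])" if "n \<le> l" for f l n
    using that
  proof (induction n)
    case (Suc n)
    then have "[l - Suc n..<l] = (l - Suc n) # [l - n..<l]"
      by (metis Suc_diff_Suc Suc_le_lessD diff_less upt_conv_Cons zero_less_Suc less_le_trans)
    with Suc show ?case by simp
  qed simp
  ultimately show ?thesis by simp
qed

lemma cptw_map [cpt_intros]:
  assumes "cpt L" "dec (\<lambda>p z. B p (ps z) (pf z))"
  shows "cptw (\<lambda>p x. map (B p x) [0..<L p x])"
  using cpt_list_build[OF assms(1) decD[OF assms(2)]]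
  by (simp add: cptw_def enc_def comp_def)

lemma cpt_length [cpt_intros]: assumes "cptw U" shows "cpt (\<lambda>p x. length (U p x))"
  using cpt_length_list_decode[OF assms[unfolded cptw_def]] by (simp add: enc_def)

lemma dec_bit_at [cpt_intros]:
  assumes "cptw U" "cpt I" shows "dec (\<lambda>p x. bit_at (U p x) (I p x))"
proof -
  have "dec (\<lambda>p x. pf (dropc (I p x) (enc (U p x)) - 1) \<noteq> 0)"
    by (intro cpt_intros cpt_dropc assms)
  moreover have "(pf (dropc i (enc u) - 1) \<noteq> 0) = bit_at u i" for i u
    unfolding nth_list_decode by (auto simp: enc_def bit_at_def)
  ultimately show ?thesis by simp
qed

lemma cptw_word [cpt_intros]: assumes "cpt F" shows "cptw (\<lambda>p x. word (F p x))"
proof -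
  have "cptw (\<lambda>p x. map (\<lambda>i. pf (dropc i (F p x) - 1) \<noteq> 0) [0..<length (list_decode (F p x))])"
    by (intro cpt_intros cpt_dropc cpt_length_list_decode assms cpt_compose[OF assms])
  moreover have "map (\<lambda>i. pf (dropc i c - 1) \<noteq> 0) [0..<length (list_decode c)] = word c" for c
    by (rule nth_equalityI) (auto simp: nth_list_decode[unfolded One_nat_def] word_def)
  ultimately show ?thesis by simp
qed

lemma cptw_compose:
  assumes "cptw U" "cpt F" shows "cptw (\<lambda>p x. U p (F p x))"
  using assms cpt_compose unfolding cptw_def by blast

lemma cptw_snoc [cpt_intros]:
  assumes "cptw U" "dec B" shows "cptw (\<lambda>p x. U p x @ [B p x])"
proof -
  have "cptw (\<lambda>p x. map (\<lambda>i. if i < length (U p x) then bit_at (U p x) i else B p x) [0..<Suc (length (U p x))])"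
    by (intro cpt_intros assms cptw_compose[OF assms(1)] dec_compose[OF assms(2)])
  moreover have "map (\<lambda>i. if i < length u then bit_at u i else b) [0..<Suc (length u)] = u @ [b]" for u b
    by (rule nth_equalityI) (auto simp: bit_at_def nth_append less_Suc_eq)
  ultimately show ?thesis by simp
qed

lemma cptw_Nil [cpt_intros]: "cptw (\<lambda>p x. [])"
  unfolding cptw_def by (rule cpt_const)

lemma cpt_foldl:
  assumes "cpt S" "cptw U" "cpt (\<lambda>p z. F p (ps (ps z)) (pf (ps z)) (pf z \<noteq> 0))"
  shows "cpt (\<lambda>p x. foldl (F p x) (S p x) (U p x))"
proof -
  have "cpt (\<lambda>p z. F p (ps (ps z)) (pf (ps z)) (bit_at (U p (ps (ps z))) (pf z)))"
    using cpt_compose[OF assms(3), of "\<lambda>p z. prod_encode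
      (of_bool (bit_at (U p (ps (ps z))) (pf z)), prod_encode (pf (ps z), ps (ps z)))"]
    by (simp add: cpt_intros cptw_compose[OF assms(2)])
  then have "cpt (\<lambda>p x. rec_nat (S p x) (\<lambda>i r. F p x r (bit_at (U p x) i)) (length (U p x)))"
    by (intro cpt_intros assms)
  moreover have "rec_nat (S p x) (\<lambda>i r. F p x r (bit_at (U p x) i)) (length (U p x))
      = foldl (F p x) (S p x) (U p x)" for p x
  proof -
    have "n \<le> length u \<Longrightarrow> rec_nat s (\<lambda>i r. f r (bit_at u i)) n = foldl f s (take n u)" for n f s u
      by (induction n) (auto simp: take_Suc_conv_app_nth bit_at_def)
    from this[OF order_refl] show ?thesis by simp
  qed
  ultimately show ?thesis by simp
qed

subsection \<open>Oracle substitution\<close>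

text \<open>\<open>tr g a t\<close> turns an \<open>a\<close>-ary term \<open>t\<close> into an \<open>a + 1\<close>-ary one whose last argument is a
  parameter of the functional, computed by \<open>g\<close>, that is put in place of the oracle.\<close>

fun tr :: "rterm \<Rightarrow> nat \<Rightarrow> rterm \<Rightarrow> rterm" where
  "tr g a RZ = RZ"
| "tr g a RS = RS"
| "tr g a (RP i) = RP i"
| "tr g a RO = RC g [RC t_pair [RP 0, RP a]]"
| "tr g a (RC f gs) = RC (tr g (length gs) f) (map (tr g a) gs @ [RP a])"
| "tr g a (RR f h) = RR (tr g (a - 1) f) (tr g (a + 1) h)"
| "tr g a (RM f) = RM (tr g (a + 1) f)"

lemma reval_tr:
  assumes g: "\<And>y. reval p g [prod_encode (y, i)] (q y)"
  shows "reval q t xs z \<Longrightarrow> reval p (tr g (length xs) t) (xs @ [i]) z"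
proof (induction rule: reval.induct)
  case (zero xs)
  then show ?case by (simp add: reval.zero)
next
  case (succ x xs)
  then show ?case by (simp add: reval.succ)
next
  case (proj i xs)
  then show ?case by (auto intro!: reval_RP simp: nth_append)
next
  case (orcl x xs)
  have "reval p (RC t_pair [RP 0, RP (Suc (length xs))]) (x # xs @ [i]) (prod_encode (x, i))"
    by (rule reval_RC[where ys = "[x, i]"]) (auto intro: reval_RP reval_pair)
  then show ?case
    using g by (auto intro!: reval_RC[where ys = "[prod_encode (x, i)]"])
next
  case (comp ys gs xs f z)
  have "reval p (RC (tr g (length gs) f) (map (tr g (length xs)) gs @ [RP (length xs)])) (xs @ [i]) z"
    by (rule reval_RC[where ys = "ys @ [i]"])
       (use comp in \<open>auto simp: list_all2_conv_all_nth nth_append intro: reval_RP\<close>)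
  then show ?case by simp
next
  case (prec0 f xs z g')
  then show ?case by (auto intro: reval.prec0)
next
  case (precS f g' n xs y z)
  then show ?case by (auto intro: reval.precS)
next
  case (mu f n xs)
  then show ?case by (auto intro!: reval.mu)
qed

lemma cpt_subst:
  assumes "cpt \<Phi>" "cpt (\<lambda>p z. G p (ps z) (pf z))" "cpt X"
  shows "cpt (\<lambda>p x. \<Phi> (G p x) (X p x))"
proof -
  obtain t where t: "\<And>p x. reval p t [x] (\<Phi> p x)" using assms(1) unfolding cpt_def by blast
  obtain g where g: "\<And>p z. reval p g [z] (G p (ps z) (pf z))"
    using assms(2) unfolding cpt_def by blast
  obtain s where s: "\<And>p x. reval p s [x] (X p x)" using assms(3) unfolding cpt_def by blast
  have "reval p (tr g 1 t) [y, x] (\<Phi> (G p x) y)" for p x y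
    using reval_tr[OF _ t, of p g x "G p x" y] g[of p "prod_encode (_, x)"] by simp
  then have "reval p (RC (tr g 1 t) [s, RP 0]) [x] (\<Phi> (G p x) (X p x))" for p x
    by (intro reval_RC[where ys = "[X p x, x]"]) (auto intro: s reval_RP)
  then show ?thesis unfolding cpt_def by blast
qed

subsection \<open>Continuity\<close>

inductive_cases reval_RZE: "reval p RZ xs z"
inductive_cases reval_RSE: "reval p RS xs z"
inductive_cases reval_RPE: "reval p (RP i) xs z"
inductive_cases reval_ROE: "reval p RO xs z"
inductive_cases reval_RCE: "reval p (RC f gs) xs z"
inductive_cases reval_RR0E: "reval p (RR f g) (0 # xs) z"
inductive_cases reval_RRSE: "reval p (RR f g) (Suc n # xs) z"
inductive_cases reval_RME: "reval p (RM f) xs z"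

lemma reval_det: "reval p t xs y \<Longrightarrow> reval p t xs z \<Longrightarrow> y = z"
proof (induction arbitrary: z rule: reval.induct)
  case (zero xs)
  then show ?case by (auto elim: reval_RZE)
next
  case (succ x xs)
  then show ?case by (auto elim: reval_RSE)
next
  case (proj i xs)
  from proj(2) show ?case by (auto elim: reval_RPE)
next
  case (orcl x xs)
  then show ?case by (auto elim: reval_ROE)
next
  case (comp ys gs xs f w)
  from comp.prems obtain ys' where ys': "length ys' = length gs"
    "\<forall>i<length gs. reval p (gs ! i) xs (ys' ! i)" "reval p f ys' z"
    by (auto elim: reval_RCE)
  have "ys = ys'" by (rule nth_equalityI) (use comp ys' in auto)
  with comp ys' show ?case by auto
next
  case (prec0 f xs w g)
  from prec0(3) show ?case by (rule reval_RR0E) (rule prec0(2))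
next
  case (precS f g n xs y w)
  from precS(5) obtain y' where y': "reval p (RR f g) (n # xs) y'" "reval p g (n # y' # xs) z"
    by (rule reval_RRSE)
  from precS(3)[OF y'(1)] y'(2) show ?case by (intro precS(4)) simp
next
  case (mu f n xs)
  from mu.prems have z: "reval p f (z # xs) 0" "\<forall>m<z. \<exists>y. 0 < y \<and> reval p f (m # xs) y"
    by (auto elim: reval_RME)
  show ?case
  proof (rule linorder_cases[of n z])
    assume "n < z"
    with z(2) obtain y where "0 < y" "reval p f (n # xs) y" by blast
    with mu.IH(1)[of y] show ?thesis by simp
  next
    assume "z < n"
    with mu.IH(2) obtain y where "0 < y" "\<And>w. reval p f (z # xs) w \<Longrightarrow> y = w" by blast
    with z(1) show ?thesis by blast
  qed
qed

text \<open>The use principle: an evaluation is a finite derivation, hence it queries the oracle at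
  finitely many places.\<close>

lemma reval_use: "reval p t xs z \<Longrightarrow> \<exists>N. \<forall>q. (\<forall>k<N. q k = p k) \<longrightarrow> reval q t xs z"
proof (induction rule: reval.induct)
  case (orcl x xs)
  show ?case
  proof (intro exI[of _ "Suc x"] allI impI)
    fix q assume "\<forall>k<Suc x. q k = p k"
    then show "reval q RO (x # xs) (p x)" using reval.orcl[of q x xs] by simp
  qed
next
  case (comp ys gs xs f z)
  then obtain N where N: "\<And>i q. i < length gs \<Longrightarrow> \<forall>k<N i. q k = p k \<Longrightarrow> reval q (gs ! i) xs (ys ! i)"
    by metis
  from comp obtain M where M: "\<And>q. \<forall>k<M. q k = p k \<Longrightarrow> reval q f ys z" by blast
  have "reval q (RC f gs) xs z" if "\<forall>k<max M (Max (N ` {..<length gs})). q k = p k" for q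
  proof (rule reval.comp[OF comp(1)])
    show "\<forall>i<length gs. reval q (gs ! i) xs (ys ! i)"
    proof (intro allI impI)
      fix i assume i: "i < length gs"
      then have "N i \<le> Max (N ` {..<length gs})" by auto
      with that show "reval q (gs ! i) xs (ys ! i)" by (intro N i) auto
    qed
    show "reval q f ys z" by (rule M) (use that in auto)
  qed
  then show ?case by blast
next
  case (precS f g n xs y z)
  then obtain M N where "\<And>q. \<forall>k<M. q k = p k \<Longrightarrow> reval q (RR f g) (n # xs) y"
    "\<And>q. \<forall>k<N. q k = p k \<Longrightarrow> reval q g (n # y # xs) z" by blast
  then have "\<forall>q. (\<forall>k<max M N. q k = p k) \<longrightarrow> reval q (RR f g) (Suc n # xs) z"
    by (metis max_less_iff_conj less_max_iff_disj reval.precS)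
  then show ?case by blast
next
  case (mu f n xs)
  from mu.IH(2) obtain y N where N: "\<And>m. m < n \<Longrightarrow> 0 < y m"
      "\<And>m q. m < n \<Longrightarrow> \<forall>k<N m. q k = p k \<Longrightarrow> reval q f (m # xs) (y m)"
    by metis
  from mu obtain M where M: "\<And>q. \<forall>k<M. q k = p k \<Longrightarrow> reval q f (n # xs) 0" by blast
  have "reval q (RM f) xs n" if "\<forall>k<max M (Max (N ` {..<n})). q k = p k" for q
  proof (rule reval.mu)
    show "\<forall>m<n. \<exists>y>0. reval q f (m # xs) y"
    proof (intro allI impI)
      fix m assume m: "m < n"
      then have "N m \<le> Max (N ` {..<n})" by auto
      with that have "reval q f (m # xs) (y m)" by (intro N m) auto
      then show "\<exists>y>0. reval q f (m # xs) y" using N(1)[OF m] by blast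
    qed
    show "reval q f (n # xs) 0" by (rule M) (use that in auto)
  qed
  then show ?case by blast
qed (auto intro: reval.zero reval.succ reval.proj reval.prec0)

lemma cpt_use:
  assumes "cpt \<Phi>" obtains N where "\<And>q. \<forall>k<N. q k = p k \<Longrightarrow> \<Phi> q x = \<Phi> p x"
proof -
  obtain t where t: "\<And>p x. reval p t [x] (\<Phi> p x)" using assms unfolding cpt_def by blast
  obtain N where "\<And>q. \<forall>k<N. q k = p k \<Longrightarrow> reval q t [x] (\<Phi> p x)" using reval_use[OF t] by blast
  with t have "\<forall>k<N. q k = p k \<Longrightarrow> \<Phi> q x = \<Phi> p x" for q by (meson reval_det)
  then show thesis by (rule that)
qed

section \<open>Iterated limits\<close>

fun limn :: "nat \<Rightarrow> baire \<Rightarrow> baire \<Rightarrow> bool" where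
  "limn 0 p q \<longleftrightarrow> p = q"
| "limn (Suc n) p q \<longleftrightarrow> (\<exists>r. lim_rel p r \<and> limn n r q)"

lemma jump_rep_funpow: "(jump_rep ^^ n) d p x \<longleftrightarrow> (\<exists>q. limn n p q \<and> d q x)"
  by (induction n arbitrary: p) (auto simp: jump_rep_def)

text \<open>\<open>limn\<close> unfolds the limit that is taken first, whereas adding a limit to a
  computation and the induction in \<open>mw_limn\<close> split off the one taken last.\<close>

lemma limn_Suc_right: "limn (Suc n) p q \<longleftrightarrow> (\<exists>r. limn n p r \<and> lim_rel r q)"
  by (induction n arbitrary: p) auto

lemma bpair_simps [simp]: "bpair p q (2 * n) = p n" "bpair p q (Suc (2 * n)) = q n"
  "bfst (bpair p q) = p" "bsnd (bpair p q) = q"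
  by (auto simp: bpair_def bfst_def bsnd_def)

lemma cpt_bfst [cpt_intros]: "cpt T \<Longrightarrow> cpt X \<Longrightarrow> cpt (\<lambda>s x. bfst (T s) (X s x))"
  unfolding bfst_def by (rule cpt_compose[of T], assumption, intro cpt_intros)

lemma cpt_bsnd [cpt_intros]: "cpt T \<Longrightarrow> cpt X \<Longrightarrow> cpt (\<lambda>s x. bsnd (T s) (X s x))"
  unfolding bsnd_def by (rule cpt_compose[of T], assumption, intro cpt_intros)

lemma cpt_bpair [cpt_intros]:
  assumes "cpt (\<lambda>p z. F p (ps z) (pf z))" "cpt (\<lambda>p z. G p (ps z) (pf z))" "cpt X"
  shows "cpt (\<lambda>p x. bpair (F p x) (G p x) (X p x))"
proof -
  have "cpt (\<lambda>p x. F p x (X p x div 2))" "cpt (\<lambda>p x. G p x (X p x div 2))"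
    using cpt_compose[OF assms(1), of "\<lambda>p x. prod_encode (X p x div 2, x)"]
      cpt_compose[OF assms(2), of "\<lambda>p x. prod_encode (X p x div 2, x)"]
    by (simp_all add: cpt_intros assms)
  then show ?thesis unfolding bpair_def by (intro cpt_intros assms)
qed

text \<open>A total computable functional is continuous and so commutes with pointwise limits: a
  single value uses finitely many entries of \<open>r\<close>, and these have all settled from some
  common stage on.\<close>

lemma lim_rel_cpt:
  assumes "cpt \<Phi>" "lim_rel a r"
  shows "lim_rel (\<lambda>z. \<Phi> (bpair p (\<lambda>y. a (prod_encode (y, ps z)))) (pf z)) (\<Phi> (bpair p r))"
  unfolding lim_rel_def
proof
  fix x
  obtain N where N: "\<And>q. \<forall>k<N. q k = bpair p r k \<Longrightarrow> \<Phi> q x = \<Phi> (bpair p r) x"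
    using cpt_use[OF assms(1)] by blast
  obtain i where i: "\<And>y j. i y \<le> j \<Longrightarrow> a (prod_encode (y, j)) = r y"
    using assms(2) unfolding lim_rel_def by metis
  have "\<Phi> (bpair p (\<lambda>y. a (prod_encode (y, j)))) x = \<Phi> (bpair p r) x" if "Max (i ` {..N}) \<le> j" for j
  proof (rule N, intro allI impI)
    fix k assume "k < N"
    then have "i (k div 2) \<le> Max (i ` {..N})" by auto
    with that have "i (k div 2) \<le> j" by linarith
    from i[OF this] show "bpair p (\<lambda>y. a (prod_encode (y, j))) k = bpair p r k"
      by (auto simp: bpair_def)
  qed
  then show "\<exists>i0. \<forall>j\<ge>i0. \<Phi> (bpair p (\<lambda>y. a (prod_encode (y, ps (prod_encode (x, j))))))
      (pf (prod_encode (x, j))) = \<Phi> (bpair p r) x"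
    by (intro exI[of _ "Max (i ` {..N})"]) (simp del: Max_le_iff)
qed

lemma limn_cpt:
  assumes "cpt \<Phi>"
  shows "\<exists>\<Psi>. cpt \<Psi> \<and> (\<forall>p a q. limn n a q \<longrightarrow> limn n (\<Psi> (bpair p a)) (\<Phi> (bpair p q)))"
proof (induction n)
  case 0
  then show ?case using assms by auto
next
  case (Suc n)
  then obtain \<Psi> where \<Psi>: "cpt \<Psi>"
    "\<And>p a q. limn n a q \<Longrightarrow> limn n (\<Psi> (bpair p a)) (\<Phi> (bpair p q))" by blast
  \<comment> \<open>\<open>\<Psi>\<close> is applied separately to every stage \<open>ps z\<close>
    of the outer limit; the parameter in the first component is subject to no limit.\<close>
  define \<Theta> where "\<Theta> s = (\<lambda>z. \<Psi> (bpair (bfst s) (\<lambda>y. bsnd s (prod_encode (y, ps z)))) (pf z))" for s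
  have "cpt \<Theta>"
    unfolding \<Theta>_def by (rule cpt_subst[OF \<Psi>(1)]; intro cpt_intros)
  moreover have "limn (Suc n) (\<Theta> (bpair p a)) (\<Phi> (bpair p q))" if "limn (Suc n) a q" for p a q
  proof -
    from that obtain r where r: "lim_rel a r" "limn n r q" by auto
    have "lim_rel (\<Theta> (bpair p a)) (\<Psi> (bpair p r))"
      unfolding \<Theta>_def using lim_rel_cpt[OF \<Psi>(1) r(1)] by simp
    with \<Psi>(2)[OF r(2)] show ?thesis by auto
  qed
  ultimately show ?case by blast
qed

text \<open>By the limit lemma, this is uniform computability from the n-th jump of
  \<open>p\<close>.\<close>

definition lcpt :: "nat \<Rightarrow> (baire \<Rightarrow> nat \<Rightarrow> nat) \<Rightarrow> bool" where
  "lcpt n F \<longleftrightarrow> (\<exists>H. cpt H \<and> (\<forall>p. limn n (H p) (F p)))"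

lemma lcpt_0: "cpt F \<Longrightarrow> lcpt 0 F"
  unfolding lcpt_def by auto

lemma lcpt_Suc:
  assumes "lcpt n G" "\<And>p. lim_rel (G p) (F p)" shows "lcpt (Suc n) F"
  using assms unfolding lcpt_def limn_Suc_right by blast

lemma lcpt_cpt:
  assumes "lcpt n F" "cpt \<Phi>" shows "lcpt n (\<lambda>p. \<Phi> (bpair p (F p)))"
proof -
  obtain H where H: "cpt H" "\<And>p. limn n (H p) (F p)" using assms(1) unfolding lcpt_def by blast
  obtain \<Psi> where \<Psi>: "cpt \<Psi>"
    "\<And>p a q. limn n a q \<Longrightarrow> limn n (\<Psi> (bpair p a)) (\<Phi> (bpair p q))"
    using limn_cpt[OF assms(2)] by blast
  have "cpt (\<lambda>p z. H p (pf z))" using cpt_compose[OF H(1)] by (simp add: cpt_intros)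
  then have "cpt (\<lambda>p x. \<Psi> (bpair p (H p)) x)"
    by (intro cpt_subst[OF \<Psi>(1)] cpt_intros)
  then show ?thesis unfolding lcpt_def using \<Psi>(2) H(2) by blast
qed

lemma lcpt_compose:
  assumes "lcpt n F" "cpt T" shows "lcpt n (\<lambda>p. F (T p))"
proof -
  obtain H where H: "cpt H" "\<And>p. limn n (H p) (F p)" using assms(1) unfolding lcpt_def by blast
  have "cpt (\<lambda>p x. H (T p) x)"
    by (rule cpt_subst[OF H(1)]) (intro cpt_intros cpt_compose[OF assms(2)])+
  then show ?thesis unfolding lcpt_def using H(2) by blast
qed

section \<open>Plays and Nash equilibria\<close>

definition pre :: "cantor \<Rightarrow> nat \<Rightarrow> bool list" where "pre x n = map x [0..<n]"

lemma length_pre [simp]: "length (pre x n) = n"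
  by (simp add: pre_def)

lemma nth_pre [simp]: "i < n \<Longrightarrow> pre x n ! i = x i"
  by (simp add: pre_def)

lemma pre_0 [simp]: "pre x 0 = []"
  by (simp add: pre_def)

lemma pre_Suc: "pre x (Suc n) = pre x n @ [x n]"
  by (simp add: pre_def)

lemma pre_eq_iff: "pre x n = pre y n \<longleftrightarrow> (\<forall>i<n. x i = y i)"
  by (auto simp: pre_def)

lemma hist_eq_pre: "hist s n = pre (play s) n"
  by (induction n) (auto simp: pre_Suc play_def)

lemma play_step: "play s n = s (pre (play s) n)"
  by (metis hist_eq_pre play_def)

lemma play_eqI: assumes "\<And>n. x n = s (pre x n)" shows "play s = x"
proof
  fix n show "play s n = x n"
  proof (induction n rule: less_induct)
    case (less n)
    then have "pre (play s) n = pre x n" by (simp add: pre_eq_iff)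
    then show ?case using assms play_step by metis
  qed
qed

definition consistent :: "(bool list \<Rightarrow> bool) \<Rightarrow> bool \<Rightarrow> strategy \<Rightarrow> cantor \<Rightarrow> bool" where
  "consistent d i s x \<longleftrightarrow> (\<forall>n. d (pre x n) = i \<longrightarrow> x n = s (pre x n))"

text \<open>A deviation matters only through the play it produces, and the plays that player
  \<open>i\<close> can produce are those in which the opponent keeps to \<open>s\<close>. Strategies
  of the deviator thus disappear from the argument.\<close>

lemma is_NE_iff:
  "is_NE (k, d, pr, v) s \<longleftrightarrow>
    (\<forall>i x. consistent d (\<not> i) s x \<longrightarrow> \<not> prefp pr i (v (play s)) (v x))"
proof
  assume NE: "is_NE (k, d, pr, v) s"
  show "\<forall>i x. consistent d (\<not> i) s x \<longrightarrow> \<not> prefp pr i (v (play s)) (v x)"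
  proof (intro allI impI)
    fix i x assume x: "consistent d (\<not> i) s x"
    define s' where "s' w = (if d w = i then x (length w) else s w)" for w
    have "play s' = x"
      using x by (intro play_eqI) (auto simp: s'_def consistent_def)
    moreover have "\<forall>w. d w \<noteq> i \<longrightarrow> s' w = s w" by (simp add: s'_def)
    ultimately show "\<not> prefp pr i (v (play s)) (v x)" using NE unfolding is_NE_def by auto
  qed
next
  assume *: "\<forall>i x. consistent d (\<not> i) s x \<longrightarrow> \<not> prefp pr i (v (play s)) (v x)"
  have "consistent d (\<not> i) s (play s')" if "\<forall>w. d w \<noteq> i \<longrightarrow> s' w = s w" for i s'
    using that play_step unfolding consistent_def by metis
  with * show "is_NE (k, d, pr, v) s" unfolding is_NE_def by auto
qed

section \<open>Weak parity games on the binary tree\<close>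

text \<open>Positions carry a colour that never increases along a play, and \<open>own c\<close> is the player who wins
  a play whose final colour is \<open>c\<close>. At a position of colour \<open>c\<close>, the opponent \<open>Q = (\<not> own c)\<close> wins iff
  \<open>Q\<close> can force the play into a position of smaller colour that is already winning for \<open>Q\<close>. A finite
  set satisfying \<open>good\<close> certifies that; certificates are numbered through their codes, and
  \<open>att \<dots> N\<close> says that one of the first \<open>N\<close> of them applies.\<close>

definition good :: "(bool list \<Rightarrow> bool) \<Rightarrow> (bool list \<Rightarrow> nat) \<Rightarrow> bool \<Rightarrow> nat \<Rightarrow> (bool list \<Rightarrow> bool)
    \<Rightarrow> bool list set \<Rightarrow> bool" where
  "good d col Q c Z S \<longleftrightarrow> (\<forall>w\<in>S. (col w < c \<and> Z w = Q) \<or> (col w = c \<and>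
     (if d w = Q then w @ [False] \<in> S \<or> w @ [True] \<in> S else w @ [False] \<in> S \<and> w @ [True] \<in> S)))"

definition Sd :: "nat \<Rightarrow> bool list set" where "Sd e = {w. enc w \<in> set_decode e}"

definition att :: "(bool list \<Rightarrow> bool) \<Rightarrow> (bool list \<Rightarrow> nat) \<Rightarrow> bool \<Rightarrow> nat \<Rightarrow> (bool list \<Rightarrow> bool)
    \<Rightarrow> nat \<Rightarrow> bool list \<Rightarrow> bool" where
  "att d col Q c Z N u \<longleftrightarrow> (\<exists>e<N. u \<in> Sd e \<and> good d col Q c Z (Sd e))"

text \<open>The winner at positions of colour at most \<open>c\<close>; only there are the values
  meaningful. The recursion runs on a bound for the colour, rather than on the colour of
  \<open>u\<close>, so that each step adds one unbounded search, which becomes one limit.\<close>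

primrec Zs :: "(bool list \<Rightarrow> bool) \<Rightarrow> (bool list \<Rightarrow> nat) \<Rightarrow> (nat \<Rightarrow> bool) \<Rightarrow> nat \<Rightarrow> bool list \<Rightarrow> bool" where
  "Zs d col own 0 u = own 0"
| "Zs d col own (Suc c) u = (if col u \<le> c then Zs d col own c u
     else own (Suc c) \<noteq> (\<exists>N. att d col (\<not> own (Suc c)) (Suc c) (Zs d col own c) N u))"

lemma inj_enc: "inj enc"
  by (rule injI) simp

lemma Sd_surj: assumes "finite S" obtains e where "Sd e = S"
proof
  show "Sd (set_encode (enc ` S)) = S" using assms by (auto simp: Sd_def)
qed

lemma finite_Sd [simp]: "finite (Sd e)"
  unfolding Sd_def using finite_vimageI[OF finite_set_decode inj_enc] by (simp add: vimage_def)

lemma att_mono: "att d col Q c Z N u \<Longrightarrow> N \<le> M \<Longrightarrow> att d col Q c Z M u"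
  unfolding att_def by (meson less_le_trans)

lemma ex_att_iff: "(\<exists>N. att d col Q c Z N u) \<longleftrightarrow> (\<exists>S. finite S \<and> u \<in> S \<and> good d col Q c Z S)"
proof
  assume "\<exists>S. finite S \<and> u \<in> S \<and> good d col Q c Z S"
  then obtain S e where "u \<in> S" "good d col Q c Z S" "Sd e = S" using Sd_surj by metis
  then show "\<exists>N. att d col Q c Z N u" unfolding att_def by blast
next
  assume "\<exists>N. att d col Q c Z N u"
  then obtain e where "u \<in> Sd e" "good d col Q c Z (Sd e)" unfolding att_def by blast
  then show "\<exists>S. finite S \<and> u \<in> S \<and> good d col Q c Z S" by (intro exI[of _ "Sd e"]) simp
qed

lemma good_cong: "(\<And>w. col w < c \<Longrightarrow> Z w = Z' w) \<Longrightarrow> good d col Q c Z S = good d col Q c Z' S"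
  unfolding good_def by blast

lemma att_cong: "(\<And>w. col w < c \<Longrightarrow> Z w = Z' w) \<Longrightarrow> att d col Q c Z N u = att d col Q c Z' N u"
  unfolding att_def using good_cong[of col c Z Z' d Q] by simp

lemma nat_decseq_eventually_const:
  fixes f :: "nat \<Rightarrow> nat"
  assumes "\<And>n. f (Suc n) \<le> f n" obtains n0 where "\<And>n. n \<ge> n0 \<Longrightarrow> f n = f n0"
proof -
  obtain n0 where n0: "\<And>n. f n0 \<le> f n" using exists_least_iff[of "\<lambda>k. \<exists>n. f n = k"]
    by (metis not_le_imp_less)
  have "f n \<le> f n0" if "n \<ge> n0" for n
    using lift_Suc_antimono_le[of f, OF assms that] .
  with n0 show thesis by (intro that[of n0]) (simp add: order_antisym)
qed

locale weak_parity =
  fixes d :: "bool list \<Rightarrow> bool" and col :: "bool list \<Rightarrow> nat" and own :: "nat \<Rightarrow> bool"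
  assumes col_le: "col (u @ [b]) \<le> col u"
begin

definition win :: "bool list \<Rightarrow> bool" where "win u = Zs d col own (col u) u"

lemma Zs_eq_win: "col u \<le> c \<Longrightarrow> Zs d col own c u = win u"
  by (induction c) (auto simp: win_def le_Suc_eq)

definition opp :: "bool list \<Rightarrow> bool" where "opp u \<longleftrightarrow> \<not> own (col u)"

abbreviation atc :: "nat \<Rightarrow> nat \<Rightarrow> bool list \<Rightarrow> bool" where
  "atc c \<equiv> att d col (\<not> own c) c win"

lemma att_Zs: "att d col (\<not> own (Suc c)) (Suc c) (Zs d col own c) = atc (Suc c)"
  by (intro ext att_cong Zs_eq_win) simp

lemma win_0: "col u = 0 \<Longrightarrow> win u = own 0"
  by (simp add: win_def)

lemma win_pos: "0 < col u \<Longrightarrow> win u = (own (col u) \<noteq> (\<exists>N. atc (col u) N u))"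
  unfolding win_def[of u] by (cases "col u") (auto simp: att_Zs)

text \<open>Certificates are closed under union, and branching is binary, so the certificates of the
  children combine with \<open>u\<close> into a finite one.\<close>

lemma ex_atc_insert:
  assumes "col u = c"
    and "if d u = (\<not> own c) then \<exists>b. \<exists>N. atc c N (u @ [b])
         else \<forall>b. \<exists>N. atc c N (u @ [b])"
  shows "\<exists>N. atc c N u"
proof -
  have ins: "\<exists>N. atc c N u" if "finite S" "good d col (\<not> own c) c win S"
    "if d u = (\<not> own c) then u @ [False] \<in> S \<or> u @ [True] \<in> S else u @ [False] \<in> S \<and> u @ [True] \<in> S" for S
    unfolding ex_att_iff
    by (rule exI[of _ "insert u S"]) (use that assms(1) in \<open>auto simp: good_def split: if_splits\<close>)
  show ?thesis
  proof (cases "d u = (\<not> own c)")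
    case True
    with assms(2) obtain b S where "finite S" "u @ [b] \<in> S" "good d col (\<not> own c) c win S"
      using ex_att_iff by auto
    with True show ?thesis by (intro ins[of S]) (cases b; auto)+
  next
    case False
    with assms(2) have "\<exists>N. atc c N (u @ [False])" "\<exists>N. atc c N (u @ [True])" by (auto split: if_splits)
    then obtain S T where *: "finite S" "u @ [False] \<in> S" "good d col (\<not> own c) c win S"
      "finite T" "u @ [True] \<in> T" "good d col (\<not> own c) c win T"
      using ex_att_iff by metis
    then have "good d col (\<not> own c) c win (S \<union> T)" unfolding good_def by (auto split: if_splits)
    with * False show ?thesis by (intro ins[of "S \<union> T"]) auto
  qed
qed

text \<open>The certificate of \<open>u\<close> already contains the required child, so the bound
  \<open>N\<close> does not grow along the play.\<close>

lemma atc_step: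
  assumes "atc c N u" "col u = c"
  shows "if d u = (\<not> own c) then \<exists>b. atc c N (u @ [b]) else \<forall>b. atc c N (u @ [b])"
proof -
  obtain e where e: "e < N" "u \<in> Sd e" "good d col (\<not> own c) c win (Sd e)"
    using assms(1) unfolding att_def by blast
  then have *: "if d u = (\<not> own c) then u @ [False] \<in> Sd e \<or> u @ [True] \<in> Sd e
      else u @ [False] \<in> Sd e \<and> u @ [True] \<in> Sd e"
    using assms(2) unfolding good_def by fastforce
  have "w \<in> Sd e \<Longrightarrow> atc c N w" for w using e unfolding att_def by blast
  with * show ?thesis by (metis (full_types))
qed

lemma atc_lower:
  assumes "col w < c" shows "(\<exists>N. atc c N w) \<longleftrightarrow> win w = (\<not> own c)"
proof
  assume "win w = (\<not> own c)"
  with assms show "\<exists>N. atc c N w"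
    unfolding ex_att_iff by (intro exI[of _ "{w}"]) (simp add: good_def)
next
  assume "\<exists>N. atc c N w"
  with assms show "win w = (\<not> own c)" unfolding ex_att_iff good_def by fastforce
qed

lemma win_iff_atc:
  assumes "0 < c" "col w \<le> c" shows "(\<exists>N. atc c N w) \<longleftrightarrow> win w = (\<not> own c)"
proof (cases "col w = c")
  case True
  with win_pos[of w] assms(1) show ?thesis by auto
next
  case False
  with atc_lower[of w c] assms(2) show ?thesis by simp
qed

text \<open>A choice function points to a child that enters the attractor no later than its sibling.\<close>

definition choice :: "(bool list \<Rightarrow> bool) \<Rightarrow> bool" where
  "choice b \<longleftrightarrow> (\<forall>u N. 0 < col u \<longrightarrow> atc (col u) N (u @ [\<not> b u]) \<longrightarrow> atc (col u) N (u @ [b u]))"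

definition act :: "(bool list \<Rightarrow> bool) \<Rightarrow> bool list \<Rightarrow> bool" where
  "act b u = (if d u = opp u then b u else \<not> b u)"

lemma win_step:
  assumes "choice b" "d u = win u \<longrightarrow> x = act b u"
  shows "win (u @ [x]) = win u"
    and "win u = opp u \<Longrightarrow> atc (col u) N u \<Longrightarrow> atc (col u) N (u @ [x])"
proof -
  define c where "c = col u"
  have le: "col (u @ [y]) \<le> c" for y using col_le c_def by simp
  show *: "atc (col u) N (u @ [x])" if o: "win u = opp u" and a: "atc (col u) N u" for N
  proof (cases "d u = opp u")
    case True
    then have "x = b u" using assms(2) o by (simp add: act_def)
    moreover obtain y where "atc c N (u @ [y])"
      using atc_step[OF a refl] True by (auto simp: opp_def c_def)
    moreover have "0 < c" using o win_0[of u] by (auto simp: opp_def c_def)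
    ultimately show ?thesis
      using assms(1) by (cases "y = b u") (auto simp: choice_def c_def)
  next
    case False
    then show ?thesis using atc_step[OF a refl] by (auto simp: opp_def)
  qed
  show "win (u @ [x]) = win u"
  proof (cases "c = 0")
    case True
    then have "col (u @ [x]) = 0" using le[of x] by simp
    then show ?thesis using True by (simp add: win_0 c_def)
  next
    case False
    then have c: "0 < c" by simp
    show ?thesis
    proof (cases "win u = opp u")
      case True
      then obtain N where "atc c N u" using win_iff_atc[OF c, of u] by (auto simp: opp_def c_def)
      from *[OF True this[unfolded c_def]] have "win (u @ [x]) = (\<not> own c)"
        using win_iff_atc[OF c le] c_def by blast
      with True show ?thesis by (simp add: opp_def c_def)
    next
      case False
      then have na: "\<nexists>N. atc c N u" using win_iff_atc[OF c, of u] by (auto simp: opp_def c_def)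
      \<comment> \<open>The avoiding player moves to the child that enters later. Had that child
        entered by stage \<open>N\<close>, its sibling would have as well, and then \<open>u\<close>
        itself would be attracted.\<close>
      have "\<not> atc c N (u @ [x])" for N
      proof
        assume N: "atc c N (u @ [x])"
        have "d u \<noteq> (\<not> own c)"
        proof
          assume "d u = (\<not> own c)"
          with ex_atc_insert[OF c_def[symmetric]] N have "\<exists>N. atc c N u" by auto
          with na show False ..
        qed
        then have "x = (\<not> b u)" using assms(2) False by (auto simp: act_def opp_def c_def)
        with N have "atc c N (u @ [b u])" using assms(1) c by (simp add: choice_def c_def)
        have "\<exists>N. atc c N (u @ [y])" for y
        proof (cases "y = x")
          case True
          with N show ?thesis by blast
        next
          case False
          with \<open>x = (\<not> b u)\<close> have "y = b u" by simp
          with \<open>atc c N (u @ [b u])\<close> show ?thesis by blast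
        qed
        with ex_atc_insert[OF c_def[symmetric]] \<open>d u \<noteq> (\<not> own c)\<close> have "\<exists>N. atc c N u" by simp
        with na show False ..
      qed
      then have "win (u @ [x]) \<noteq> (\<not> own c)" using win_iff_atc[OF c le] by blast
      with False show ?thesis by (auto simp: opp_def c_def)
    qed
  qed
qed

text \<open>If the loser owned the final colour, every late prefix would lie in the attractor within
  one fixed stage \<open>N\<close>. That stage is a finite union of finite certificates, while the
  prefixes of a play are pairwise distinct.\<close>

lemma winner_wins:
  assumes "choice b" "consistent d i (act b) x" "win [] = i"
    and final: "\<And>n. n \<ge> n0 \<Longrightarrow> col (pre x n) = c"
  shows "own c = i"
proof (rule ccontr)
  assume ne: "own c \<noteq> i"
  have step: "d (pre x n) = i \<longrightarrow> x n = act b (pre x n)" for n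
    using assms(2) by (simp add: consistent_def)
  have win: "win (pre x n) = i" for n
    by (induction n) (use assms step win_step(1) in \<open>auto simp: pre_Suc\<close>)
  have "0 < c"
    using ne win_0[of "pre x n0"] win[of n0] final[of n0] by (auto intro: ccontr)
  then obtain N where N: "atc c N (pre x n0)"
    using win_iff_atc[of c "pre x n0"] win[of n0] final[of n0] ne by auto
  have at: "atc c N (pre x (n0 + k))" for k
  proof (induction k)
    case (Suc k)
    have "win (pre x (n0 + k)) = opp (pre x (n0 + k))"
      using win ne final by (auto simp: opp_def)
    from win_step(2)[OF assms(1) _ this, of "x (n0 + k)" N] Suc final win step show ?case
      by (simp add: pre_Suc)
  qed (use N in simp)
  have "(\<lambda>k. pre x (n0 + k)) ` UNIV \<subseteq> (\<Union>e<N. Sd e)"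
    using at unfolding att_def by blast
  then have "finite ((\<lambda>k. pre x (n0 + k)) ` (UNIV :: nat set))"
    by (rule finite_subset) simp
  moreover have "inj (\<lambda>k. pre x (n0 + k))"
    by (rule injI) (metis add_left_cancel length_pre)
  ultimately show False using finite_imageD infinite_UNIV_nat by blast
qed

lemma choice_exists: "\<exists>b. choice b"
proof -
  \<comment> \<open>\<open>True\<close> is chosen only if it enters strictly earlier; ties,
    including children that never enter, go to \<open>False\<close>.\<close>
  define b where "b u \<longleftrightarrow> (\<exists>N. atc (col u) N (u @ [True]) \<and> \<not> atc (col u) N (u @ [False]))" for u
  have "choice b" unfolding choice_def
  proof (intro allI impI)
    fix u N assume N: "atc (col u) N (u @ [\<not> b u])"
    show "atc (col u) N (u @ [b u])"
    proof (cases "b u")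
      case True
      then obtain M where "atc (col u) M (u @ [True])" "\<not> atc (col u) M (u @ [False])"
        unfolding b_def by blast
      moreover from this have "M \<le> N" using N True att_mono[of _ _ _ _ _ N _ M] by (cases "M \<le> N") auto
      ultimately show ?thesis using True att_mono by auto
    next
      case False
      then have "atc (col u) N (u @ [True]) \<longrightarrow> atc (col u) N (u @ [False])" unfolding b_def by blast
      with N False show ?thesis by simp
    qed
  qed
  then show ?thesis by blast
qed

end

section \<open>Names of sets in the difference hierarchy as colourings\<close>

text \<open>The length of \<open>u\<close> also bounds how far the enumeration is inspected. This
  makes colours decidable at every position and monotone along plays.\<close>

definition seen :: "baire \<Rightarrow> bool list \<Rightarrow> bool" where
  "seen P u \<longleftrightarrow> (\<exists>i<length u. 0 < P i \<and> length (word (P i - 1)) \<le> length u \<and>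
     (\<forall>j<length (word (P i - 1)). bit_at u j = bit_at (word (P i - 1)) j))"

definition ncol :: "nat \<Rightarrow> baire \<Rightarrow> bool list \<Rightarrow> nat" where
  "ncol m r u = bleast m (\<lambda>c. seen (bcomp r c) u)"

lemma seen_snoc: "seen P u \<Longrightarrow> seen P (u @ [b])"
proof -
  assume "seen P u"
  then obtain i where i: "i < length u" "0 < P i" "length (word (P i - 1)) \<le> length u"
     "\<forall>j<length (word (P i - 1)). bit_at u j = bit_at (word (P i - 1)) j"
    unfolding seen_def by blast
  then have "\<forall>j<length (word (P i - 1)). bit_at (u @ [b]) j = bit_at (word (P i - 1)) j"
    by (auto simp: bit_at_def nth_append)
  with i show ?thesis unfolding seen_def by (intro exI[of _ i]) simp
qed

lemma cyl_decode: "x \<in> cyl (list_decode c) \<longleftrightarrow> pre x (length (word c)) = word c"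
  unfolding list_eq_iff_nth_eq[of "pre _ _"] by (auto simp: cyl_def word_def)

lemma open_of_iff: "x \<in> open_of P \<longleftrightarrow> (\<exists>i. 0 < P i \<and> pre x (length (word (P i - 1))) = word (P i - 1))"
  by (simp add: open_of_def cyl_decode)

lemma open_of_seen: "x \<in> open_of P \<longleftrightarrow> (\<exists>n. seen P (pre x n))"
proof
  assume "x \<in> open_of P"
  then obtain i where i: "0 < P i" "pre x (length (word (P i - 1))) = word (P i - 1)"
    unfolding open_of_iff by blast
  let ?w = "word (P i - 1)"
  have "bit_at (pre x n) j = bit_at ?w j" if "j < length ?w" "length ?w \<le> n" for j n
    using that nth_pre[of j "length ?w" x] unfolding i(2) by (simp add: bit_at_def)
  then have "seen P (pre x (max (Suc i) (length ?w)))"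
    unfolding seen_def using i by (intro exI[of _ i]) auto
  then show "\<exists>n. seen P (pre x n)" by blast
next
  assume "\<exists>n. seen P (pre x n)"
  then obtain n i where i: "0 < P i" "length (word (P i - 1)) \<le> n"
     "\<forall>j<length (word (P i - 1)). bit_at (pre x n) j = bit_at (word (P i - 1)) j"
    unfolding seen_def by auto
  then have "pre x (length (word (P i - 1))) = word (P i - 1)"
    by (intro nth_equalityI) (auto simp: bit_at_def)
  with i(1) show "x \<in> open_of P" unfolding open_of_iff by blast
qed

lemma ncol_snoc: "ncol m r (u @ [b]) \<le> ncol m r u"
proof (cases "ncol m r u < m")
  case True
  then have "seen (bcomp r (ncol m r u)) (u @ [b])"
    using bleast_spec(3)[of m "\<lambda>c. seen (bcomp r c) u"] unfolding ncol_def by (intro seen_snoc)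
  then show ?thesis unfolding ncol_def[of m r "u @ [b]"] using bleast_spec(2) not_le by blast
next
  case False
  then show ?thesis using bleast_spec(1)[of m "\<lambda>c. seen (bcomp r c) (u @ [b])"]
    by (simp add: ncol_def)
qed

lemma first_idx_eq_bleast: "first_idx m r x = bleast m (\<lambda>c. x \<in> open_of (bcomp r c))"
proof (cases "\<exists>c<m. x \<in> open_of (bcomp r c)")
  case True
  define l where "l = (LEAST c. c < m \<and> x \<in> open_of (bcomp r c))"
  have l: "l < m \<and> x \<in> open_of (bcomp r l)"
    unfolding l_def by (rule LeastI_ex) (use True in blast)
  have "bleast m (\<lambda>c. x \<in> open_of (bcomp r c)) = l"
  proof (rule bleast_eqI)
    fix i assume "i < l"
    then show "x \<notin> open_of (bcomp r i)" using not_less_Least[of i "\<lambda>c. c < m \<and> x \<in> open_of (bcomp r c)"] l unfolding l_def by auto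
  qed (use l in auto)
  with True show ?thesis unfolding first_idx_def l_def by simp
next
  case False
  then show ?thesis unfolding first_idx_def by (auto intro!: bleast_eqI[symmetric])
qed

lemma ncol_eventually: "\<exists>n0. \<forall>n\<ge>n0. ncol m r (pre x n) = first_idx m r x"
proof -
  have "ncol m r (pre x (Suc n)) \<le> ncol m r (pre x n)" for n by (simp add: pre_Suc ncol_snoc)
  then obtain n0 where n0: "\<And>n. n \<ge> n0 \<Longrightarrow> ncol m r (pre x n) = ncol m r (pre x n0)"
    by (rule nat_decseq_eventually_const[of "\<lambda>n. ncol m r (pre x n)"]) blast
  define f where "f = ncol m r (pre x n0)"
  have "first_idx m r x = f"
    unfolding first_idx_eq_bleast
  proof (rule bleast_eqI)
    show "f \<le> m" unfolding f_def ncol_def by (rule bleast_spec)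
    show "x \<in> open_of (bcomp r f)" if "f < m"
      unfolding open_of_seen using that bleast_spec(3)[of m "\<lambda>c. seen (bcomp r c) (pre x n0)"]
      by (intro exI[of _ n0]) (simp add: f_def ncol_def)
    fix c assume c: "c < f"
    show "x \<notin> open_of (bcomp r c)"
    proof
      assume "x \<in> open_of (bcomp r c)"
      then obtain n where n: "seen (bcomp r c) (pre x n)" unfolding open_of_seen by blast
      have "seen (bcomp r c) (pre x (n + k))" for k
        by (induction k) (auto simp: pre_Suc n seen_snoc)
      from this[of n0] have "ncol m r (pre x (n + n0)) \<le> c"
        unfolding ncol_def using bleast_spec(2)[of c m "\<lambda>c. seen (bcomp r c) (pre x (n + n0))"]
        by (meson not_le)
      with n0[of "n + n0"] c show False by (simp add: f_def)
    qed
  qed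
  then have "ncol m r (pre x n) = first_idx m r x" if "n \<ge> n0" for n
    using n0[OF that] by (simp only: f_def)
  then show ?thesis by blast
qed

text \<open>Converse of \<open>ncol_eventually\<close>, used to name a constructed game: if the c-th
  open set enumerates all positions of colour at most \<open>c\<close>, the first index containing a
  play is its final colour.\<close>

lemma first_idx_colour:
  assumes r: "\<And>c. c < m \<Longrightarrow> bcomp r c = (\<lambda>i. if col (word i) \<le> c then Suc i else 0)"
    and mono: "\<And>u b. col (u @ [b]) \<le> col u"
    and final: "\<And>n. n \<ge> n0 \<Longrightarrow> col (pre x n) = f" and "f \<le> m"
  shows "first_idx m r x = f"
  unfolding first_idx_eq_bleast
proof (rule bleast_eqI)
  have op: "x \<in> open_of (bcomp r c) \<longleftrightarrow> (\<exists>n. col (pre x n) \<le> c)" if "c < m" for c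
  proof -
    have "x \<in> open_of (bcomp r c) \<longleftrightarrow> (\<exists>i. col (word i) \<le> c \<and> pre x (length (word i)) = word i)"
      unfolding open_of_iff r[OF that] by auto
    also have "\<dots> \<longleftrightarrow> (\<exists>n. col (pre x n) \<le> c)"
      by (metis length_pre word_enc)
    finally show ?thesis .
  qed
  show "x \<in> open_of (bcomp r f)" if "f < m" using op[OF that] final by blast
  fix c assume c: "c < f"
  have "f \<le> col (pre x n)" for n
  proof -
    have "col (pre x (n + n0)) \<le> col (pre x n)"
      using lift_Suc_antimono_le[of "\<lambda>n. col (pre x n)" n "n + n0"] mono by (simp add: pre_Suc)
    with final[of "n + n0"] show ?thesis by simp
  qed
  with c show "x \<notin> open_of (bcomp r c)" using op[of c] \<open>f \<le> m\<close> by (auto simp: not_le intro: less_le_trans)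
qed fact

section \<open>Computing equilibria from choice and LPO\<close>

text \<open>For a game named by \<open>p\<close>, \<open>gcol m p a\<close> and \<open>gown m p a\<close> describe the win/lose game in which player 1
  aims for outcomes at least as good as \<open>a\<close>.\<close>

definition gk :: "baire \<Rightarrow> nat" where "gk p = bcomp p 0 0"
definition gd :: "baire \<Rightarrow> bool list \<Rightarrow> bool" where "gd p u \<longleftrightarrow> bcomp p 1 (enc u) \<noteq> 0"
definition gpr :: "baire \<Rightarrow> nat \<Rightarrow> nat \<Rightarrow> bool" where
  "gpr p a b \<longleftrightarrow> a < gk p \<and> b < gk p \<and> bcomp p 2 (prod_encode (a, b)) \<noteq> 0"
definition gup :: "baire \<Rightarrow> nat \<Rightarrow> nat set" where "gup p a = {b. b < gk p \<and> (b = a \<or> gpr p a b)}"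
definition gname :: "baire \<Rightarrow> nat \<Rightarrow> baire" where
  "gname p a = bcomp (bcomp p 3) (prod_encode (1, set_encode (gup p a)))"
definition gcol :: "nat \<Rightarrow> baire \<Rightarrow> nat \<Rightarrow> bool list \<Rightarrow> nat" where
  "gcol m p a = ncol m (\<lambda>k. gname p a (Suc k))"
definition gown :: "nat \<Rightarrow> baire \<Rightarrow> nat \<Rightarrow> nat \<Rightarrow> bool" where
  "gown m p a c \<longleftrightarrow> (even c \<noteq> even m) \<noteq> (gname p a 0 = 1)"
definition gatt :: "nat \<Rightarrow> baire \<Rightarrow> baire \<Rightarrow> nat \<Rightarrow> nat \<Rightarrow> nat \<Rightarrow> bool list \<Rightarrow> bool" where
  "gatt m p z a c =
    att (gd p) (gcol m p a) (\<not> gown m p a c) c (\<lambda>w. z (prod_encode (a, enc w)) \<noteq> 0)"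

lemma cpt_bcomp [cpt_intros]: "cpt T \<Longrightarrow> cpt I \<Longrightarrow> cpt X \<Longrightarrow> cpt (\<lambda>s x. bcomp (T s) (I s x) (X s x))"
  unfolding bcomp_def by (rule cpt_compose[of T], assumption, intro cpt_intros)

lemma cpt_gk [cpt_intros]: "cpt T \<Longrightarrow> cpt (\<lambda>s x. gk (T s))"
  unfolding gk_def by (intro cpt_intros)

lemma dec_gd [cpt_intros]: "cpt T \<Longrightarrow> cptw U \<Longrightarrow> dec (\<lambda>s x. gd (T s) (U s x))"
  unfolding gd_def by (intro cpt_intros)

lemma dec_gpr [cpt_intros]:
  "cpt T \<Longrightarrow> cpt A \<Longrightarrow> cpt B \<Longrightarrow> dec (\<lambda>s x. gpr (T s) (A s x) (B s x))"
  unfolding gpr_def by (intro cpt_intros)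

lemma cpt_gname [cpt_intros]:
  assumes "cpt T" "cpt A" "cpt X" shows "cpt (\<lambda>s x. gname (T s) (A s x) (X s x))"
proof -
  have "cpt (\<lambda>s x. set_encode (gup (T s) x))"
    unfolding gup_def by (intro cpt_intros assms)
  then have "cpt (\<lambda>s x. set_encode (gup (T s) (A s x)))"
    by (rule cpt_compose) fact
  then show ?thesis
    unfolding gname_def bcomp_def by (intro cpt_compose[OF assms(1)] cpt_intros assms)
qed

lemma cpt_param:
  assumes "cpt (\<lambda>p z. P p (ps z) (pf z))" "cpt X" "cpt F"
  shows "cpt (\<lambda>p x. P p (X p x) (F p x))"
  using cpt_compose[OF assms(1), of "\<lambda>p x. prod_encode (F p x, X p x)"] assms(2,3)
  by (simp add: cpt_intros)

lemma dec_param: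
  assumes "dec (\<lambda>p z. P p (ps z) (pf z))" "cpt X" "cpt F"
  shows "dec (\<lambda>p x. P p (X p x) (F p x))"
  using dec_compose[OF assms(1), of "\<lambda>p x. prod_encode (F p x, X p x)"] assms(2,3)
  by (simp add: cpt_intros)

lemma dec_seen:
  assumes "cpt (\<lambda>p z. P p (ps z) (pf z))" "cptw U"
  shows "dec (\<lambda>p x. seen (P p x) (U p x))"
  unfolding seen_def
  by (intro cpt_intros cpt_param[OF assms(1)] cptw_compose[OF assms(2)] assms(2))

lemma cpt_gcol [cpt_intros]:
  assumes "cpt T" "cpt A" "cptw U" shows "cpt (\<lambda>s x. gcol m (T s) (A s x) (U s x))"
  unfolding gcol_def ncol_def bcomp_def
  by (intro cpt_intros dec_seen assms(1) cpt_compose[OF assms(2)] cptw_compose[OF assms(3)])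

lemma dec_gown [cpt_intros]:
  assumes "cpt T" "cpt A" "cpt C" shows "dec (\<lambda>s x. gown m (T s) (A s x) (C s x))"
  unfolding gown_def by (intro cpt_intros assms)

text \<open>Rewrites a quantifier over words as one over bounded numbers; the guard
  \<open>enc (word i) = i\<close> skips the codes that are not canonical.\<close>

lemma good_Sd: "good d col Q c Z (Sd e) \<longleftrightarrow> (\<forall>i\<in>set_decode e. enc (word i) = i \<longrightarrow>
    (col (word i) < c \<and> Z (word i) = Q) \<or> (col (word i) = c \<and>
     (if d (word i) = Q
      then enc (word i @ [False]) \<in> set_decode e \<or> enc (word i @ [True]) \<in> set_decode e
      else enc (word i @ [False]) \<in> set_decode e \<and> enc (word i @ [True]) \<in> set_decode e)))"
proof -
  have "(\<forall>w\<in>Sd e. P w) \<longleftrightarrow> (\<forall>i\<in>set_decode e. enc (word i) = i \<longrightarrow> P (word i))" for P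
    unfolding Sd_def by (metis mem_Collect_eq word_enc)
  then show ?thesis unfolding good_def by (simp only: Sd_def mem_Collect_eq)
qed

lemma dec_att:
  assumes "dec (\<lambda>p z. D p (ps z) (word (pf z)))" "cpt (\<lambda>p z. C p (ps z) (word (pf z)))"
    "dec (\<lambda>p z. Z p (ps z) (word (pf z)))" "dec Q" "cpt B" "cpt N" "cptw U"
  shows "dec (\<lambda>p x. att (D p x) (C p x) (Q p x) (B p x) (Z p x) (N p x) (U p x))"
  unfolding att_def good_Sd
  unfolding Sd_def mem_Collect_eq
  by (intro cpt_intros assms cptw_compose[OF assms(7)] dec_compose[OF assms(4)] cpt_compose[OF assms(5)]
      dec_param[OF assms(1)] cpt_param[OF assms(2)] dec_param[OF assms(3)])

lemma dec_gatt [cpt_intros]: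
  assumes "cpt T" "cpt R" "cpt A" "cpt C" "cpt N" "cptw U"
  shows "dec (\<lambda>s x. gatt m (T s) (R s) (A s x) (C s x) (N s x) (U s x))"
  unfolding gatt_def
  by (rule dec_att) (intro cpt_intros assms cpt_compose[OF assms(2)] cpt_compose[OF assms(3)])+

subsection \<open>The winning regions are iterated limits\<close>

definition gwin :: "nat \<Rightarrow> nat \<Rightarrow> baire \<Rightarrow> baire" where
  "gwin m c p x = of_bool (Zs (gd p) (gcol m p (pf x)) (gown m p (pf x)) c (word (ps x)))"

text \<open>One limit for each colour above 0: attractor stages increase with \<open>N\<close>, so
  the approximation at stage \<open>N\<close> changes at most once.\<close>

lemma lcpt_gwin: "lcpt c (gwin m c)"
proof (induction c)
  case 0
  have "cpt (\<lambda>p x. of_bool (gown m p (pf x) 0))" by (intro cpt_intros)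
  then show ?case unfolding gwin_def by (intro lcpt_0) simp
next
  case (Suc c)
  define \<Phi> :: "baire \<Rightarrow> nat \<Rightarrow> nat" where
    "\<Phi> s y = of_bool (let p = bfst s; z = bsnd s; x = pf y; a = pf x; u = word (ps x) in
       if gcol m p a u \<le> c then z x \<noteq> 0
       else gown m p a (Suc c) \<noteq> gatt m p z a (Suc c) (ps y) u)" for s y
  have "cpt \<Phi>"
    unfolding \<Phi>_def Let_def by (intro cpt_intros)
  then have "lcpt c (\<lambda>p. \<Phi> (bpair p (gwin m c p)))"
    by (rule lcpt_cpt[OF Suc])
  moreover have "lim_rel (\<Phi> (bpair p (gwin m c p))) (gwin m (Suc c) p)" for p
    unfolding lim_rel_def
  proof
    fix x
    define a where "a = pf x"
    define u where "u = word (ps x)"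
    let ?A = "att (gd p) (gcol m p a) (\<not> gown m p a (Suc c)) (Suc c)
      (Zs (gd p) (gcol m p a) (gown m p a) c)"
    have \<Phi>: "\<Phi> (bpair p (gwin m c p)) (prod_encode (x, N)) = of_bool (
        if gcol m p a u \<le> c then Zs (gd p) (gcol m p a) (gown m p a) c u
        else gown m p a (Suc c) \<noteq> ?A N u)" for N
      by (simp add: \<Phi>_def gwin_def gatt_def a_def u_def Let_def)
    obtain N0 where "\<And>N. N \<ge> N0 \<Longrightarrow> ?A N u = (\<exists>N. ?A N u)"
      using att_mono by (metis (no_types))
    then show "\<exists>i0. \<forall>i\<ge>i0. \<Phi> (bpair p (gwin m c p)) (prod_encode (x, i)) = gwin m (Suc c) p x"
      unfolding \<Phi> by (intro exI[of _ N0]) (auto simp: gwin_def a_def[symmetric] u_def[symmetric])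
  qed
  ultimately show ?case by (rule lcpt_Suc)
qed

lemma weak_parity_gcol: "weak_parity (gcol m p a)"
  by standard (simp add: gcol_def ncol_snoc)

abbreviation gwinner :: "nat \<Rightarrow> baire \<Rightarrow> nat \<Rightarrow> bool list \<Rightarrow> bool" where
  "gwinner m p a \<equiv> weak_parity.win (gd p) (gcol m p a) (gown m p a)"

abbreviation gchoice :: "nat \<Rightarrow> baire \<Rightarrow> nat \<Rightarrow> (bool list \<Rightarrow> bool) \<Rightarrow> bool" where
  "gchoice m p a \<equiv> weak_parity.choice (gd p) (gcol m p a) (gown m p a)"

abbreviation gact :: "nat \<Rightarrow> baire \<Rightarrow> nat \<Rightarrow> (bool list \<Rightarrow> bool) \<Rightarrow> bool list \<Rightarrow> bool" where
  "gact m p a \<equiv> weak_parity.act (gd p) (gcol m p a) (gown m p a)"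

text \<open>The attractor of colour \<open>c\<close> consults winners of smaller colour only, so the
  n-fold limit \<open>gwin m n\<close> decides its stages even for \<open>c = n + 1\<close>. This
  saves the last jump.\<close>

lemma gatt_gwin:
  assumes "c \<le> Suc n"
  shows "gatt m p (gwin m n p) a c =
    att (gd p) (gcol m p a) (\<not> gown m p a c) c (gwinner m p a)"
proof (intro ext)
  interpret weak_parity "gd p" "gcol m p a" "gown m p a" by (rule weak_parity_gcol)
  show "gatt m p (gwin m n p) a c N u = att (gd p) (gcol m p a) (\<not> gown m p a c) c win N u" for N u
    unfolding gatt_def using assms by (intro att_cong) (simp add: gwin_def Zs_eq_win)
qed

lemma gcol_le: "gcol m p a u \<le> m"
  unfolding gcol_def ncol_def by (rule bleast_spec)

text \<open>No part of the enumeration is inspected at the root, so its colour is the top one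
  whatever the name, and one query at that colour decides the winner.\<close>

lemma gcol_Nil: "gcol m p a [] = m"
  unfolding gcol_def ncol_def by (rule bleast_eqI) (auto simp: seen_def)

subsection \<open>Correctness of the strategy profile\<close>

lemma mod_2_neq_iff: "i mod 2 \<noteq> j mod 2 \<longleftrightarrow> even i \<noteq> even j" for i j :: nat
  by presburger

lemma game_repD:
  assumes "game_rep m p (k, d, pr, v)"
  shows "k = gk p" "d = gd p" "pr = gpr p"
    "\<And>a x. a < k \<Longrightarrow> (v x = a \<or> pr a (v x)) = gown m p a (first_idx m (\<lambda>k. gname p a (Suc k)) x)"
proof -
  from assms have v: "valid_game (k, d, pr, v)" and k: "bcomp p 0 0 = k"
    and d: "\<And>j. bcomp p 1 j = of_bool (d (word j))"
    and pr: "\<And>a b. a < k \<Longrightarrow> b < k \<Longrightarrow> bcomp p 2 (prod_encode (a, b)) = of_bool (pr a b)"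
    and g: "\<And>i U. upper_set k pr i U \<Longrightarrow>
        gamma_rep m (bcomp (bcomp p 3) (prod_encode (of_bool i, set_encode U))) {x. v x \<in> U}"
    unfolding game_rep_def by auto
  show 1: "k = gk p" using k by (simp add: gk_def)
  show "d = gd p" using d by (auto simp: gd_def)
  show 3: "pr = gpr p"
  proof (intro ext)
    fix a b
    have "pr a b \<Longrightarrow> a < k \<and> b < k" using v by (auto simp: valid_game_def)
    then show "pr a b = gpr p a b" using pr[of a b] 1 by (auto simp: gpr_def)
  qed
  fix a x assume a: "a < k"
  have up: "b \<in> gup p a \<longleftrightarrow> b < k \<and> (b = a \<or> pr a b)" for b
    using a 1 3 by (auto simp: gup_def)
  have "upper_set k pr True (gup p a)"
    unfolding upper_set_def prefp_def using v up by (auto simp: valid_game_def)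
  from g[OF this] have "gamma_rep m (gname p a) {x. v x \<in> gup p a}" by (simp add: gname_def)
  then have "v x \<in> gup p a \<longleftrightarrow> gown m p a (first_idx m (\<lambda>k. gname p a (Suc k)) x)"
  proof -
    let ?r = "\<lambda>k. gname p a (Suc k)"
    assume "gamma_rep m (gname p a) {x. v x \<in> gup p a}"
    then consider "gname p a 0 = 0" "v x \<in> gup p a \<longleftrightarrow> x \<in> Dm_set m ?r"
      | "gname p a 0 = 1" "v x \<in> gup p a \<longleftrightarrow> x \<notin> Dm_set m ?r"
      unfolding gamma_rep_def set_eq_iff by (elim disjE conjE) auto
    moreover have "x \<in> Dm_set m ?r \<longleftrightarrow> even (first_idx m ?r x) \<noteq> even m"
      unfolding Dm_set_def mem_Collect_eq by (rule mod_2_neq_iff)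
    ultimately show ?thesis unfolding gown_def by cases simp_all
  qed
  moreover have "v x < k" using v by (simp add: valid_game_def)
  ultimately show "(v x = a \<or> pr a (v x)) = gown m p a (first_idx m (\<lambda>k. gname p a (Suc k)) x)"
    using up by auto
qed

lemma game_rep_valid: "game_rep m p G \<Longrightarrow> valid_game G"
  by (simp add: game_rep_def)

lemma valid_gameD:
  assumes "valid_game (k, d, pr, v)"
  shows "v x < k" "pr a b \<Longrightarrow> a < k" "pr a b \<Longrightarrow> b < k" "\<not> pr a a"
    "pr a b \<Longrightarrow> pr b c \<Longrightarrow> pr a c" "a < k \<Longrightarrow> b < k \<Longrightarrow> a \<noteq> b \<Longrightarrow> pr a b \<or> pr b a"
  using assms unfolding valid_game_def prod.case by blast+

text \<open>The equation serves both players: whoever wins at the root enforces the corresponding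
  side of the threshold.\<close>

lemma threshold_game:
  assumes "game_rep m p (k, d, pr, v)" "a < k" "gchoice m p a b" 
    "consistent (gd p) (gwinner m p a []) (gact m p a b) x"
  shows "(v x = a \<or> pr a (v x)) = gwinner m p a []"
proof -
  interpret weak_parity "gd p" "gcol m p a" "gown m p a" by (rule weak_parity_gcol)
  obtain n0 where "\<And>n. n \<ge> n0 \<Longrightarrow> gcol m p a (pre x n) = first_idx m (\<lambda>k. gname p a (Suc k)) x"
    using ncol_eventually unfolding gcol_def by blast
  from winner_wins[OF assms(3,4) refl this] game_repD(4)[OF assms(1,2)] show ?thesis by simp
qed

definition best :: "nat \<Rightarrow> (nat \<Rightarrow> nat \<Rightarrow> bool) \<Rightarrow> (nat \<Rightarrow> bool) \<Rightarrow> nat" where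
  "best k pr W = bleast k (\<lambda>a. W a \<and> (\<forall>b<k. W b \<longrightarrow> \<not> pr a b))"

text \<open>If \<open>a\<close> is the top outcome the value is the default \<open>k\<close>, and
  then player 2 has nothing to prevent.\<close>

definition next_above :: "nat \<Rightarrow> (nat \<Rightarrow> nat \<Rightarrow> bool) \<Rightarrow> nat \<Rightarrow> nat" where
  "next_above k pr a = bleast k (\<lambda>b. pr a b \<and> (\<forall>c<k. pr a c \<longrightarrow> \<not> pr c b))"

lemma bounded_maximal:
  fixes k :: nat
  assumes "a < k" "P a" and irr: "\<And>a. \<not> R a a" and trans: "\<And>a b c. R a b \<Longrightarrow> R b c \<Longrightarrow> R a c"
  shows "\<exists>a<k. P a \<and> (\<forall>b<k. P b \<longrightarrow> \<not> R a b)"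
proof -
  let ?A = "{a. a < k \<and> P a}"
  have "asymp_on ?A R" by (rule asymp_onI) (use irr trans in blast)
  moreover have "transp_on ?A R" by (rule transp_onI) (use trans in blast)
  moreover have "?A \<noteq> {}" using assms(1,2) by blast
  ultimately obtain m where "m \<in> ?A" "\<forall>x\<in>?A. x \<noteq> m \<longrightarrow> \<not> R m x"
    using Finite_Set.bex_max_element[of ?A R] by auto
  then show ?thesis using irr by (intro exI[of _ m]) auto
qed

lemma profile_is_NE:
  assumes rep: "game_rep m p (k, d, pr, v)"
    and choice: "\<And>a. gchoice m p a (b a)"
  defines "W \<equiv> \<lambda>a. gwinner m p a []"
  defines "s \<equiv> \<lambda>u. let a = best k pr W in let c = if gd p u then a else next_above k pr a in
     gact m p c (b c) u"
  shows "is_NE (k, d, pr, v) s"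
proof -
  note val = valid_gameD[OF game_rep_valid[OF rep]]
  note vk = val(1) and irr = val(4) and trans = val(5) and tot = val(6)
  note gd = game_repD(2)[OF rep]
  have thr: "(v x = a \<or> pr a (v x)) = W a" if "a < k" "consistent (gd p) (W a) (gact m p a (b a)) x" for a x
    using threshold_game[OF rep that(1) choice] that(2) by (simp add: W_def)
  define a where "a = best k pr W"
  define c where "c = next_above k pr a"
  have s: "s u = (if gd p u then gact m p a (b a) u else gact m p c (b c) u)" for u
    unfolding s_def a_def c_def by (simp add: Let_def)
  have "\<exists>a<k. True \<and> (\<forall>b<k. True \<longrightarrow> \<not> pr b a)"
    using vk irr trans by (rule bounded_maximal[of _ _ _ "\<lambda>x y. pr y x", OF _ TrueI])
  then obtain a0 where a0: "a0 < k" "\<And>b. b < k \<Longrightarrow> \<not> pr b a0" by auto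
  \<comment> \<open>Every play reaches the least outcome, so player 2 cannot win this threshold
    game. Hence some outcome can be enforced and \<open>best\<close> is not a default.\<close>
  have "W a0"
  proof (rule ccontr)
    assume "\<not> W a0"
    have "consistent (gd p) (W a0) (gact m p a0 (b a0)) (play (gact m p a0 (b a0)))"
      unfolding consistent_def using play_step by blast
    from thr[OF a0(1) this] \<open>\<not> W a0\<close> show False using a0 vk tot by metis
  qed
  with a0(1) have "\<exists>a<k. W a \<and> (\<forall>b<k. W b \<longrightarrow> \<not> pr a b)"
    using irr trans by (rule bounded_maximal)
  then have "a < k" unfolding a_def best_def bleast_less_iff .
  from this bleast_spec(3) have a: "W a" "\<And>b. b < k \<Longrightarrow> W b \<Longrightarrow> \<not> pr a b"
    unfolding a_def best_def by blast+
  have low: "v x = a \<or> pr a (v x)" if "consistent d True s x" for x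
  proof -
    have "consistent (gd p) (W a) (gact m p a (b a)) x"
      using that a(1) unfolding consistent_def gd s by simp
    from thr[OF \<open>a < k\<close> this] a(1) show ?thesis by simp
  qed
  have up: "\<not> pr a (v x)" if x: "consistent d False s x" for x
  proof
    assume "pr a (v x)"
    have "\<exists>b<k. pr a b \<and> (\<forall>c<k. pr a c \<longrightarrow> \<not> pr c b)"
      using vk \<open>pr a (v x)\<close> irr trans by (rule bounded_maximal[of _ _ _ "\<lambda>x y. pr y x"])
    then have "c < k" unfolding c_def next_above_def bleast_less_iff .
    from this bleast_spec(3) have c: "pr a c" "\<And>b. b < k \<Longrightarrow> pr a b \<Longrightarrow> \<not> pr b c"
      unfolding c_def next_above_def by blast+
    have "\<not> W c" using a(2)[OF \<open>c < k\<close>] c(1) by blast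
    then have "consistent (gd p) (W c) (gact m p c (b c)) x"
      using x unfolding consistent_def gd s by simp
    from thr[OF \<open>c < k\<close> this] \<open>\<not> W c\<close> have "pr (v x) c" using tot[OF vk \<open>c < k\<close>] by blast
    with c(2)[OF vk \<open>pr a (v x)\<close>] show False by blast
  qed
  have play: "consistent d i s (play s)" for i
    unfolding consistent_def using play_step by blast
  have va: "v (play s) = a" using low[OF play] up[OF play] by blast
  show ?thesis
    unfolding is_NE_iff
  proof (intro allI impI)
    fix i x assume x: "consistent d (\<not> i) s x"
    show "\<not> prefp pr i (v (play s)) (v x)"
    proof (cases i)
      case True
      with x up show ?thesis by (simp add: prefp_def va)
    next
      case False
      with x low[of x] irr trans show ?thesis unfolding prefp_def va by auto
    qed
  qed
qed

lemma NE_exists: assumes "game_rep m p G" shows "\<exists>s. is_NE G s"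
proof -
  obtain k d pr v where G: "G = (k, d, pr, v)" by (cases G)
  have "\<exists>b. gchoice m p a b" for a
    by (rule weak_parity.choice_exists) (rule weak_parity_gcol)
  then obtain b where "\<And>a. gchoice m p a (b a)" by metis
  from profile_is_NE[OF assms[unfolded G] this] show ?thesis unfolding G by blast
qed

subsection \<open>The reduction\<close>

lemma bleast_cong: "(\<And>i. i < b \<Longrightarrow> P i = Q i) \<Longrightarrow> bleast b P = bleast b Q"
  using bleast_spec(1)[of b Q] bleast_spec(2)[of _ b Q] bleast_spec(3)[of b Q]
  by (intro bleast_eqI) (auto intro: less_le_trans)

lemma weihrauch_leI:
  assumes "cpt H" "cpt K"
    and "\<And>p x. dX p x \<Longrightarrow> f x \<noteq> {} \<Longrightarrow> \<exists>z. dZ (H p) z \<and> g z \<noteq> {}"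
    and "\<And>p x G. realizer (g, dZ, dU) G \<Longrightarrow> dX p x \<Longrightarrow> f x \<noteq> {} \<Longrightarrow>
      \<exists>y. dY (K (bpair p (G (H p)))) y \<and> y \<in> f x"
  shows "(f, dX, dY) \<le>\<^sub>W (g, dZ, dU)"
proof -
  obtain tH where tH: "\<And>p. computes tH p (H p)"
    using assms(1) unfolding cpt_def computes_def by blast
  obtain tK where tK: "\<And>p. computes tK p (K p)"
    using assms(2) unfolding cpt_def computes_def by blast
  show ?thesis
    unfolding weihrauch_le_def prod.case
    by (rule exI[of _ tH], rule exI[of _ tK]) (use tH tK assms(3,4) in blast)
qed

lemma choice_lpo_eq:
  "prod_prob (jump_prob n C_cantor) (star_prob (jump_prob n LPO)) =
    (\<lambda>(A, qs). A \<times> {ys. length ys = length qs \<and>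
        (\<forall>i<length qs. ys ! i = (if qs ! i = (\<lambda>_. 0) then 1 else 0))},
     prod_rep ((jump_rep ^^ n) closed_rep) (tuple_rep ((jump_rep ^^ n) baire_rep)),
     prod_rep cantor_rep (tuple_rep nat_rep))"
  by (simp add: prod_prob_def jump_prob_def C_cantor_def star_prob_def LPO_def)

text \<open>Carries an outcome inside the name, so that a single functional produces the LPO
  instances for all outcomes.\<close>

definition bcons :: "nat \<Rightarrow> baire \<Rightarrow> baire" where "bcons a p i = (if i = 0 then a else p (i - 1))"

definition btl :: "baire \<Rightarrow> baire" where "btl p i = p (Suc i)"

lemma bcons_simps [simp]: "bcons a p 0 = a" "btl (bcons a p) = p"
  by (auto simp: bcons_def btl_def)

lemma cpt_btl [cpt_intros]: "cpt T \<Longrightarrow> cpt X \<Longrightarrow> cpt (\<lambda>s x. btl (T s) (X s x))"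
  unfolding btl_def by (rule cpt_compose[of T], assumption, intro cpt_intros)

lemma dec_neq_Nil [cpt_intros]: "cptw U \<Longrightarrow> dec (\<lambda>p x. U p x \<noteq> [])"
  using dec_pos[OF cpt_length] by simp

text \<open>The instance of LPO for outcome \<open>a\<close> asks whether the root lies in the top-level attractor.\<close>

definition lpo_query :: "nat \<Rightarrow> baire \<Rightarrow> baire \<Rightarrow> nat \<Rightarrow> baire" where
  "lpo_query m p z a N = of_bool (gatt m p z a m N [])"

text \<open>The instance of closed choice asks for all choice functions at once: position \<open>i\<close> of the desired
  point is the choice of the game \<open>pf i\<close> at the word coded by \<open>ps i\<close>. A word whose last letter is
  found to be wrong is excluded.\<close>

definition wrong :: "nat \<Rightarrow> baire \<Rightarrow> baire \<Rightarrow> nat \<Rightarrow> nat \<Rightarrow> bool \<Rightarrow> bool" where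
  "wrong m p z N i b \<longleftrightarrow> (let c = gcol m p (pf i) (word (ps i)) in 0 < c \<and>
     gatt m p z (pf i) c N (word (ps i) @ [\<not> b]) \<and>
     \<not> gatt m p z (pf i) c N (word (ps i) @ [b]))"

definition closed_query :: "nat \<Rightarrow> baire \<Rightarrow> baire \<Rightarrow> baire" where
  "closed_query m p z x = (let w = word (pf x); l = length w - 1 in
     if w \<noteq> [] \<and> wrong m p z (ps x) l (bit_at w l) then Suc (pf x) else 0)"

lemma dec_wrong [cpt_intros]:
  assumes "cpt T" "cpt R" "cpt N" "cpt I" "dec B"
  shows "dec (\<lambda>s x. wrong m (T s) (R s) (N s x) (I s x) (B s x))"
  unfolding wrong_def Let_def by (intro cpt_intros assms)

lemma lcpt_lpo_query: "lcpt n (\<lambda>p. lpo_query (Suc n) (btl p) (gwin (Suc n) n (btl p)) (p 0))"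
proof -
  define \<Phi> :: "baire \<Rightarrow> nat \<Rightarrow> nat" where
    "\<Phi> s = lpo_query (Suc n) (btl (bfst s)) (bsnd s) (bfst s 0)" for s
  have "cpt \<Phi>" unfolding \<Phi>_def lpo_query_def by (intro cpt_intros)
  moreover have "cpt btl" using cpt_btl[OF cpt_orcl[OF cpt_id] cpt_id] .
  ultimately have "lcpt n (\<lambda>p. \<Phi> (bpair p (gwin (Suc n) n (btl p))))"
    by (intro lcpt_cpt lcpt_compose[of n "gwin (Suc n) n" btl] lcpt_gwin)
  then show ?thesis by (simp add: \<Phi>_def)
qed

lemma lcpt_closed_query: "lcpt n (\<lambda>p. closed_query (Suc n) p (gwin (Suc n) n p))"
proof -
  define \<Phi> :: "baire \<Rightarrow> nat \<Rightarrow> nat" where "\<Phi> s = closed_query (Suc n) (bfst s) (bsnd s)" for s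
  have "cpt \<Phi>" unfolding \<Phi>_def closed_query_def Let_def by (intro cpt_intros)
  from lcpt_cpt[OF lcpt_gwin this] show ?thesis by (simp add: \<Phi>_def)
qed

lemma open_of_closed_query:
  "x \<in> open_of (closed_query m p z) \<longleftrightarrow> (\<exists>N i. wrong m p z N i (x i))"
proof
  assume "x \<in> open_of (closed_query m p z)"
  then obtain y where y: "0 < closed_query m p z y"
    "pre x (length (word (closed_query m p z y - 1))) = word (closed_query m p z y - 1)"
    unfolding open_of_iff by blast
  define w where "w = word (pf y)"
  from y(1) have w: "w \<noteq> []" "wrong m p z (ps y) (length w - 1) (bit_at w (length w - 1))"
    and "closed_query m p z y = Suc (pf y)"
    by (auto simp: closed_query_def w_def Let_def split: if_splits)
  with y(2) have "pre x (length w) = w" by (simp add: w_def)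
  then have "bit_at w (length w - 1) = x (length w - 1)"
    using w(1) nth_pre[of "length w - 1" "length w" x] by (simp add: bit_at_def)
  with w(2) have "wrong m p z (ps y) (length w - 1) (x (length w - 1))" by (simp only:)
  then show "\<exists>N i. wrong m p z N i (x i)" by blast
next
  assume "\<exists>N i. wrong m p z N i (x i)"
  then obtain N i where w: "wrong m p z N i (x i)" by blast
  have "bit_at (pre x (Suc i)) i = x i" by (simp add: bit_at_def)
  moreover have "pre x (Suc i) \<noteq> []" by (metis length_pre list.size(3) nat.distinct(1))
  ultimately have "closed_query m p z (prod_encode (enc (pre x (Suc i)), N)) = Suc (enc (pre x (Suc i)))"
    using w by (simp add: closed_query_def Let_def)
  then show "x \<in> open_of (closed_query m p z)"
    unfolding open_of_iff by (intro exI[of _ "prod_encode (enc (pre x (Suc i)), N)"]) simp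
qed

lemma not_wrong_iff_choice:
  "(\<forall>N i. \<not> wrong (Suc n) p (gwin (Suc n) n p) N i (x i)) \<longleftrightarrow>
    (\<forall>a. \<forall>i. \<forall>N. let c = gcol (Suc n) p a (word i); b = x (prod_encode (a, i)) in 0 < c \<longrightarrow>
      att (gd p) (gcol (Suc n) p a) (\<not> gown (Suc n) p a c) c (gwinner (Suc n) p a) N (word i @ [\<not> b]) \<longrightarrow>
      att (gd p) (gcol (Suc n) p a) (\<not> gown (Suc n) p a c) c (gwinner (Suc n) p a) N (word i @ [b]))"
  (is "?L \<longleftrightarrow> ?R")
proof -
  have *: "wrong (Suc n) p (gwin (Suc n) n p) N (prod_encode (a, i)) b \<longleftrightarrow>
    \<not> (let c = gcol (Suc n) p a (word i) in 0 < c \<longrightarrow>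
      att (gd p) (gcol (Suc n) p a) (\<not> gown (Suc n) p a c) c (gwinner (Suc n) p a) N (word i @ [\<not> b]) \<longrightarrow>
      att (gd p) (gcol (Suc n) p a) (\<not> gown (Suc n) p a c) c (gwinner (Suc n) p a) N (word i @ [b]))" for N a i b
    unfolding wrong_def Let_def by (simp add: gatt_gwin gcol_le)
  have "?L \<longleftrightarrow> (\<forall>N a i. \<not> wrong (Suc n) p (gwin (Suc n) n p) N (prod_encode (a, i)) (x (prod_encode (a, i))))"
    by (metis prod.collapse prod_decode_inverse)
  also have "\<dots> \<longleftrightarrow> ?R" unfolding * Let_def by blast
  finally show ?thesis .
qed

lemma closed_query_choice:
  assumes "x \<notin> open_of (closed_query (Suc n) p (gwin (Suc n) n p))"
  shows "gchoice (Suc n) p a (\<lambda>u. x (prod_encode (a, enc u)))"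
proof -
  interpret weak_parity "gd p" "gcol (Suc n) p a" "gown (Suc n) p a" by (rule weak_parity_gcol)
  from assms have "\<forall>N i. \<not> wrong (Suc n) p (gwin (Suc n) n p) N i (x i)"
    unfolding open_of_closed_query by blast
  then have "let c = gcol (Suc n) p a (word i); b = x (prod_encode (a, i)) in 0 < c \<longrightarrow>
      atc c N (word i @ [\<not> b]) \<longrightarrow> atc c N (word i @ [b])" for i N
    unfolding not_wrong_iff_choice by blast
  from this[of "enc _"] show ?thesis unfolding choice_def by (simp add: Let_def)
qed

lemma closed_query_nonempty: "\<exists>x. x \<notin> open_of (closed_query (Suc n) p (gwin (Suc n) n p))"
proof -
  have "\<exists>b. gchoice (Suc n) p a b" for a
    by (rule weak_parity.choice_exists) (rule weak_parity_gcol)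
  then obtain b where b: "\<And>a. gchoice (Suc n) p a (b a)" by metis
  define x where "x i = b (pf i) (word (ps i))" for i
  have "let c = gcol (Suc n) p a (word i); b = x (prod_encode (a, i)) in 0 < c \<longrightarrow>
      att (gd p) (gcol (Suc n) p a) (\<not> gown (Suc n) p a c) c (gwinner (Suc n) p a) N (word i @ [\<not> b]) \<longrightarrow>
      att (gd p) (gcol (Suc n) p a) (\<not> gown (Suc n) p a c) c (gwinner (Suc n) p a) N (word i @ [b])" for a i N
  proof -
    interpret weak_parity "gd p" "gcol (Suc n) p a" "gown (Suc n) p a" by (rule weak_parity_gcol)
    show ?thesis using b[of a] unfolding choice_def by (simp add: Let_def x_def)
  qed
  then have "\<forall>N i. \<not> wrong (Suc n) p (gwin (Suc n) n p) N i (x i)"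
    unfolding not_wrong_iff_choice by blast
  then show ?thesis unfolding open_of_closed_query by blast
qed

text \<open>The strategy assembled from \<open>s = bpair p g\<close>, where \<open>g\<close> names the point of the closed set and the
  answers of LPO.\<close>

definition swin :: "nat \<Rightarrow> baire \<Rightarrow> nat \<Rightarrow> bool" where
  "swin m s a \<longleftrightarrow> (bsnd (bsnd s) (Suc (prod_encode (a, 0))) = 1) = gown m (bfst s) a m"

definition sbest :: "nat \<Rightarrow> baire \<Rightarrow> nat" where
  "sbest m s = best (gk (bfst s)) (gpr (bfst s)) (swin m s)"

definition ssel :: "nat \<Rightarrow> baire \<Rightarrow> bool list \<Rightarrow> nat" where
  "ssel m s u = (if gd (bfst s) u then sbest m s else next_above (gk (bfst s)) (gpr (bfst s)) (sbest m s))"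

definition sout :: "nat \<Rightarrow> baire \<Rightarrow> bool list \<Rightarrow> bool" where
  "sout m s u = (let a = ssel m s u; b = (bfst (bsnd s) (prod_encode (a, enc u)) \<noteq> 0) in
     if gd (bfst s) u = (\<not> gown m (bfst s) a (gcol m (bfst s) a u)) then b else \<not> b)"

lemma dec_swin: "cpt A \<Longrightarrow> dec (\<lambda>s x. swin m s (A s x))"
  unfolding swin_def by (intro cpt_intros)

lemma cpt_sbest: "cpt (\<lambda>s x. sbest m s)"
  unfolding sbest_def best_def by (intro cpt_intros dec_swin)

lemma cpt_ssel: "cptw U \<Longrightarrow> cpt (\<lambda>s x. ssel m s (U s x))"
  unfolding ssel_def next_above_def by (intro cpt_intros cpt_sbest)

lemma cpt_sout: "cpt (\<lambda>s x. of_bool (sout m s (word x)))"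
  unfolding sout_def Let_def by (intro cpt_intros cpt_ssel)

lemma NE_ap_le: "NE_ap (Suc n) \<le>\<^sub>W prod_prob (jump_prob n C_cantor) (star_prob (jump_prob n LPO))"
proof -
  obtain HC where HC: "cpt HC"
    "\<And>p. limn n (HC p) (closed_query (Suc n) p (gwin (Suc n) n p))"
    using lcpt_closed_query unfolding lcpt_def by blast
  obtain HL where HL: "cpt HL"
    "\<And>p. limn n (HL p) (lpo_query (Suc n) (btl p) (gwin (Suc n) n (btl p)) (p 0))"
    using lcpt_lpo_query unfolding lcpt_def by blast
  define HT where "HT p y = (if y = 0 then gk p else HL (bcons (pf (y - 1)) p) (ps (y - 1)))" for p y
  define H where "H p = bpair (HC p) (HT p)" for p
  have "cpt (\<lambda>p y. HL (bcons (pf (y - 1)) p) (ps (y - 1)))"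
    unfolding bcons_def by (rule cpt_subst[OF HL(1)]) (intro cpt_intros)+
  then have HT: "cpt HT" unfolding HT_def by (intro cpt_intros)
  have cH: "cpt H"
    unfolding H_def by (intro cpt_intros cpt_compose[OF HC(1)] cpt_compose[OF HT])
  define C where "C p = - open_of (closed_query (Suc n) p (gwin (Suc n) n p))" for p
  define qs where "qs p = map (lpo_query (Suc n) p (gwin (Suc n) n p)) [0..<gk p]" for p
  have name: "prod_rep ((jump_rep ^^ n) closed_rep) (tuple_rep ((jump_rep ^^ n) baire_rep)) (H p) (C p, qs p)" for p
  proof -
    have "(jump_rep ^^ n) closed_rep (HC p) (C p)"
      unfolding jump_rep_funpow closed_rep_def C_def using HC(2) by blast
    moreover have "(jump_rep ^^ n) baire_rep (\<lambda>k. HT p (Suc (prod_encode (i, k)))) (qs p ! i)"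
      if "i < gk p" for i
      unfolding jump_rep_funpow baire_rep_def using HL(2)[of "bcons i p"] that
      by (simp add: HT_def qs_def)
    ultimately show ?thesis
      by (auto simp: prod_rep_def tuple_rep_def H_def qs_def HT_def)
  qed
  show ?thesis
    unfolding choice_lpo_eq NE_ap_def
  proof (rule weihrauch_leI[OF cH cpt_sout[of "Suc n"]])
    fix p and G :: game
    let ?g = "\<lambda>(A, qs). A \<times> {ys. length ys = length qs \<and>
        (\<forall>i<length qs. ys ! i = (if qs ! i = (\<lambda>_. 0) then 1 else 0 :: nat))}"
    have "map (\<lambda>q. if q = (\<lambda>_. 0) then 1 else 0) (qs p) \<in> {ys. length ys = length (qs p) \<and>
        (\<forall>i<length (qs p). ys ! i = (if qs p ! i = (\<lambda>_. 0) then 1 else 0 :: nat))}"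
      by auto
    moreover have "C p \<noteq> {}" using closed_query_nonempty unfolding C_def by blast
    ultimately have ne: "?g (C p, qs p) \<noteq> {}" by blast
    with name show "\<exists>z. prod_rep ((jump_rep ^^ n) closed_rep) (tuple_rep ((jump_rep ^^ n) baire_rep)) (H p) z \<and>
      ?g z \<noteq> {}" by blast
    fix F assume F: "realizer (?g, prod_rep ((jump_rep ^^ n) closed_rep) (tuple_rep ((jump_rep ^^ n) baire_rep)),
      prod_rep cantor_rep (tuple_rep nat_rep)) F" and G: "game_rep (Suc n) p G"
    obtain k d pr v where Geq: "G = (k, d, pr, v)" by (cases G)
    note rep = G[unfolded Geq]
    define g where "g = F (H p)"
    from F name ne have "\<exists>y. prod_rep cantor_rep (tuple_rep nat_rep) g y \<and> y \<in> ?g (C p, qs p)"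
      unfolding realizer_def prod.case g_def by blast
    then obtain x ys where x: "cantor_rep (bfst g) x" "x \<in> C p"
      and ys: "tuple_rep nat_rep (bsnd g) ys" "length ys = length (qs p)"
        "\<And>i. i < length (qs p) \<Longrightarrow> ys ! i = (if qs p ! i = (\<lambda>_. 0) then 1 else 0)"
      by (auto simp: prod_rep_def)
    define s where "s = bpair p g"
    define W where "W a = gwinner (Suc n) p a []" for a
    have W: "swin (Suc n) s a = W a" if "a < k" for a
    proof -
      interpret weak_parity "gd p" "gcol (Suc n) p a" "gown (Suc n) p a" by (rule weak_parity_gcol)
      have a: "a < gk p" using that game_repD(1)[OF rep] by simp
      have "bsnd g (Suc (prod_encode (a, 0))) = ys ! a"
        using ys(1,2) a by (simp add: tuple_rep_def nat_rep_def qs_def)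
      also have "\<dots> = (if lpo_query (Suc n) p (gwin (Suc n) n p) a = (\<lambda>_. 0) then 1 else 0)"
        using ys(3)[of a] a by (simp add: qs_def)
      \<comment> \<open>LPO answers 1 on the zero sequence, that is, when the root is never
        attracted and the owner of the top colour wins.\<close>
      finally have "bsnd g (Suc (prod_encode (a, 0))) = 1 \<longleftrightarrow> (\<forall>N. \<not> atc (Suc n) N [])"
        by (simp add: lpo_query_def gatt_gwin fun_eq_iff)
      moreover have "W a = (gown (Suc n) p a (Suc n) \<noteq> (\<exists>N. atc (Suc n) N []))"
        unfolding W_def using win_pos[of "[]"] by (simp add: gcol_Nil)
      ultimately show ?thesis unfolding swin_def s_def by auto
    qed
    have best: "sbest (Suc n) s = best k pr W"
      unfolding sbest_def best_def s_def bpair_simps game_repD(1,3)[OF rep, symmetric]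
      by (rule bleast_cong) (use W in \<open>auto simp: s_def\<close>)
    have sel: "ssel (Suc n) s u = (if gd p u then best k pr W else next_above k pr (best k pr W))" for u
      unfolding ssel_def best by (simp add: s_def game_repD(1,3)[OF rep, symmetric])
    have "(\<lambda>u. let a = best k pr W in let c = if gd p u then a else next_above k pr a in
       gact (Suc n) p c (\<lambda>u. x (prod_encode (c, enc u))) u) = sout (Suc n) s"
    proof
      fix u
      define c where "c = ssel (Suc n) s u"
      interpret weak_parity "gd p" "gcol (Suc n) p c" "gown (Suc n) p c" by (rule weak_parity_gcol)
      have s: "bfst s = p" "bsnd s = g" by (simp_all add: s_def)
      have "sout (Suc n) s u = act (\<lambda>u. x (prod_encode (c, enc u))) u"
        using x(1) by (simp add: sout_def act_def opp_def Let_def c_def[symmetric] s cantor_rep_def)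
      then show "(let a = best k pr W in let c = if gd p u then a else next_above k pr a in
       gact (Suc n) p c (\<lambda>u. x (prod_encode (c, enc u))) u) = sout (Suc n) s u"
        unfolding Let_def sel[symmetric] c_def[symmetric] by simp
    qed
    moreover have "is_NE G (\<lambda>u. let a = best k pr W in let c = if gd p u then a else next_above k pr a in
       gact (Suc n) p c (\<lambda>u. x (prod_encode (c, enc u))) u)"
      unfolding Geq W_def
      by (rule profile_is_NE[OF rep]) (use closed_query_choice x(2) in \<open>auto simp: C_def\<close>)
    ultimately have "is_NE G (sout (Suc n) s)" by simp
    then show "\<exists>y. strat_rep (\<lambda>x. of_bool (sout (Suc n) (bpair p (F (H p))) (word x))) y \<and> y \<in> {s. is_NE G s}"
      unfolding strat_rep_def s_def g_def by blast
  qed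
qed

section \<open>A game that answers choice and LPO\<close>

text \<open>In round \<open>i < k\<close> player 1 claims or denies that the \<open>i\<close>-th instance of LPO is nonzero (\<open>Cl\<close>), and
  player 2 may challenge a claim (\<open>Ch\<close>). Afterwards player 2 builds a point bit by bit (\<open>Bd\<close>), and after
  each bit player 1 may interrupt (\<open>In\<close>) by claiming that the prefix built so far is covered by the open
  complement. A challenge or an interruption starts a verification (\<open>Ve\<close>) of a statement
  \<open>\<exists>e. hit (r e)\<close>, where \<open>r\<close> is the \<open>n\<close>-fold limit of the source \<open>s\<close>: the players alternately name
  numbers in unary, as witnesses for the quantifiers of the unfolded limits. The number \<open>c\<close> of claims
  is the value of a play in which player 2 survives.\<close>

datatype state = Cl nat nat | Ch nat nat bool | Bd nat "bool list" | In nat "bool list"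
  | Ve nat nat "bool list" nat nat nat nat

definition enter :: "nat \<Rightarrow> nat \<Rightarrow> nat \<Rightarrow> state" where
  "enter k i c = (if i < k then Cl i c else Bd c [])"

text \<open>A move codes two numbers: an offset above the bound \<open>y\<close> set by the
  opponent, which selects the stage of the current limit, and the bound for the next limit. The
  first move selects an index of the outermost sequence instead.\<close>

definition next_idx :: "nat \<Rightarrow> nat \<Rightarrow> nat \<Rightarrow> nat \<Rightarrow> nat" where
  "next_idx j x y e = (if j = 0 then e else prod_encode (x, y + e))"

fun step :: "nat \<Rightarrow> nat \<Rightarrow> state \<Rightarrow> bool \<Rightarrow> state" where
  "step k m (Cl i c) b = Ch i c b"
| "step k m (Ch i c b') b =
    (if b' \<and> b then Ve (Suc i) c [] 0 0 0 0 else enter k (Suc i) (c + of_bool b'))"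
| "step k m (Bd c w) b = In c (w @ [b])"
| "step k m (In c w) b = (if b then Ve 0 c w 0 0 0 0 else Bd c w)"
| "step k m (Ve s c w j g x y) b = (if m \<le> j then Ve s c w j g x y
     else if b then Ve s c w (Suc j) 0 (next_idx j x y (pf g)) (ps g) else Ve s c w j (Suc g) x y)"

definition run :: "nat \<Rightarrow> nat \<Rightarrow> bool list \<Rightarrow> state" where
  "run k m u = foldl (step k m) (enter k 0 0) u"

fun turn :: "state \<Rightarrow> bool" where
  "turn (Cl i c) = True"
| "turn (Ch i c b) = False"
| "turn (Bd c w) = False"
| "turn (In c w) = True"
| "turn (Ve s c w j g x y) = even j"

definition is_prefix :: "bool list \<Rightarrow> bool list \<Rightarrow> bool" where
  "is_prefix v w \<longleftrightarrow> length v \<le> length w \<and> (\<forall>j<length v. bit_at w j = bit_at v j)"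

text \<open>Source 0 enumerates the complement of the closed set, where a hit is a cylinder
  containing all extensions of \<open>w\<close>. The other sources are the instances of LPO.\<close>

definition hit :: "nat \<Rightarrow> bool list \<Rightarrow> nat \<Rightarrow> bool" where
  "hit s w z \<longleftrightarrow> 0 < z \<and> (0 < s \<or> is_prefix (word (z - 1)) w)"

text \<open>Player 1 reaches outcome at least \<open>t\<close> iff the final \<open>tcol\<close>-colour has parity other than \<open>m\<close>.\<close>

fun vcol :: "nat \<Rightarrow> (nat \<Rightarrow> baire) \<Rightarrow> nat \<Rightarrow> state \<Rightarrow> nat" where
  "vcol m src t (Cl i c) = m"
| "vcol m src t (Ch i c b) = m"
| "vcol m src t (Bd c w) = (if t \<le> Suc c then m - 1 else m)"
| "vcol m src t (In c w) = (if t \<le> Suc c then m - 1 else m)"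
| "vcol m src t (Ve s c w j g x y) =
    (if s = 0 \<and> t \<le> Suc c then m - 1
     else if j < m then m - j else if hit s w (src s x) = odd m then 0 else 1)"

text \<open>Threshold 0 is always reached and thresholds above \<open>k + 2\<close> never; they
  represent the full and the empty upper set of player 1.\<close>

definition tcol :: "nat \<Rightarrow> nat \<Rightarrow> (nat \<Rightarrow> baire) \<Rightarrow> nat \<Rightarrow> state \<Rightarrow> nat" where
  "tcol k m src t z = (if t = 0 then m - 1 else if k + 2 < t then m else vcol m src t z)"

definition attains :: "nat \<Rightarrow> nat \<Rightarrow> (nat \<Rightarrow> baire) \<Rightarrow> nat \<Rightarrow> cantor \<Rightarrow> bool" where
  "attains k m src t x \<longleftrightarrow>
    (\<exists>n0. \<forall>n\<ge>n0. even (tcol k m src t (run k m (pre x n))) \<noteq> even m)"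

text \<open>The number of thresholds reached. Outcome 0 is a refuted claim, \<open>Suc c\<close> is
  \<open>c\<close> claims with no successful interruption, and \<open>k + 2\<close> is a successful
  verification.\<close>

definition pay :: "nat \<Rightarrow> nat \<Rightarrow> (nat \<Rightarrow> baire) \<Rightarrow> cantor \<Rightarrow> nat" where
  "pay k m src x = bleast (k + 2) (\<lambda>t. \<not> attains k m src (Suc t) x)"

text \<open>Before the last verification move the colour \<open>m - j\<close> has come down to 1, so
  both 0 and 1 are available for the verdict. An interruption keeps \<open>m - 1\<close> for the
  thresholds secured by the claims, so failing it costs player 1 nothing.\<close>

lemma tcol_step:
  assumes "0 < m" shows "tcol k m src t (step k m z b) \<le> tcol k m src t z"
  using assms by (cases z) (auto simp: tcol_def enter_def)

lemma tcol_le: "0 < m \<Longrightarrow> tcol k m src t z \<le> m"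
  by (cases z) (auto simp: tcol_def)

lemma attains_iffI:
  assumes "\<And>n. n \<ge> n0 \<Longrightarrow> (even (tcol k m src t (run k m (pre x n))) \<noteq> even m) = B"
  shows "attains k m src t x = B"
proof
  assume "attains k m src t x"
  then obtain n1 where "\<And>n. n \<ge> n1 \<Longrightarrow> even (tcol k m src t (run k m (pre x n))) \<noteq> even m"
    unfolding attains_def by blast
  from this[of "max n0 n1"] assms[of "max n0 n1"] show B by simp
next
  assume B
  with assms show "attains k m src t x" unfolding attains_def by blast
qed

lemma attains_mono:
  assumes "0 < m" "attains k m src t x" "t' \<le> t" shows "attains k m src t' x"
proof -
  have "even (tcol k m src t' z) \<noteq> even m" if "even (tcol k m src t z) \<noteq> even m" for z
    using that assms(1,3) by (cases z) (auto simp: tcol_def split: if_splits)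
  with assms(2) show ?thesis unfolding attains_def by blast
qed

lemma pay_ge_iff:
  assumes "0 < m" shows "t \<le> pay k m src x \<longleftrightarrow> attains k m src t x"
proof
  assume t: "t \<le> pay k m src x"
  show "attains k m src t x"
  proof (cases t)
    case 0
    then show ?thesis using assms by (auto simp: attains_def tcol_def)
  next
    case (Suc t')
    with t show ?thesis using bleast_spec(2)[of t' "k + 2" "\<lambda>t. \<not> attains k m src (Suc t) x"] unfolding pay_def by auto
  qed
next
  assume a: "attains k m src t x"
  have "t \<le> k + 2"
  proof (rule ccontr)
    assume "\<not> t \<le> k + 2"
    then have "attains k m src t x = False" by (intro attains_iffI[of 0]) (simp add: tcol_def)
    with a show False by simp
  qed
  show "t \<le> pay k m src x"
  proof (rule ccontr)
    assume "\<not> t \<le> pay k m src x"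
    then have "pay k m src x < k + 2" "Suc (pay k m src x) \<le> t" using \<open>t \<le> k + 2\<close> by auto
    then show False
      using bleast_spec(3)[of "k + 2" "\<lambda>t. \<not> attains k m src (Suc t) x"]
        attains_mono[OF assms a] unfolding pay_def by blast
  qed
qed

lemma pay_le: "pay k m src x \<le> k + 2"
  unfolding pay_def by (rule bleast_spec)

lemma pay_eqI:
  assumes "0 < m" "N \<le> k + 2" "\<And>t. 0 < t \<Longrightarrow> t \<le> k + 2 \<Longrightarrow> attains k m src t x \<longleftrightarrow> t \<le> N"
  shows "pay k m src x = N"
proof (rule antisym)
  show "pay k m src x \<le> N"
    using assms(3)[of "pay k m src x"] pay_le[of k m src x] pay_ge_iff[OF assms(1), of "pay k m src x"]
    by (cases "pay k m src x = 0") auto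
  show "N \<le> pay k m src x"
    using assms(2) assms(3)[of N] pay_ge_iff[OF assms(1), of N] by (cases "N = 0") auto
qed

section \<open>Equilibria and deviations from a given position\<close>

definition claim_game :: "nat \<Rightarrow> nat \<Rightarrow> (nat \<Rightarrow> baire) \<Rightarrow> game" where
  "claim_game k m src = (k + 3, \<lambda>u. turn (run k m u), \<lambda>a b. a < b \<and> b < k + 3, pay k m src)"

lemma claim_game_NE:
  assumes "is_NE (claim_game k m src) \<sigma>"
  shows "consistent (\<lambda>u. turn (run k m u)) False \<sigma> x \<Longrightarrow> pay k m src x \<le> pay k m src (play \<sigma>)"
    and "consistent (\<lambda>u. turn (run k m u)) True \<sigma> x \<Longrightarrow> pay k m src (play \<sigma>) \<le> pay k m src x"
proof -
  have lt: "pay k m src x < k + 3" for x using pay_le[of k m src x] by simp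
  note * = assms[unfolded claim_game_def is_NE_iff, rule_format]
  show "consistent (\<lambda>u. turn (run k m u)) False \<sigma> x \<Longrightarrow> pay k m src x \<le> pay k m src (play \<sigma>)"
    using *[of True x] lt by (simp add: prefp_def)
  show "consistent (\<lambda>u. turn (run k m u)) True \<sigma> x \<Longrightarrow> pay k m src (play \<sigma>) \<le> pay k m src x"
    using *[of False x] lt by (simp add: prefp_def)
qed

lemma run_Nil [simp]: "run k m [] = enter k 0 0"
  by (simp add: run_def)

lemma run_snoc [simp]: "run k m (u @ [b]) = step k m (run k m u) b"
  by (simp add: run_def)

text \<open>Player \<open>i\<close> follows \<open>\<sigma>\<close> from \<open>u\<close> on and the
  opponent achieves \<open>\<Psi>\<close>. Ignoring what led to \<open>u\<close> allows reasoning
  backwards from a verification to the root.\<close>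

definition reach :: "(bool list \<Rightarrow> bool) \<Rightarrow> strategy \<Rightarrow> bool list \<Rightarrow> bool \<Rightarrow> (cantor \<Rightarrow> bool) \<Rightarrow> bool" where
  "reach d \<sigma> u i \<Psi> \<longleftrightarrow> (\<exists>x. pre x (length u) = u \<and>
     (\<forall>n\<ge>length u. d (pre x n) = i \<longrightarrow> x n = \<sigma> (pre x n)) \<and> \<Psi> x)"

lemma reach_mono: "reach d \<sigma> u i \<Psi> \<Longrightarrow> (\<And>x. \<Psi> x \<Longrightarrow> \<Psi>' x) \<Longrightarrow> reach d \<sigma> u i \<Psi>'"
  unfolding reach_def by blast

lemma reach_back:
  assumes "reach d \<sigma> (u @ [b]) i \<Psi>" "d u = i \<Longrightarrow> b = \<sigma> u" shows "reach d \<sigma> u i \<Psi>"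
proof -
  obtain x where x: "pre x (Suc (length u)) = u @ [b]"
    "\<And>n. n \<ge> Suc (length u) \<Longrightarrow> d (pre x n) = i \<Longrightarrow> x n = \<sigma> (pre x n)" "\<Psi> x"
    using assms(1) unfolding reach_def by auto
  then have u: "pre x (length u) = u" "x (length u) = b" by (auto simp: pre_Suc)
  have "x n = \<sigma> (pre x n)" if "n \<ge> length u" "d (pre x n) = i" for n
    using that x(2)[of n] u assms(2) by (cases "n = length u") auto
  with u x(3) show ?thesis unfolding reach_def by blast
qed

lemma reach_along:
  assumes "reach d \<sigma> (pre x (n + l)) i \<Psi>"
    and "\<And>j. n \<le> j \<Longrightarrow> j < n + l \<Longrightarrow> d (pre x j) = i \<Longrightarrow> x j = \<sigma> (pre x j)"
  shows "reach d \<sigma> (pre x n) i \<Psi>"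
  using assms
proof (induction l)
  case (Suc l)
  have "reach d \<sigma> (pre x (n + l)) i \<Psi>"
    by (rule reach_back[of _ _ _ "x (n + l)"]) (use Suc.prems in \<open>auto simp: pre_Suc\<close>)
  then show ?case using Suc by simp
qed simp

lemma reach_Nil: "reach d \<sigma> [] i \<Psi> \<longleftrightarrow> (\<exists>x. consistent d i \<sigma> x \<and> \<Psi> x)"
  by (simp add: reach_def consistent_def)

lemma path_exists: "\<exists>x. pre x (length u) = u \<and> (\<forall>n\<ge>length u. x n = f (pre x n))"
proof -
  define x where "x = play (\<lambda>w. if length w < length u then u ! length w else f w)"
  have x: "x n = (if n < length u then u ! n else f (pre x n))" for n
    unfolding x_def by (subst play_step) simp
  then have "pre x (length u) = u" by (intro nth_equalityI) auto
  with x show ?thesis by auto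
qed

subsection \<open>Verification\<close>

text \<open>\<open>mw P \<iota> j\<close>: with \<open>j + 1\<close> moves left, the player to move can refute \<open>\<forall>e. P (\<iota> e)\<close> after taking
  limits.\<close>

primrec mw :: "(nat \<Rightarrow> bool) \<Rightarrow> (nat \<Rightarrow> nat) \<Rightarrow> nat \<Rightarrow> bool" where
  "mw P \<iota> 0 = (\<exists>z. \<not> P (\<iota> (pf z)))"
| "mw P \<iota> (Suc j) = (\<exists>z. \<not> mw (\<lambda>x. \<not> P x) (\<lambda>e. prod_encode (\<iota> (pf z), ps z + e)) j)" 

text \<open>As the limit exists, it fails \<open>Q\<close> iff the approximation fails
  \<open>Q\<close> at all stages from some i0 on. The choice of i0 merges with the choice of the
  witness, so each limit adds just one move.\<close>

lemma mw_limn: "limn j a r \<Longrightarrow> mw (\<lambda>x. Q (a x)) \<iota> j \<longleftrightarrow> (\<exists>e. \<not> Q (r (\<iota> e)))"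
proof (induction j arbitrary: Q \<iota> r)
  case 0
  have "(\<exists>z. \<not> Q (a (\<iota> (pf z)))) \<longleftrightarrow> (\<exists>e. \<not> Q (a (\<iota> e)))"
    by (metis prod_encode_inverse fst_conv)
  with 0 show ?case by simp
next
  case (Suc j)
  then obtain b where b: "limn j a b" "lim_rel b r" unfolding limn_Suc_right by blast
  have IH: "mw (\<lambda>x. \<not> Q (a x)) (\<lambda>e. prod_encode (\<iota> (pf z), ps z + e)) j \<longleftrightarrow>
      (\<exists>e. Q (b (prod_encode (\<iota> (pf z), ps z + e))))" for z
    using Suc.IH[OF b(1), of "\<lambda>v. \<not> Q v"] by simp
  have "mw (\<lambda>x. Q (a x)) \<iota> (Suc j) \<longleftrightarrow> (\<exists>e i0. \<forall>i. \<not> Q (b (prod_encode (\<iota> e, i0 + i))))"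
    unfolding mw.simps IH by (metis prod_encode_inverse fst_conv snd_conv)
  also have "\<dots> \<longleftrightarrow> (\<exists>e. \<not> Q (r (\<iota> e)))"
  proof
    assume "\<exists>e i0. \<forall>i. \<not> Q (b (prod_encode (\<iota> e, i0 + i)))"
    then obtain e i0 where e: "\<And>i. \<not> Q (b (prod_encode (\<iota> e, i0 + i)))" by blast
    obtain i1 where "\<forall>i\<ge>i1. b (prod_encode (\<iota> e, i)) = r (\<iota> e)"
      using b(2) unfolding lim_rel_def by blast
    then have "b (prod_encode (\<iota> e, i0 + i1)) = r (\<iota> e)" by simp
    with e[of i1] show "\<exists>e. \<not> Q (r (\<iota> e))" by metis
  next
    assume "\<exists>e. \<not> Q (r (\<iota> e))"
    then obtain e where e: "\<not> Q (r (\<iota> e))" by blast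
    obtain i0 where "\<forall>i\<ge>i0. b (prod_encode (\<iota> e, i)) = r (\<iota> e)"
      using b(2) unfolding lim_rel_def by blast
    then have "b (prod_encode (\<iota> e, i0 + i)) = r (\<iota> e)" for i by simp
    with e have "\<forall>i. \<not> Q (b (prod_encode (\<iota> e, i0 + i)))" by metis
    then show "\<exists>e i0. \<forall>i. \<not> Q (b (prod_encode (\<iota> e, i0 + i)))" by blast
  qed
  finally show ?case .
qed

locale claim_play =
  fixes k n m :: nat and src r :: "nat \<Rightarrow> baire" and \<sigma> :: strategy
  assumes m_eq: "m = Suc n" and limn_src: "\<And>s. s \<le> k \<Longrightarrow> limn n (src s) (r s)"
begin

lemma m_pos: "0 < m" by (simp add: m_eq)

abbreviation st :: "bool list \<Rightarrow> state" where "st \<equiv> run k m"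
abbreviation trn :: "bool list \<Rightarrow> bool" where "trn u \<equiv> turn (st u)"
abbreviation rch :: "bool list \<Rightarrow> bool \<Rightarrow> (cantor \<Rightarrow> bool) \<Rightarrow> bool" where "rch \<equiv> reach trn \<sigma>"

text \<open>Below \<open>m\<close> moves the player to move is stalling; at odd \<open>j\<close>
  this is player 2, and player 1 wins.\<close>

definition vwin :: "nat \<Rightarrow> bool list \<Rightarrow> nat \<Rightarrow> nat \<Rightarrow> bool" where
  "vwin s w j x = (if j < m then odd j else hit s w (src s x))"

definition Vend :: "nat \<Rightarrow> nat \<Rightarrow> bool list \<Rightarrow> bool \<Rightarrow> cantor \<Rightarrow> bool" where
  "Vend s c w B x \<longleftrightarrow> (\<exists>n0. \<forall>n\<ge>n0. \<exists>j g a y. st (pre x n) = Ve s c w j g a y \<and> vwin s w j a = B)"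

lemma st_zeros: "st u = Ve s c w j g x y \<Longrightarrow> j < m \<Longrightarrow>
    st (u @ replicate z False) = Ve s c w j (g + z) x y"
proof (induction z)
  case (Suc z)
  have "u @ replicate (Suc z) False = (u @ replicate z False) @ [False]"
    by (simp add: replicate_append_same)
  with Suc show ?case by (simp only: run_snoc) simp
qed simp

lemma rch_zeros:
  assumes "rch (u @ replicate z False) i \<Psi>"
    and "\<And>z'. z' < z \<Longrightarrow> trn (u @ replicate z' False) = i \<Longrightarrow> \<not> \<sigma> (u @ replicate z' False)"
  shows "rch u i \<Psi>"
  using assms
proof (induction z)
  case (Suc z)
  have "u @ replicate (Suc z) False = (u @ replicate z False) @ [False]"
    by (simp add: replicate_append_same)
  with Suc.prems(1) have "rch ((u @ replicate z False) @ [False]) i \<Psi>" by (simp only:)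
  then have "rch (u @ replicate z False) i \<Psi>"
    by (rule reach_back) (use Suc.prems(2)[of z] in simp)
  then show ?case by (rule Suc.IH) (use Suc.prems(2) in simp)
qed simp

lemma rch_final:
  assumes "st u = Ve s c w m g x y" shows "rch u i (Vend s c w (hit s w (src s x)))"
proof -
  obtain z where z: "pre z (length u) = u" "\<forall>n\<ge>length u. z n = \<sigma> (pre z n)"
    using path_exists[of u \<sigma>] by blast
  have "st (pre z (length u + l)) = Ve s c w m g x y" for l
    by (induction l) (use z(1) assms in \<open>auto simp: pre_Suc\<close>)
  then have "Vend s c w (hit s w (src s x)) z"
    unfolding Vend_def by (intro exI[of _ "length u"]) (auto simp: vwin_def le_iff_add)
  with z show ?thesis unfolding reach_def by blast
qed

text \<open>\<open>F\<close> collects the moves after which \<open>p\<close> succeeds. If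
  \<open>p\<close> moves, one of them suffices. Otherwise \<open>\<sigma>\<close> either moves at
  some first time, where \<open>F\<close> holds of any number, or stalls for ever and loses to
  \<open>p\<close>.\<close>

lemma rch_move:
  assumes u: "st u = Ve s c v j 0 x y" "j < m"
    and F: "\<And>z. F z \<Longrightarrow> rch ((u @ replicate z False) @ [True]) (\<not> p) (Vend s c v p)"
    and mover: "p = even j \<Longrightarrow> \<exists>z. F z" and other: "p \<noteq> even j \<Longrightarrow> \<forall>z. F z"
  shows "rch u (\<not> p) (Vend s c v p)"
proof (cases "p = even j")
  case True
  then obtain z where z: "F z" using mover by blast
  have "rch (u @ replicate z False) (\<not> p) (Vend s c v p)"
    using True by (intro reach_back[OF F[OF z]]) (simp add: st_zeros[OF u])
  then show ?thesis by (rule rch_zeros) (simp add: st_zeros[OF u] True)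
next
  case False
  show ?thesis
  proof (cases "\<exists>z. \<sigma> (u @ replicate z False)")
    case True
    define z where "z = (LEAST z. \<sigma> (u @ replicate z False))"
    have z: "\<sigma> (u @ replicate z False)" using True unfolding z_def by (rule LeastI_ex)
    have "rch (u @ replicate z False) (\<not> p) (Vend s c v p)"
      using False other z by (intro reach_back[OF F]) auto
    then show ?thesis by (rule rch_zeros) (use not_less_Least in \<open>auto simp: z_def\<close>)
  next
    case False': False
    obtain a where a: "pre a (length u) = u" "\<forall>n\<ge>length u. a n = False"
      using path_exists[of u "\<lambda>_. False"] by blast
    have pre: "pre a (length u + l) = u @ replicate l False" for l
    proof (induction l)
      case (Suc l)
      then have "pre a (Suc (length u + l)) = (u @ replicate l False) @ [False]"
        using a(2) by (simp add: pre_Suc)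
      then show ?case by (simp add: replicate_append_same)
    qed (use a in simp)
    have "Vend s c v p a"
      unfolding Vend_def
    proof (rule exI[of _ "length u"], intro allI impI)
      fix n assume "length u \<le> n"
      then obtain l where l: "n = length u + l" by (auto simp: le_iff_add)
      have "st (pre a n) = Ve s c v j (0 + l) x y" unfolding l pre by (rule st_zeros[OF u])
      moreover have "vwin s v j x = p" using False u(2) by (simp add: vwin_def)
      ultimately show "\<exists>j g a' y. st (pre a n) = Ve s c v j g a' y \<and> vwin s v j a' = p" by blast
    qed
    moreover have "a n = \<sigma> (pre a n)" if "length u \<le> n" for n
    proof -
      have "pre a n = u @ replicate (n - length u) False" using pre[of "n - length u"] that by simp
      with a(2) that False' show ?thesis by auto
    qed
    ultimately show ?thesis using a(1) unfolding reach_def by blast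
  qed
qed

text \<open>Player \<open>p\<close> deviates from \<open>\<sigma>\<close>, and the other one follows it.\<close>

lemma rch_verify:
  assumes "st u = Ve s c v j 0 x y" "j + l = m - 1"
    and "(p = even j) = mw (\<lambda>a. hit s v (src s a) \<noteq> even j) (next_idx j x y) l"
  shows "rch u (\<not> p) (Vend s c v p)"
  using assms
proof (induction l arbitrary: u j x y)
  case 0
  then have j: "j < m" "Suc j = m" using m_pos by auto
  show ?case
  proof (rule rch_move[OF 0(1) j(1), where F = "\<lambda>z. hit s v (src s (next_idx j x y (pf z))) = p"])
    fix z assume z: "hit s v (src s (next_idx j x y (pf z))) = p"
    have "st ((u @ replicate z False) @ [True]) = Ve s c v m 0 (next_idx j x y (pf z)) (ps z)"
      using st_zeros[OF 0(1) j(1), of z] j by (simp only: run_snoc) simp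
    from rch_final[OF this] show "rch ((u @ replicate z False) @ [True]) (\<not> p) (Vend s c v p)"
      unfolding z .
  qed (use 0(3) in auto)
next
  case (Suc l)
  then have j: "j < m" "Suc j < m" using m_pos by auto
  let ?A = "\<lambda>a. hit s v (src s a)"
  let ?N = "\<lambda>z. mw (\<lambda>a. ?A a \<noteq> even (Suc j)) (next_idx (Suc j) (next_idx j x y (pf z)) (ps z)) l"
  have N: "mw (\<lambda>a. ?A a \<noteq> even j) (next_idx j x y) (Suc l) = (\<exists>z. \<not> ?N z)"
    by (simp add: next_idx_def[of "Suc j", abs_def])
  show ?case
  proof (rule rch_move[OF Suc.prems(1) j(1), where F = "\<lambda>z. (p = even (Suc j)) = ?N z"])
    fix z assume z: "(p = even (Suc j)) = ?N z"
    have "st ((u @ replicate z False) @ [True]) = Ve s c v (Suc j) 0 (next_idx j x y (pf z)) (ps z)"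
      using st_zeros[OF Suc.prems(1) j(1), of z] j by (simp only: run_snoc) simp
    from Suc.IH[OF this _ z] show "rch ((u @ replicate z False) @ [True]) (\<not> p) (Vend s c v p)"
      using Suc.prems(2) by simp
  next
    show "\<exists>z. (p = even (Suc j)) = ?N z" if "p = even j" using Suc.prems(3) N that by auto
    show "\<forall>z. (p = even (Suc j)) = ?N z" if "p \<noteq> even j" using Suc.prems(3) N that by auto
  qed
qed

lemma rch_claim:
  assumes "st u = Ve s c v 0 0 0 0" "s \<le> k" "p \<longleftrightarrow> (\<exists>e. hit s v (r s e))"
  shows "rch u (\<not> p) (Vend s c v p)"
proof (rule rch_verify[OF assms(1), of n])
  have "mw (\<lambda>a. \<not> hit s v (src s a)) (next_idx 0 0 0) n \<longleftrightarrow> (\<exists>e. hit s v (r s e))"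
    using mw_limn[OF limn_src[OF assms(2)], of "\<lambda>z. \<not> hit s v z"] by (simp add: next_idx_def)
  then show "(p = even 0) = mw (\<lambda>a. hit s v (src s a) \<noteq> even 0) (next_idx 0 0 0) n"
    using assms(3) by simp
qed (simp add: m_eq)

subsection \<open>Payoffs\<close>

abbreviation py :: "cantor \<Rightarrow> nat" where "py \<equiv> pay k m src"

lemma pay_Vend:
  assumes "Vend s c v B x" "c \<le> k"
  shows "py x = (if B then k + 2 else if s = 0 then Suc c else 0)"
proof (rule pay_eqI[OF m_pos])
  fix t :: nat assume t: "0 < t" "t \<le> k + 2"
  obtain n0 where n0: "\<And>n. n \<ge> n0 \<Longrightarrow> \<exists>j g a y. st (pre x n) = Ve s c v j g a y \<and> vwin s v j a = B"
    using assms(1) unfolding Vend_def by blast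
  have "attains k m src t x = (B \<or> s = 0 \<and> t \<le> Suc c)"
  proof (rule attains_iffI)
    fix n assume "n \<ge> n0"
    from n0[OF this] obtain j g a y where
      "st (pre x n) = Ve s c v j g a y" "vwin s v j a = B" by blast
    then show "(even (tcol k m src t (st (pre x n))) \<noteq> even m) = (B \<or> s = 0 \<and> t \<le> Suc c)"
      using t m_pos by (auto simp: tcol_def vwin_def)
  qed
  then show "attains k m src t x \<longleftrightarrow> t \<le> (if B then k + 2 else if s = 0 then Suc c else 0)"
    using t by auto
qed (use assms(2) in auto)

lemma pay_build:
  assumes "\<And>n. n \<ge> n0 \<Longrightarrow> \<exists>w. st (pre x n) = Bd c w \<or> st (pre x n) = In c w" "c \<le> k"
  shows "py x = Suc c"
proof (rule pay_eqI[OF m_pos])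
  fix t :: nat assume t: "0 < t" "t \<le> k + 2"
  show "attains k m src t x \<longleftrightarrow> t \<le> Suc c"
  proof (rule attains_iffI)
    fix n assume "n \<ge> n0"
    from assms(1)[OF this] obtain w where "st (pre x n) = Bd c w \<or> st (pre x n) = In c w" by blast
    then show "(even (tcol k m src t (st (pre x n))) \<noteq> even m) = (t \<le> Suc c)"
      using t m_pos by (auto simp: tcol_def split: if_splits)
  qed
qed (use assms(2) in auto)

text \<open>After a challenge the colours are the same for all thresholds from 1 to
  \<open>k + 2\<close>, so these are reached all together or not at all.\<close>

lemma pay_challenged:
  assumes "st (pre x N) = Ve (Suc i) c v j g a y"
  shows "py x = 0 \<or> py x = k + 2"
proof -
  have "\<exists>j g a y. st (pre x (N + l)) = Ve (Suc i) c v j g a y" for l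
    by (induction l) (use assms in \<open>auto simp: pre_Suc\<close>)
  then have *: "\<exists>j g a y. st (pre x n') = Ve (Suc i) c v j g a y" if "n' \<ge> N" for n'
    using that by (metis le_iff_add)
  have "tcol k m src 1 (st (pre x n')) = tcol k m src (k + 2) (st (pre x n'))" if "n' \<ge> N" for n'
    using *[OF that] by (auto simp: tcol_def)
  then have "attains k m src 1 x \<longleftrightarrow> attains k m src (k + 2) x"
    unfolding attains_def by (metis (no_types, lifting) max.cobounded1 max.cobounded2 order_trans)
  then have "1 \<le> py x \<longleftrightarrow> k + 2 \<le> py x" using pay_ge_iff[OF m_pos] by blast
  then show ?thesis using pay_le[of k m src x] by auto
qed

lemma st_build:
  assumes "st u = Bd c []" "pre x (length u) = u" "\<And>l. \<not> x (length u + (2 * l + 1))"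
  shows "st (pre x (length u + 2 * l)) = Bd c (pre (\<lambda>j. x (length u + 2 * j)) l)"
    and "st (pre x (length u + (2 * l + 1))) = In c (pre (\<lambda>j. x (length u + 2 * j)) (Suc l))"
proof -
  have *: "st (pre x (length u + (2 * l + 1))) = In c (pre (\<lambda>j. x (length u + 2 * j)) (Suc l))"
    if "st (pre x (length u + 2 * l)) = Bd c (pre (\<lambda>j. x (length u + 2 * j)) l)" for l
    using that by (simp add: pre_Suc)
  show 1: "st (pre x (length u + 2 * l)) = Bd c (pre (\<lambda>j. x (length u + 2 * j)) l)" for l
  proof (induction l)
    case (Suc l)
    have "pre x (length u + 2 * Suc l) = pre x (length u + (2 * l + 1)) @ [x (length u + (2 * l + 1))]"
      using pre_Suc[of x "length u + (2 * l + 1)"] by simp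
    then show ?case using *[OF Suc] assms(3)[of l] by simp
  qed (use assms in simp)
  from *[OF this] show "st (pre x (length u + (2 * l + 1))) = In c (pre (\<lambda>j. x (length u + 2 * j)) (Suc l))" .
qed

lemma pay_st_build:
  assumes "st u = Bd c []" "pre x (length u) = u" "\<And>l. \<not> x (length u + (2 * l + 1))" "c \<le> k"
  shows "py x = Suc c"
proof (rule pay_build[of "length u"])
  fix n assume "length u \<le> n"
  then obtain l where l: "n = length u + l" by (auto simp: le_iff_add)
  show "\<exists>w. st (pre x n) = Bd c w \<or> st (pre x n) = In c w"
  proof (cases "even l")
    case True
    then obtain l' where "l = 2 * l'" by blast
    with st_build(1)[OF assms(1-3), of l'] l show ?thesis by auto
  next
    case False
    then obtain l' where "l = 2 * l' + 1" by (blast elim: oddE)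
    with st_build(2)[OF assms(1-3), of l'] l show ?thesis by auto
  qed
qed fact

section \<open>What each player can secure against a fixed strategy of the other\<close>

definition claim :: "nat \<Rightarrow> bool" where "claim i \<longleftrightarrow> (\<exists>e. hit (Suc i) [] (r (Suc i) e))"

definition covered :: "bool list \<Rightarrow> bool" where "covered v \<longleftrightarrow> (\<exists>e. hit 0 v (r 0 e))"

definition claims_from :: "nat \<Rightarrow> nat" where
  "claims_from i = (\<Sum>j=i..<k. of_bool (claim j))"

lemma claims_from_le: "claims_from i \<le> k - i"
proof -
  have "claims_from i \<le> (\<Sum>j=i..<k. 1)" unfolding claims_from_def by (rule sum_mono) simp
  then show ?thesis by simp
qed

lemma claims_from_end [simp]: "claims_from k = 0"
  by (simp add: claims_from_def)

lemma claims_from_step: "i < k \<Longrightarrow> claims_from i = of_bool (claim i) + claims_from (Suc i)"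
  unfolding claims_from_def by (rule sum.atLeast_Suc_lessThan)

text \<open>Player 1 claims exactly the true instances and never interrupts; a challenge of a true
  claim can only raise the payoff to \<open>k + 2\<close>.\<close>

lemma rch_lower:
  assumes "i \<le> k" "st u = enter k i c" "c \<le> i"
  shows "rch u False (\<lambda>x. Suc c + claims_from i \<le> py x)"
  using assms
proof (induction i arbitrary: c u rule: inc_induct)
  case base
  then have u: "st u = Bd c []" by (simp add: enter_def)
  obtain x where x: "pre x (length u) = u"
    "\<And>n. n \<ge> length u \<Longrightarrow> x n = (\<not> trn (pre x n) \<and> \<sigma> (pre x n))"
    using path_exists[of u "\<lambda>v. \<not> trn v \<and> \<sigma> v"] by blast
  have bd: "st (pre x (length u + 2 * l)) = Bd c (pre (\<lambda>j. x (length u + 2 * j)) l)" for l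
  proof (induction l)
    case (Suc l)
    have "st (pre x (Suc (length u + 2 * l))) = In c (pre (\<lambda>j. x (length u + 2 * j)) (Suc l))"
      using Suc by (simp add: pre_Suc)
    moreover from this have "\<not> x (Suc (length u + 2 * l))" using x(2) by simp
    ultimately have "st (pre x (Suc (Suc (length u + 2 * l)))) = Bd c (pre (\<lambda>j. x (length u + 2 * j)) (Suc l))"
      unfolding pre_Suc[of x "Suc _"] by simp
    then show ?case by simp
  qed (use u x in simp)
  have "st (pre x (Suc (length u + 2 * l))) = In c (pre (\<lambda>j. x (length u + 2 * j)) (Suc l))" for l
    using bd[of l] by (simp add: pre_Suc)
  then have "\<not> x (length u + (2 * l + 1))" for l using x(2)[of "Suc (length u + 2 * l)"] by simp
  from pay_st_build[OF u x(1) this] base have "py x = Suc c" by simp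
  then show ?case unfolding reach_def using x by (intro exI[of _ x]) auto
next
  case (step i)
  then have u: "st u = Cl i c" by (simp add: enter_def)
  have ch: "st (u @ [b]) = Ch i c b" for b using u by simp
  show ?case
  proof (cases "claim i")
    case True
    have "rch ((u @ [True]) @ [\<sigma> (u @ [True])]) False (\<lambda>x. Suc c + claims_from i \<le> py x)"
    proof (cases "\<sigma> (u @ [True])")
      case s: True
      have "st ((u @ [True]) @ [\<sigma> (u @ [True])]) = Ve (Suc i) c [] 0 0 0 0"
        unfolding run_snoc[of k m "u @ [True]"] ch using s by simp
      from rch_claim[OF this, of True] True step.hyps
      have "rch ((u @ [True]) @ [\<sigma> (u @ [True])]) False (Vend (Suc i) c [] True)"
        by (simp add: claim_def)
      then show ?thesis
      proof (rule reach_mono)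
        fix x assume "Vend (Suc i) c [] True x"
        then have "py x = k + 2" using pay_Vend step by simp
        then show "Suc c + claims_from i \<le> py x" using claims_from_le[of i] step by simp
      qed
    next
      case s: False
      have "st ((u @ [True]) @ [\<sigma> (u @ [True])]) = enter k (Suc i) (Suc c)"
        unfolding run_snoc[of k m "u @ [True]"] ch using s by simp
      from step.IH[OF this] step.hyps step.prems True show ?thesis
        by (simp add: claims_from_step)
    qed
    then have "rch (u @ [True]) False (\<lambda>x. Suc c + claims_from i \<le> py x)"
      by (rule reach_back) simp
    then show ?thesis by (rule reach_back) (simp add: u)
  next
    case False
    have "st ((u @ [False]) @ [\<sigma> (u @ [False])]) = enter k (Suc i) c"
      unfolding run_snoc[of k m "u @ [False]"] ch by simp
    from step.IH[OF this] step.hyps step.prems False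
    have "rch ((u @ [False]) @ [\<sigma> (u @ [False])]) False (\<lambda>x. Suc c + claims_from i \<le> py x)"
      by (simp add: claims_from_step)
    then have "rch (u @ [False]) False (\<lambda>x. Suc c + claims_from i \<le> py x)"
      by (rule reach_back) simp
    then show ?thesis by (rule reach_back) (simp add: u)
  qed
qed

text \<open>Player 2 builds \<open>a\<close>, a point of the closed set. The first interruption by
  \<open>\<sigma>\<close>, if any, makes a false claim; refuting it leaves the payoff at
  \<open>Suc c\<close>.\<close>

lemma rch_build:
  assumes "st u = Bd c []" "c \<le> k" "\<And>l. \<not> covered (pre a l)"
  shows "rch u True (\<lambda>x. py x = Suc c)"
proof -
  obtain x where x: "pre x (length u) = u"
    "\<And>n. n \<ge> length u \<Longrightarrow> x n = (even (n - length u) \<and> a ((n - length u) div 2))"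
    using path_exists[of u "\<lambda>v. even (length v - length u) \<and> a ((length v - length u) div 2)"] by auto
  have odd: "\<not> x (length u + (2 * l + 1))" for l using x(2) by simp
  have even: "(\<lambda>j. x (length u + 2 * j)) = a" using x(2) by (simp add: fun_eq_iff)
  note st_build = st_build[OF assms(1) x(1) odd, unfolded even]
  have along: "rch u True \<Psi>" if "rch (pre x (length u + l)) True \<Psi>"
    "\<And>l'. 2 * l' + 1 < l \<Longrightarrow> \<not> \<sigma> (pre x (length u + (2 * l' + 1)))" for l \<Psi>
  proof -
    have "rch (pre x (length u)) True \<Psi>"
    proof (rule reach_along[OF that(1)])
      fix j assume j: "length u \<le> j" "j < length u + l" "trn (pre x j) = True"
      define i where "i = j - length u"
      have ji: "j = length u + i" using j by (simp add: i_def)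
      have "odd i" using st_build(1)[of "i div 2"] j(3) unfolding ji by (intro notI) auto
      then obtain l' where l': "i = 2 * l' + 1" by (blast elim: oddE)
      show "x j = \<sigma> (pre x j)" using that(2)[of l'] odd[of l'] j(2) unfolding ji l' by simp
    qed
    then show ?thesis using x(1) by simp
  qed
  show ?thesis
  proof (cases "\<exists>l. \<sigma> (pre x (length u + (2 * l + 1)))")
    case True
    define l where "l = (LEAST l. \<sigma> (pre x (length u + (2 * l + 1))))"
    have l: "\<sigma> (pre x (length u + (2 * l + 1)))" using True unfolding l_def by (rule LeastI_ex)
    have "st (pre x (length u + (2 * l + 1)) @ [True]) = Ve 0 c (pre a (Suc l)) 0 0 0 0"
      using st_build(2)[of l] by simp
    from rch_claim[OF this, of False] assms(3)
    have "rch (pre x (length u + (2 * l + 1)) @ [True]) True (Vend 0 c (pre a (Suc l)) False)"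
      by (simp add: covered_def)
    then have "rch (pre x (length u + (2 * l + 1)) @ [True]) True (\<lambda>x. py x = Suc c)"
      by (rule reach_mono) (use pay_Vend assms(2) in simp)
    then have "rch (pre x (length u + (2 * l + 1))) True (\<lambda>x. py x = Suc c)"
      by (rule reach_back) (use l in simp)
    then show ?thesis by (rule along) (use not_less_Least in \<open>auto simp: l_def\<close>)
  next
    case False
    have "x j = \<sigma> (pre x j)" if "length u \<le> j" "trn (pre x j) = True" for j
    proof -
      define i where "i = j - length u"
      have ji: "j = length u + i" using that by (simp add: i_def)
      have "odd i" using st_build(1)[of "i div 2"] that(2) unfolding ji by (intro notI) auto
      then obtain l' where l': "i = 2 * l' + 1" by (blast elim: oddE)
      show ?thesis using False odd[of l'] unfolding ji l' by simp
    qed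
    moreover have "py x = Suc c" by (rule pay_st_build[OF assms(1) x(1) odd assms(2)])
    ultimately show ?thesis using x(1) unfolding reach_def by blast
  qed
qed

text \<open>Player 2 challenges exactly the false claims and then builds the point
  \<open>a\<close>.\<close>

lemma rch_upper:
  assumes "\<And>l. \<not> covered (pre a l)" "i \<le> k" "st u = enter k i c" "c \<le> i"
  shows "rch u True (\<lambda>x. py x \<le> Suc c + claims_from i)"
  using assms(2-)
proof (induction i arbitrary: c u rule: inc_induct)
  case base
  then have "rch u True (\<lambda>x. py x = Suc c)" by (intro rch_build[OF _ _ assms(1)]) (simp_all add: enter_def)
  then show ?case by (rule reach_mono) simp
next
  case (step i)
  then have u: "st u = Cl i c" by (simp add: enter_def)
  define b where "b = \<sigma> u"
  have ch: "st (u @ [b]) = Ch i c b" using u by simp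
  have "rch (u @ [b]) True (\<lambda>x. py x \<le> Suc c + claims_from i)"
  proof (cases "b \<and> \<not> claim i")
    case True
    then have "st ((u @ [b]) @ [True]) = Ve (Suc i) c [] 0 0 0 0"
      unfolding run_snoc[of k m "u @ [b]"] ch by simp
    from rch_claim[OF this, of False] True step.hyps
    have "rch ((u @ [b]) @ [True]) True (Vend (Suc i) c [] False)" by (simp add: claim_def)
    then have "rch ((u @ [b]) @ [True]) True (\<lambda>x. py x \<le> Suc c + claims_from i)"
      by (rule reach_mono) (use pay_Vend step in simp)
    then show ?thesis by (rule reach_back) (use ch in simp)
  next
    case False
    then have "st ((u @ [b]) @ [False]) = enter k (Suc i) (c + of_bool b)"
      unfolding run_snoc[of k m "u @ [b]"] ch by simp
    from step.IH[OF this] step.prems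
    have "rch ((u @ [b]) @ [False]) True (\<lambda>x. py x \<le> Suc (c + of_bool b) + claims_from (Suc i))" by simp
    moreover have "of_bool b + claims_from (Suc i) \<le> claims_from i"
      using False step.hyps by (cases b) (auto simp: claims_from_step)
    ultimately have "rch ((u @ [b]) @ [False]) True (\<lambda>x. py x \<le> Suc c + claims_from i)"
      by (elim reach_mono) linarith
    then show ?thesis by (rule reach_back) (use ch in simp)
  qed
  then show ?case by (rule reach_back) (simp add: b_def)
qed

text \<open>The equilibrium payoff is one more than the number of true instances. The point is read
  off \<open>x\<close> rather than the equilibrium play, where player 1 may interrupt at no loss and
  cut the point short. In \<open>x\<close> player 2 still follows \<open>\<sigma>\<close>, so a
  covered prefix would let player 1 deviate to \<open>k + 2\<close>.\<close>

lemma NE_answers: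
  assumes NE: "is_NE (claim_game k m src) \<sigma>" and a: "\<And>l. \<not> covered (pre a l)"
  defines "x \<equiv> play (\<lambda>v. \<not> (2 * k \<le> length v \<and> odd (length v)) \<and> \<sigma> v)"
  shows "i < k \<Longrightarrow> x (2 * i) = claim i"
    and "\<not> covered (pre (\<lambda>j. x (2 * k + 2 * j)) (Suc l))"
proof -
  let ?y = "play \<sigma>"
  define C where "C i = (\<Sum>j<i. of_bool (?y (2 * j)) :: nat)" for i
  have C_le: "C i \<le> i" for i
  proof -
    have "C i \<le> (\<Sum>j<i. 1)" unfolding C_def by (rule sum_mono) simp
    then show ?thesis by simp
  qed
  obtain z where "consistent trn False \<sigma> z" "Suc (claims_from 0) \<le> py z"
    using rch_lower[of 0 "[]" 0] by (auto simp: reach_Nil)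
  with claim_game_NE(1)[OF NE] have lower: "Suc (claims_from 0) \<le> py ?y" by fastforce
  have dev: "py ?y \<le> N" if "rch (pre ?y j) True (\<lambda>x. py x \<le> N)" for j N
  proof -
    have "rch (pre ?y 0) True (\<lambda>x. py x \<le> N)"
      by (rule reach_along[of _ _ _ 0 j]) (use that play_step in auto)
    then obtain z where "consistent trn True \<sigma> z" "py z \<le> N" by (auto simp: reach_Nil)
    with claim_game_NE(2)[OF NE] show ?thesis by fastforce
  qed
  have "rch (pre ?y 0) True (\<lambda>x. py x \<le> Suc 0 + claims_from 0)"
    by (rule rch_upper[OF a]) auto
  from dev[OF this] lower have val: "py ?y = Suc (claims_from 0)" by simp
  then have val_bounds: "py ?y \<noteq> 0" "py ?y < k + 2" using claims_from_le[of 0] by auto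
  have st: "st (pre ?y (2 * i)) = enter k i (C i)" if "i \<le> k" for i
    using that
  proof (induction i)
    case (Suc i)
    then have "st (pre ?y (Suc (2 * i))) = Ch i (C i) (?y (2 * i))" by (simp add: pre_Suc enter_def)
    then have *: "st (pre ?y (Suc (Suc (2 * i)))) = (if ?y (2 * i) \<and> ?y (Suc (2 * i)) then Ve (Suc i) (C i) [] 0 0 0 0
        else enter k (Suc i) (C i + of_bool (?y (2 * i))))"
      unfolding pre_Suc[of _ "Suc (2 * i)"] by simp
    \<comment> \<open>A challenge would end in payoff 0 or \<open>k + 2\<close>, and the equilibrium
      payoff lies strictly between.\<close>
    have "\<not> (?y (2 * i) \<and> ?y (Suc (2 * i)))"
    proof
      assume "?y (2 * i) \<and> ?y (Suc (2 * i))"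
      with * have "st (pre ?y (Suc (Suc (2 * i)))) = Ve (Suc i) (C i) [] 0 0 0 0" by simp
      from pay_challenged[OF this] val_bounds show False by simp
    qed
    with * show ?case by (simp add: C_def)
  qed (simp add: C_def)
  have sound: "claim i" if i: "i < k" "?y (2 * i)" for i
  proof (rule ccontr)
    assume "\<not> claim i"
    have ch: "st (pre ?y (Suc (2 * i))) = Ch i (C i) True" using st[of i] i by (simp add: pre_Suc enter_def)
    then have "st (pre ?y (Suc (2 * i)) @ [True]) = Ve (Suc i) (C i) [] 0 0 0 0" by simp
    from rch_claim[OF this, of False] \<open>\<not> claim i\<close> i
    have "rch (pre ?y (Suc (2 * i)) @ [True]) True (Vend (Suc i) (C i) [] False)" by (simp add: claim_def)
    then have "rch (pre ?y (Suc (2 * i)) @ [True]) True (\<lambda>x. py x \<le> 0)"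
      by (rule reach_mono) (use pay_Vend C_le[of i] i in simp)
    then have "rch (pre ?y (Suc (2 * i))) True (\<lambda>x. py x \<le> 0)"
      by (rule reach_back) (use ch in simp)
    from dev[OF this] val_bounds show False by simp
  qed
  have bd: "st (pre ?y (2 * k)) = Bd (C k) []" using st[of k] by (simp add: enter_def)
  have "rch (pre ?y (2 * k)) True (\<lambda>x. py x = Suc (C k))"
    by (rule rch_build[OF bd C_le a])
  then have "rch (pre ?y (2 * k)) True (\<lambda>x. py x \<le> Suc (C k))" by (rule reach_mono) simp
  \<comment> \<open>From here player 2 can hold the payoff to \<open>Suc (C k)\<close>, so there are
    at least as many claims as true instances. Since all claims are true, none is missing.\<close>
  from dev[OF this] val have count: "claims_from 0 \<le> C k" by simp
  have complete: "?y (2 * i)" if i: "i < k" "claim i" for i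
  proof (rule ccontr)
    assume ni: "\<not> ?y (2 * i)"
    have "C k < (\<Sum>j<k. of_bool (claim j))"
      unfolding C_def by (rule sum_strict_mono_ex1) (use sound i ni in auto)
    also have "\<dots> = claims_from 0" unfolding claims_from_def by (simp add: atLeast0LessThan)
    finally show False using count by simp
  qed
  have xs: "x n = (\<not> (2 * k \<le> n \<and> odd n) \<and> \<sigma> (pre x n))" for n
    unfolding x_def by (subst play_step) simp
  have "n \<le> 2 * k \<Longrightarrow> pre x n = pre ?y n" for n
  proof (induction n)
    case (Suc n)
    then have "x n = ?y n" using xs[of n] play_step[of \<sigma> n] by simp
    with Suc show ?case by (simp add: pre_Suc)
  qed simp
  then have pre_x: "pre x (2 * k) = pre ?y (2 * k)" by simp
  then have "x n = ?y n" if "n < 2 * k" for n using that by (simp add: pre_eq_iff)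
  with sound complete show "i < k \<Longrightarrow> x (2 * i) = claim i" by auto
  let ?u = "pre ?y (2 * k)" and ?b = "\<lambda>j. x (2 * k + 2 * j)"
  have odd: "\<not> x (2 * k + (2 * l + 1))" for l using xs by simp
  have build: "st (pre x (2 * k + (2 * l + 1))) = In (C k) (pre ?b (Suc l))" for l
    using st_build(2)[OF bd, of x l] pre_x odd by simp
  show "\<not> covered (pre ?b (Suc l))"
  proof
    let ?n = "2 * k + (2 * l + 1)"
    assume "covered (pre ?b (Suc l))"
    have "st (pre x ?n @ [True]) = Ve 0 (C k) (pre ?b (Suc l)) 0 0 0 0" using build[of l] by simp
    from rch_claim[OF this, of True] \<open>covered (pre ?b (Suc l))\<close>
    have "rch (pre x ?n @ [True]) False (Vend 0 (C k) (pre ?b (Suc l)) True)" by (simp add: covered_def)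
    then have "rch (pre x ?n @ [True]) False (\<lambda>x. py x = k + 2)"
      by (rule reach_mono) (use pay_Vend C_le[of k] in simp)
    then have "rch (pre x (0 + ?n)) False (\<lambda>x. py x = k + 2)"
      unfolding add_0 by (rule reach_back) (use build[of l] in simp)
    then have "rch (pre x 0) False (\<lambda>x. py x = k + 2)"
    proof (rule reach_along)
      fix j assume j: "trn (pre x j) = False"
      have "\<not> (2 * k \<le> j \<and> odd j)"
      proof
        assume jk: "2 * k \<le> j \<and> odd j"
        then have "odd (j - 2 * k)" by simp
        then obtain l' where "j - 2 * k = 2 * l' + 1" by (blast elim: oddE)
        with jk have "j = 2 * k + (2 * l' + 1)" by simp
        with build[of l'] j show False by simp
      qed
      with xs[of j] show "x j = \<sigma> (pre x j)" by simp
    qed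
    then obtain z where "consistent trn False \<sigma> z" "py z = k + 2" by (auto simp: reach_Nil)
    with claim_game_NE(1)[OF NE] val_bounds show False by fastforce
  qed
qed

end

subsection \<open>Computability of the game\<close>

text \<open>Filler zeros keep \<open>c\<close> in field 2 and the word in field 3 for all states
  that have them.\<close>

fun senc :: "state \<Rightarrow> nat" where
  "senc (Cl i c) = list_encode [0, i, c]"
| "senc (Ch i c b) = list_encode [1, i, c, of_bool b]"
| "senc (Bd c w) = list_encode [2, 0, c, enc w]"
| "senc (In c w) = list_encode [3, 0, c, enc w]"
| "senc (Ve s c w j g x y) = list_encode [4, s, c, enc w, j, g, x, y]"

definition fld :: "nat \<Rightarrow> nat \<Rightarrow> nat" where "fld i z = pf (dropc i z - 1)"

lemma fld_list_encode: "i < length xs \<Longrightarrow> fld i (list_encode xs) = xs ! i"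
  unfolding fld_def nth_list_decode by simp

lemma cpt_fld [cpt_intros]: "cpt F \<Longrightarrow> cpt (\<lambda>p x. fld i (F p x))"
  unfolding fld_def by (intro cpt_intros cpt_dropc)

definition enterc :: "nat \<Rightarrow> nat \<Rightarrow> nat \<Rightarrow> nat" where
  "enterc k i c = (if i < k then list_encode [0, i, c] else list_encode [2, 0, c, 0])"

definition stepc :: "nat \<Rightarrow> nat \<Rightarrow> nat \<Rightarrow> bool \<Rightarrow> nat" where
  "stepc k m z b =
    (if fld 0 z = 0 then list_encode [1, fld 1 z, fld 2 z, of_bool b]
     else if fld 0 z = 1 then (if 0 < fld 3 z \<and> b then list_encode [4, Suc (fld 1 z), fld 2 z, 0, 0, 0, 0, 0]
       else enterc k (Suc (fld 1 z)) (fld 2 z + fld 3 z))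
     else if fld 0 z = 2 then list_encode [3, 0, fld 2 z, enc (word (fld 3 z) @ [b])]
     else if fld 0 z = 3 then (if b then list_encode [4, 0, fld 2 z, fld 3 z, 0, 0, 0, 0]
       else list_encode [2, 0, fld 2 z, fld 3 z])
     else if m \<le> fld 4 z then z
     else if b then list_encode [4, fld 1 z, fld 2 z, fld 3 z, Suc (fld 4 z), 0,
       next_idx (fld 4 z) (fld 6 z) (fld 7 z) (pf (fld 5 z)), ps (fld 5 z)]
     else list_encode [4, fld 1 z, fld 2 z, fld 3 z, fld 4 z, Suc (fld 5 z), fld 6 z, fld 7 z])"

definition turnc :: "nat \<Rightarrow> bool" where
  "turnc z \<longleftrightarrow> fld 0 z = 0 \<or> fld 0 z = 3 \<or> fld 0 z = 4 \<and> even (fld 4 z)"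

definition vcolc :: "nat \<Rightarrow> (nat \<Rightarrow> baire) \<Rightarrow> nat \<Rightarrow> nat \<Rightarrow> nat" where
  "vcolc m src t z =
    (if fld 0 z \<le> 1 then m
     else if fld 0 z \<le> 3 then (if t \<le> Suc (fld 2 z) then m - 1 else m)
     else if fld 1 z = 0 \<and> t \<le> Suc (fld 2 z) then m - 1
     else if fld 4 z < m then m - fld 4 z
     else if hit (fld 1 z) (word (fld 3 z)) (src (fld 1 z) (fld 6 z)) = odd m then 0 else 1)"

lemma enc_Nil [simp]: "enc [] = 0"
  by (simp add: enc_def)

lemma senc_enter: "senc (enter k i c) = enterc k i c"
  by (simp add: enter_def enterc_def)

lemma senc_step: "senc (step k m z b) = stepc k m (senc z) b"
  by (cases z) (simp_all add: stepc_def fld_list_encode senc_enter del: list_encode.simps)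

lemma turn_senc: "turn z = turnc (senc z)"
  by (cases z) (simp_all add: turnc_def fld_list_encode del: list_encode.simps)

lemma vcol_senc: "vcol m src t z = vcolc m src t (senc z)"
  by (cases z) (simp_all add: vcolc_def fld_list_encode del: list_encode.simps)

lemma senc_run: "senc (run k m u) = foldl (stepc k m) (enterc k 0 0) u"
  by (induction u rule: rev_induct) (simp_all add: senc_enter senc_step)

lemma cpt_list_encode_Cons [cpt_intros]:
  "cpt F \<Longrightarrow> cpt (\<lambda>p x. list_encode (G p x)) \<Longrightarrow> cpt (\<lambda>p x. list_encode (F p x # G p x))"
  unfolding list_encode.simps by (intro cpt_intros)

lemma cpt_enterc: "cpt K \<Longrightarrow> cpt I \<Longrightarrow> cpt C \<Longrightarrow> cpt (\<lambda>p x. enterc (K p x) (I p x) (C p x))"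
  unfolding enterc_def by (intro cpt_intros)

lemma cpt_stepc:
  "cpt K \<Longrightarrow> cpt Z \<Longrightarrow> dec B \<Longrightarrow> cpt (\<lambda>p x. stepc (K p x) m (Z p x) (B p x))"
  unfolding stepc_def next_idx_def by (intro cpt_intros cpt_enterc)

lemma cpt_senc_run:
  assumes "cpt K" "cptw U" shows "cpt (\<lambda>p x. senc (run (K p x) m (U p x)))"
  unfolding senc_run
  by (intro cpt_foldl cpt_enterc cpt_stepc cpt_intros assms cpt_compose[OF assms(1)])

lemma dec_turn_run:
  assumes "cpt K" "cptw U" shows "dec (\<lambda>p x. turn (run (K p x) m (U p x)))"
  unfolding turn_senc turnc_def by (intro cpt_intros cpt_senc_run assms)

definition source :: "baire \<Rightarrow> nat \<Rightarrow> baire" where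
  "source q s x = (if s = 0 then bfst q x else bsnd q (Suc (prod_encode (s - 1, x))))"

definition lpo_count :: "baire \<Rightarrow> nat" where "lpo_count q = bsnd q 0"

lemma dec_hit: assumes "cpt S" "cptw W" "cpt Z" shows "dec (\<lambda>p x. hit (S p x) (W p x) (Z p x))"
  unfolding hit_def is_prefix_def
  by (intro cpt_intros assms cpt_compose[OF assms(3)] cptw_compose[OF assms(2)])

lemma cpt_tcol_run:
  assumes "cpt T" "cptw U"
  shows "cpt (\<lambda>q x. tcol (lpo_count q) m (source q) (T q x) (run (lpo_count q) m (U q x)))"
  unfolding tcol_def vcol_senc vcolc_def source_def lpo_count_def
  by (intro cpt_intros cpt_senc_run dec_hit assms)

text \<open>Upper sets of player 1 are the outcomes from \<open>t\<close> on, those of player 2 the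
  outcomes below \<open>t\<close>. The default \<open>k + 3\<close> covers the empty and the full
  set respectively.\<close>

definition threshold :: "nat \<Rightarrow> nat \<Rightarrow> nat" where
  "threshold k e = (if pf e = 1 then bleast (k + 3) (\<lambda>t. t \<in> set_decode (ps e))
     else bleast (k + 3) (\<lambda>t. t \<notin> set_decode (ps e)))"

definition game_name :: "nat \<Rightarrow> baire \<Rightarrow> baire" where
  "game_name m q z =
    (if pf z = 0 then lpo_count q + 3
     else if pf z = 1 then of_bool (turn (run (lpo_count q) m (word (ps z))))
     else if pf z = 2 then of_bool (pf (ps z) < ps (ps z))
     else if ps (ps z) = 0 then of_bool (pf (pf (ps z)) \<noteq> 1)
     else (let c = pf (ps (ps z) - 1); i = ps (ps (ps z) - 1) in
       if tcol (lpo_count q) m (source q) (threshold (lpo_count q) (pf (ps z))) (run (lpo_count q) m (word i)) \<le> c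
       then Suc i else 0))"

lemma cpt_game_name: "cpt (game_name m)"
proof -
  have "cpt (\<lambda>q x. lpo_count q)" unfolding lpo_count_def by (intro cpt_intros)
  moreover have "cpt (\<lambda>q z. threshold (lpo_count q) (pf (ps z)))"
    unfolding threshold_def lpo_count_def by (intro cpt_intros)
  ultimately show ?thesis
    unfolding game_name_def Let_def by (intro cpt_intros cpt_tcol_run dec_turn_run)
qed

lemma Dm_set_tcol:
  assumes "0 < m" and r: "\<And>c i. r (prod_encode (c, i)) = (if tcol k m src t (run k m (word i)) \<le> c then Suc i else 0)"
  shows "Dm_set m r = {x. attains k m src t x}"
proof (rule set_eqI)
  fix x
  let ?c = "\<lambda>u. tcol k m src t (run k m u)"
  have mono: "?c (u @ [b]) \<le> ?c u" for u b using tcol_step[OF assms(1)] by simp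
  then have "?c (pre x (Suc n)) \<le> ?c (pre x n)" for n by (simp add: pre_Suc)
  then obtain n0 where n0: "\<And>n. n \<ge> n0 \<Longrightarrow> ?c (pre x n) = ?c (pre x n0)"
    by (rule nat_decseq_eventually_const[of "\<lambda>n. ?c (pre x n)"]) blast
  have "first_idx m r x = ?c (pre x n0)"
    by (rule first_idx_colour[of m r ?c, OF _ mono n0]) (simp_all add: bcomp_def r tcol_le assms(1))
  moreover have "attains k m src t x = (even (?c (pre x n0)) \<noteq> even m)"
  proof (rule attains_iffI)
    fix n assume "n0 \<le> n"
    from n0[OF this] show "(even (?c (pre x n)) \<noteq> even m) = (even (?c (pre x n0)) \<noteq> even m)" by simp
  qed
  ultimately show "x \<in> Dm_set m r \<longleftrightarrow> x \<in> {x. attains k m src t x}"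
    unfolding Dm_set_def mem_Collect_eq by (simp only: mod_2_neq_iff)
qed

lemma threshold_upper:
  assumes "upper_set (k + 3) (\<lambda>a b. a < b \<and> b < k + 3) i U" "v < k + 3"
  shows "v \<in> U \<longleftrightarrow> (threshold k (prod_encode (of_bool i, set_encode U)) \<le> v) = i"
proof -
  have U: "U \<subseteq> {..<k + 3}" "\<And>a b. a \<in> U \<Longrightarrow> b < k + 3 \<Longrightarrow> prefp (\<lambda>a b. a < b \<and> b < k + 3) i a b \<Longrightarrow> b \<in> U"
    using assms(1) unfolding upper_set_def by auto
  then have [simp]: "set_decode (set_encode U) = U" using finite_subset by (intro set_encode_inverse) blast
  show ?thesis
  proof (cases i)
    case True
    define t where "t = bleast (k + 3) (\<lambda>t. t \<in> U)"
    have "v \<in> U \<longleftrightarrow> t \<le> v"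
    proof
      assume "v \<in> U" then show "t \<le> v"
        using bleast_spec(2)[of v "k + 3" "\<lambda>t. t \<in> U"] unfolding t_def by (meson not_le)
    next
      assume "t \<le> v"
      then have "t \<in> U" using bleast_spec(3)[of "k + 3" "\<lambda>t. t \<in> U"] assms(2) unfolding t_def by linarith
      with U(2)[of t v] \<open>t \<le> v\<close> assms(2) True show "v \<in> U" by (cases "t = v") (auto simp: prefp_def)
    qed
    then show ?thesis using True by (simp add: threshold_def t_def)
  next
    case False
    define t where "t = bleast (k + 3) (\<lambda>t. t \<notin> U)"
    have "v \<notin> U \<longleftrightarrow> t \<le> v"
    proof
      assume "v \<notin> U" then show "t \<le> v"
        using bleast_spec(2)[of v "k + 3" "\<lambda>t. t \<notin> U"] unfolding t_def by (meson not_le)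
    next
      assume "t \<le> v"
      then have "t \<notin> U" using bleast_spec(3)[of "k + 3" "\<lambda>t. t \<notin> U"] assms(2) unfolding t_def by linarith
      with U(2)[of v t] \<open>t \<le> v\<close> assms(2) False show "v \<notin> U" by (cases "t = v") (auto simp: prefp_def)
    qed
    then have "v \<in> U \<longleftrightarrow> \<not> t \<le> v" by blast
    then show ?thesis using False by (simp add: threshold_def t_def)
  qed
qed

lemma game_rep_claim_game:
  assumes "0 < m" shows "game_rep m (game_name m q) (claim_game (lpo_count q) m (source q))"
proof -
  let ?k = "lpo_count q"
  have lt: "pay ?k m (source q) x < ?k + 3" for x using pay_le[of ?k m "source q" x] by simp
  have "gamma_rep m (bcomp (bcomp (game_name m q) 3) (prod_encode (of_bool i, set_encode U)))
      {x. pay ?k m (source q) x \<in> U}" (is "gamma_rep m ?g _")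
    if U: "upper_set (?k + 3) (\<lambda>a b. a < b \<and> b < ?k + 3) i U" for i U
  proof -
    let ?t = "threshold ?k (prod_encode (of_bool i, set_encode U))"
    have g0: "?g 0 = of_bool (\<not> i)" by (auto simp: bcomp_def game_name_def)
    have "Dm_set m (\<lambda>z. ?g (Suc z)) = {x. attains ?k m (source q) ?t x}"
      by (rule Dm_set_tcol[OF assms]) (simp add: bcomp_def game_name_def Let_def)
    also have "\<dots> = {x. ?t \<le> pay ?k m (source q) x}" using pay_ge_iff[OF assms] by simp
    finally have D: "Dm_set m (\<lambda>z. ?g (Suc z)) = {x. ?t \<le> pay ?k m (source q) x}" .
    have "{x. pay ?k m (source q) x \<in> U} = {x. (?t \<le> pay ?k m (source q) x) = i}"
      using threshold_upper[OF U lt] by simp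
    then show ?thesis unfolding gamma_rep_def D g0 by (cases i) auto
  qed
  then show ?thesis
    unfolding game_rep_def claim_game_def valid_game_def prod.case
    using lt by (auto simp: bcomp_def[of _ 0] bcomp_def[of _ 1] bcomp_def[of _ 2] bcomp_def[of _ "Suc 0"] game_name_def)
qed

subsection \<open>The reduction\<close>

text \<open>Here \<open>s = bpair q g\<close> with \<open>g\<close> a name of an equilibrium; the answers are read from the play in
  which player 1 never interrupts.\<close>

definition calm :: "baire \<Rightarrow> strategy" where
  "calm s v \<longleftrightarrow> \<not> (2 * lpo_count (bfst s) \<le> length v \<and> odd (length v)) \<and> bsnd s (enc v) \<noteq> 0"

definition answers :: "baire \<Rightarrow> baire" where
  "answers s = bpair (\<lambda>i. of_bool (play (calm s) (2 * lpo_count (bfst s) + 2 * i)))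
     (\<lambda>j. if j = 0 then lpo_count (bfst s) else if play (calm s) (2 * pf (j - 1)) then 0 else 1)"

lemma dec_calm [cpt_intros]: "cptw V \<Longrightarrow> dec (\<lambda>s x. calm s (V s x))"
  unfolding calm_def lpo_count_def by (intro cpt_intros)

lemma dec_play_calm [cpt_intros]: assumes "cpt X" shows "dec (\<lambda>s x. play (calm s) (X s x))"
proof -
  have "enc (hist \<sigma> n) = rec_nat 0 (\<lambda>_ r. enc (word r @ [\<sigma> (word r)])) n" for \<sigma> n
  proof (induction n)
    case (Suc n)
    show ?case by (simp add: Suc[symmetric])
  qed simp
  moreover have "cpt (\<lambda>s x. rec_nat 0 (\<lambda>_ r. enc (word r @ [calm s (word r)])) (X s x))"
    by (intro cpt_intros assms)
  ultimately have "cptw (\<lambda>s x. hist (calm s) (X s x))" by (simp add: cptw_def)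
  then show ?thesis unfolding play_def by (intro cpt_intros)
qed

lemma cpt_answers: "cpt answers"
  unfolding answers_def lpo_count_def by (intro cpt_intros)

lemma is_prefix_pre: "is_prefix w (pre x l) \<longleftrightarrow> length w \<le> l \<and> pre x (length w) = w"
  unfolding is_prefix_def list_eq_iff_nth_eq[of "pre x _"] by (auto simp: bit_at_def)

lemma le_NE_ap: "prod_prob (jump_prob n C_cantor) (star_prob (jump_prob n LPO)) \<le>\<^sub>W NE_ap (Suc n)"
  unfolding choice_lpo_eq NE_ap_def
proof (rule weihrauch_leI[OF cpt_game_name[of "Suc n"] cpt_answers])
  let ?f = "\<lambda>(A, qs). A \<times> {ys. length ys = length qs \<and>
        (\<forall>i<length qs. ys ! i = (if qs ! i = (\<lambda>_. 0) then 1 else 0 :: nat))}"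
  fix q :: baire and z :: "cantor set \<times> baire list"
  let ?G = "claim_game (lpo_count q) (Suc n) (source q)"
  have rep: "game_rep (Suc n) (game_name (Suc n) q) ?G" by (rule game_rep_claim_game) simp
  \<comment> \<open>The determinacy argument of the first reduction puts the constructed game into
    the domain.\<close>
  with NE_exists[OF rep] show "\<exists>z. game_rep (Suc n) (game_name (Suc n) q) z \<and> {s. is_NE z s} \<noteq> {}" by blast
  fix F assume F: "realizer (\<lambda>G. {s. is_NE G s}, game_rep (Suc n), strat_rep) F"
    and z: "prod_rep ((jump_rep ^^ n) closed_rep) (tuple_rep ((jump_rep ^^ n) baire_rep)) q z" "?f z \<noteq> {}"
  obtain A qs where zA: "z = (A, qs)" by (cases z)
  obtain r0 where r0: "limn n (bfst q) r0" "A = - open_of r0"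
    using z(1) unfolding zA prod_rep_def jump_rep_funpow closed_rep_def by auto
  have lpo_count: "lpo_count q = length qs" and
    qs: "\<And>i. i < lpo_count q \<Longrightarrow> limn n (\<lambda>l. bsnd q (Suc (prod_encode (i, l)))) (qs ! i)"
    using z(1) unfolding zA prod_rep_def tuple_rep_def jump_rep_funpow baire_rep_def lpo_count_def by auto
  obtain a where a: "a \<in> A" using z(2) unfolding zA by auto
  define g where "g = F (game_name (Suc n) q)"
  obtain \<sigma> where \<sigma>: "strat_rep g \<sigma>" "is_NE ?G \<sigma>"
    using F rep NE_exists[OF rep] unfolding realizer_def prod.case g_def by blast
  define r where "r s = (if s = 0 then r0 else qs ! (s - 1))" for s
  interpret claim_play "lpo_count q" n "Suc n" "source q" r \<sigma>
  proof
    fix s assume "s \<le> lpo_count q"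
    moreover have "source q 0 = bfst q" "source q (Suc i) = (\<lambda>l. bsnd q (Suc (prod_encode (i, l))))" for i
      by (auto simp: source_def)
    ultimately show "limn n (source q s) (r s)" using r0(1) qs by (cases s) (auto simp: r_def)
  qed simp
  have covered: "covered (pre x l) \<Longrightarrow> x \<in> open_of r0" for x l
    unfolding covered_def hit_def is_prefix_pre open_of_iff by (auto simp: r_def)
  \<comment> \<open>Player 1 can interrupt only after at least one bit, hence \<open>Suc l\<close>;
    this suffices because covered prefixes stay covered when extended.\<close>
  have uncovered: "x \<notin> open_of r0" if "\<And>l. \<not> covered (pre x (Suc l))" for x
  proof
    assume "x \<in> open_of r0"
    then obtain e where e: "0 < r0 e" "pre x (length (word (r0 e - 1))) = word (r0 e - 1)"
      unfolding open_of_iff by blast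
    then have "hit 0 (pre x (Suc (length (word (r0 e - 1))))) (r 0 e)"
      by (simp add: hit_def is_prefix_pre r_def)
    with that show False unfolding covered_def by blast
  qed
  have claim: "claim i \<longleftrightarrow> qs ! i \<noteq> (\<lambda>_. 0)" for i
    by (auto simp: claim_def hit_def r_def fun_eq_iff)
  define s where "s = bpair q g"
  have calm: "calm s = (\<lambda>v. \<not> (2 * lpo_count q \<le> length v \<and> odd (length v)) \<and> \<sigma> v)"
    using \<sigma>(1) by (auto simp: calm_def s_def strat_rep_def)
  have "\<not> covered (pre a l)" for l using covered a r0(2) by blast
  note ans = NE_answers[OF \<sigma>(2) this, folded calm]
  have "(\<lambda>j. play (calm s) (2 * lpo_count q + 2 * j)) \<in> A"
    using uncovered[OF ans(2)] r0(2) by simp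
  moreover have "cantor_rep (bfst (answers s)) (\<lambda>j. play (calm s) (2 * lpo_count q + 2 * j))"
    by (simp add: cantor_rep_def answers_def s_def)
  moreover have "tuple_rep nat_rep (bsnd (answers s)) (map (\<lambda>p. if p = (\<lambda>_. 0) then 1 else 0) qs)"
    using ans(1) claim lpo_count by (auto simp: tuple_rep_def nat_rep_def answers_def s_def)
  ultimately show "\<exists>y. prod_rep cantor_rep (tuple_rep nat_rep)
      (answers (bpair q (F (game_name (Suc n) q)))) y \<and> y \<in> ?f z"
    unfolding zA s_def g_def prod_rep_def
    by (intro exI[of _ "(\<lambda>j. play (calm (bpair q (F (game_name (Suc n) q)))) (2 * lpo_count q + 2 * j),
      map (\<lambda>p. if p = (\<lambda>_. 0) then 1 else 0) qs)"]) simp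
qed

theorem theorem30:
  fixes n :: nat
  shows "NE_ap (n + 1) \<equiv>\<^sub>W prod_prob (jump_prob n C_cantor) (star_prob (jump_prob n LPO))"
  unfolding weihrauch_eq_def using NE_ap_le le_NE_ap by simp

end
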